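(* Let $\mathbb{K}$ be a field with $\operatorname{char}(\mathbb{K})=0$, let $G$ be a finite group acting on a nonempty set $E$, let $D=G\times E$ be the associated generalized digroup, and let $Q,W\in\mathsf{Rep}(D)$. Then the spectral sequence $$E_2^{p,q}\cong H^p\bigl(G,\operatorname{Ext}^q_{B_E}(Q,W)\bigr)\Longrightarrow\operatorname{Ext}^{p+q}_{\mathsf{Rep}(D)}(Q,W)$$ (the Grothendieck spectral sequence of the composite of $\operatorname{Hom}_{B_E}(Q,-):\mathsf{Rep}(D)\to\mathbb{K}G\text{-}\mathsf{Mod}$ with the invariants functor $(-)^G$) collapses at the $E_2$-page, and for every $n\ge 0$, $$\operatorname{Ext}^n_{\mathsf{Rep}(D)}(Q,W)\cong\operatorname{Ext}^n_{B_E}(Q,W)^G.$$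
   Context: Let $G$ be a group with identity $1$ acting on the left on a nonempty set $E$, $(g,\alpha)\mapsto g\bullet\alpha$. The associated generalized digroup is $D=G\times E$ with operations $(g,\alpha)\vdash(h,\beta)=(gh,g\bullet\beta)$, $(g,\alpha)\dashv(h,\beta)=(gh,\alpha)$ and halo $\overline{E}=\{(1,\alpha)\mid\alpha\in E\}$. (Every generalized digroup is isomorphic to one of this form.) A representation of $D$ over $\mathbb{K}$ is a triple $(V,\lambda,\rho)$ where $V$ is a $\mathbb{K}$-vector space and $\lambda:D\to\operatorname{End}(V)$, $\rho:D\to\operatorname{Aut}(V)$ are maps such that for all $x,y\in D$ and $e\in\overline{E}$: $\lambda_{x\dashv y}=\lambda_x\lambda_y$, $\rho_{x\vdash y}=\rho_x\rho_y$, $\rho_e=\mathrm{id}_V$, $\rho_x\lambda_y=\lambda_{x\vdash y}$, $\lambda_x\rho_y=\lambda_{x\dashv y}$. A morphism of representations is a $\mathbb{K}$-linear map commuting with all $\lambda_x$ and $\rho_x$. These form the category $\mathsf{Rep}(D)$, which is abelian with enough injectives. For any representation, $\rho_{(g,\alpha)}$ depends only on $g$, is written $\rho_g$, and $g\mapsto\rho_g$ is a representation of $G$. The halo algebra $B_E$ is the unital associative $\mathbb{K}$-algebra generated by symbols $\varepsilon_\alpha$ ($\alpha\in E$) subject to $\varepsilon_\alpha\varepsilon_\beta=\varepsilon_\alpha$ for all $\alpha,\beta\in E$. Every representation $(V,\lambda,\rho)$ is a left $B_E$-module via $\varepsilon_\alpha\cdot v=\lambda_{(1,\alpha)}(v)$.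 The group $G$ acts on $\operatorname{Hom}_{B_E}(Q,W)$ by $(g\cdot f)(q)=\rho_g^W(f((\rho_g^Q)^{-1}(q)))$. The $G$-module structure on $\operatorname{Ext}^n_{B_E}(Q,W)$ is the one induced by this action on the complex $\operatorname{Hom}_{B_E}(Q,I^\bullet)$, where $W\to I^\bullet$ is an injective resolution in $\mathsf{Rep}(D)$, whose underlying complex of $B_E$-modules is an injective resolution of $W$ in $B_E\text{-}\mathsf{Mod}$. The superscript $G$ denotes $G$-invariants. *)

theory Defs
  imports "HOL-Algebra.Group_Action" "HOL-Algebra.QuotRing" "HOL-Algebra.Module"
begin

section \<open>Vector spaces with operators\<close>

text \<open>Representations of a digroup, modules over an algebra and modules over a group ring are all
  vector spaces with a family of operators, and their morphisms are the linear maps commuting with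
  these operators. Hom spaces, injectivity and cohomology are defined once, for all three categories.
  The multiplicative fields that the record \<^type>\<open>module\<close> inherits from rings play no role here,
  except for algebras.\<close>

record ('k, 'v, 'x) opmod = "('k, 'v) module" +
  opr :: "'x \<Rightarrow> 'v \<Rightarrow> 'v"

definition vspace ::
  "'v set \<Rightarrow> 'v \<Rightarrow> ('v \<Rightarrow> 'v \<Rightarrow> 'v) \<Rightarrow> ('k \<Rightarrow> 'v \<Rightarrow> 'v) \<Rightarrow> ('k, 'v) module"
  where "vspace C z a s =
    \<lparr>carrier = C, monoid.mult = (\<lambda>_ _. undefined), one = undefined, ring.zero = z, add = a, smult = s\<rparr>"

definition with_ops :: "('k, 'v) module \<Rightarrow> ('x \<Rightarrow> 'v \<Rightarrow> 'v) \<Rightarrow> ('k, 'v, 'x) opmod"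
  where "with_ops M T = module.extend M (opmod.fields T)"

definition linear_map ::
  "('k, 'a) ring_scheme \<Rightarrow> ('k, 'v, 'b) module_scheme \<Rightarrow> ('k, 'w, 'c) module_scheme \<Rightarrow>
    ('v \<Rightarrow> 'w) \<Rightarrow> bool"
  where "linear_map K V W f \<longleftrightarrow>
    f \<in> carrier V \<rightarrow> carrier W \<and>
    (\<forall>x\<in>carrier V. \<forall>y\<in>carrier V. f (x \<oplus>\<^bsub>V\<^esub> y) = f x \<oplus>\<^bsub>W\<^esub> f y) \<and>
    (\<forall>k\<in>carrier K. \<forall>x\<in>carrier V. f (k \<odot>\<^bsub>V\<^esub> x) = k \<odot>\<^bsub>W\<^esub> f x)"

definition lin_iso ::
  "('k, 'a) ring_scheme \<Rightarrow> ('k, 'v, 'b) module_scheme \<Rightarrow> ('k, 'w, 'c) module_scheme \<Rightarrow> bool"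
  where "lin_iso K V W \<longleftrightarrow> (\<exists>f. linear_map K V W f \<and> bij_betw f (carrier V) (carrier W))"

definition equivariant_map ::
  "('k, 'a) ring_scheme \<Rightarrow> 'x set \<Rightarrow> ('k, 'v, 'x) opmod \<Rightarrow> ('k, 'w, 'x) opmod \<Rightarrow>
    ('v \<Rightarrow> 'w) \<Rightarrow> bool"
  where "equivariant_map K S V W f \<longleftrightarrow>
    linear_map K V W f \<and> (\<forall>x\<in>S. \<forall>v\<in>carrier V. f (opr V x v) = opr W x (f v))"

definition hom_space ::
  "('k, 'a) ring_scheme \<Rightarrow> 'x set \<Rightarrow> ('k, 'v, 'x) opmod \<Rightarrow> ('k, 'w, 'x) opmod \<Rightarrow>
    ('k, 'v \<Rightarrow> 'w) module"
  where "hom_space K S V W = vspace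
    {f \<in> extensional (carrier V). equivariant_map K S V W f}
    (\<lambda>v\<in>carrier V. \<zero>\<^bsub>W\<^esub>)
    (\<lambda>f g. \<lambda>v\<in>carrier V. f v \<oplus>\<^bsub>W\<^esub> g v)
    (\<lambda>k f. \<lambda>v\<in>carrier V. k \<odot>\<^bsub>W\<^esub> f v)"

text \<open>The space \<open>Z / B\<close> of cosets, for subspaces \<open>B \<subseteq> Z\<close> of \<open>V\<close>.\<close>

definition subquotient :: "('k, 'v, 'b) module_scheme \<Rightarrow> 'v set \<Rightarrow> 'v set \<Rightarrow> ('k, 'v set) module"
  where "subquotient V Z B = vspace
    {B +>\<^bsub>V\<^esub> z | z. z \<in> Z} B (set_add V) (\<lambda>k Y. \<Union>x\<in>Y. B +>\<^bsub>V\<^esub> (k \<odot>\<^bsub>V\<^esub> x))"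


section \<open>Cochain complexes in nonnegative degrees\<close>

definition cocycles ::
  "(nat \<Rightarrow> ('k, 'v, 'b) module_scheme) \<Rightarrow> (nat \<Rightarrow> 'v \<Rightarrow> 'v) \<Rightarrow> nat \<Rightarrow> 'v set"
  where "cocycles C d n = {x \<in> carrier (C n). d n x = \<zero>\<^bsub>C (Suc n)\<^esub>}"

definition coboundaries ::
  "(nat \<Rightarrow> ('k, 'v, 'b) module_scheme) \<Rightarrow> (nat \<Rightarrow> 'v \<Rightarrow> 'v) \<Rightarrow> nat \<Rightarrow> 'v set"
  where "coboundaries C d n =
    (case n of 0 \<Rightarrow> {\<zero>\<^bsub>C 0\<^esub>} | Suc m \<Rightarrow> d m ` carrier (C m))"

definition cohomology ::
  "(nat \<Rightarrow> ('k, 'v, 'b) module_scheme) \<Rightarrow> (nat \<Rightarrow> 'v \<Rightarrow> 'v) \<Rightarrow> nat \<Rightarrow> ('k, 'v set) module"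
  where "cohomology C d n = subquotient (C n) (cocycles C d n) (coboundaries C d n)"

definition cohomology_ops ::
  "(nat \<Rightarrow> ('k, 'v, 'x) opmod) \<Rightarrow> (nat \<Rightarrow> 'v \<Rightarrow> 'v) \<Rightarrow> nat \<Rightarrow> ('k, 'v set, 'x) opmod"
  where "cohomology_ops C d n = with_ops (cohomology C d n)
    (\<lambda>x Y. \<Union>v\<in>Y. coboundaries C d n +>\<^bsub>C n\<^esub> opr (C n) x v)"

definition coboundary_space ::
  "(nat \<Rightarrow> ('k, 'v, 'x) opmod) \<Rightarrow> (nat \<Rightarrow> 'v \<Rightarrow> 'v) \<Rightarrow> nat \<Rightarrow> ('k, 'v, 'x) opmod"
  where "coboundary_space C d n = (C n)\<lparr>carrier := coboundaries C d n\<rparr>"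

text \<open>The map on cohomology in degree \<open>n\<close>, with target the cohomology of \<open>(C, d)\<close>, induced by
  the degree \<open>n\<close> component \<open>f\<close> of a chain map.\<close>

definition cohomology_map ::
  "(nat \<Rightarrow> ('k, 'w, 'b) module_scheme) \<Rightarrow> (nat \<Rightarrow> 'w \<Rightarrow> 'w) \<Rightarrow> nat \<Rightarrow> ('v \<Rightarrow> 'w) \<Rightarrow>
    'v set \<Rightarrow> 'w set"
  where "cohomology_map C d n f Y = (\<Union>x\<in>Y. coboundaries C d n +>\<^bsub>C n\<^esub> f x)"


section \<open>Injective objects and injective resolutions\<close>

text \<open>HOL cannot quantify over types, so injectivity is tested against the objects (\<open>T\<close>) whose
  carrier lies in a given type, which serves as the universe of sets. Every result is stated for an
  arbitrary universe; by Baer's criterion, a universe at least as large as the acting algebra yields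
  injectivity in the usual sense.\<close>

definition injective_object ::
  "('k, 'a) ring_scheme \<Rightarrow> 'x set \<Rightarrow> (('k, 't, 'x) opmod \<Rightarrow> bool) \<Rightarrow> ('k, 'v, 'x) opmod \<Rightarrow> bool"
  where "injective_object K S T M \<longleftrightarrow>
    (\<forall>A B i f. T A \<and> T B \<and>
      equivariant_map K S A B i \<and> inj_on i (carrier A) \<and> equivariant_map K S A M f \<longrightarrow>
      (\<exists>h. equivariant_map K S B M h \<and> (\<forall>a\<in>carrier A. h (i a) = f a)))"

text \<open>\<open>0 \<rightarrow> M \<rightarrow> R 0 \<rightarrow> R 1 \<rightarrow> \<dots>\<close> is exact with augmentation \<open>\<eta>\<close> and
  differentials \<open>d\<close>, and every \<open>R n\<close> is an injective object of the category given by \<open>P\<close>.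
  The predicates \<open>P\<close> and \<open>T\<close> describe the same category, with carriers in possibly
  different types.\<close>

definition injective_resolution ::
  "('k, 'a) ring_scheme \<Rightarrow> 'x set \<Rightarrow> (('k, 'v, 'x) opmod \<Rightarrow> bool) \<Rightarrow> (('k, 't, 'x) opmod \<Rightarrow> bool) \<Rightarrow>
    ('k, 'w, 'x) opmod \<Rightarrow> ('w \<Rightarrow> 'v) \<Rightarrow> (nat \<Rightarrow> ('k, 'v, 'x) opmod) \<Rightarrow> (nat \<Rightarrow> 'v \<Rightarrow> 'v) \<Rightarrow> bool"
  where "injective_resolution K S P T M \<eta> R d \<longleftrightarrow>
    (\<forall>n. P (R n) \<and> injective_object K S T (R n)) \<and>
    equivariant_map K S M (R 0) \<eta> \<and>
    (\<forall>n. equivariant_map K S (R n) (R (Suc n)) (d n)) \<and>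
    inj_on \<eta> (carrier M) \<and>
    \<eta> ` carrier M = cocycles R d 0 \<and>
    (\<forall>n. d n ` carrier (R n) = cocycles R d (Suc n))"


section \<open>Representations of the generalized digroup of a group action\<close>

abbreviation digroup :: "('g, 'a) monoid_scheme \<Rightarrow> 'e set \<Rightarrow> ('g \<times> 'e) set"
  where "digroup G E \<equiv> carrier G \<times> E"

definition dg_vdash ::
  "('g, 'a) monoid_scheme \<Rightarrow> ('g \<Rightarrow> 'e \<Rightarrow> 'e) \<Rightarrow> 'g \<times> 'e \<Rightarrow> 'g \<times> 'e \<Rightarrow> 'g \<times> 'e"
  where "dg_vdash G \<phi> x y = (fst x \<otimes>\<^bsub>G\<^esub> fst y, \<phi> (fst x) (snd y))"

definition dg_dashv :: "('g, 'a) monoid_scheme \<Rightarrow> 'g \<times> 'e \<Rightarrow> 'g \<times> 'e \<Rightarrow> 'g \<times> 'e"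
  where "dg_dashv G x y = (fst x \<otimes>\<^bsub>G\<^esub> fst y, snd x)"

abbreviation halo :: "('g, 'a) monoid_scheme \<Rightarrow> 'e set \<Rightarrow> ('g \<times> 'e) set"
  where "halo G E \<equiv> {\<one>\<^bsub>G\<^esub>} \<times> E"

datatype 'd rep_sym = Lam 'd | Rho 'd

abbreviation lam :: "('k, 'v, 'd rep_sym) opmod \<Rightarrow> 'd \<Rightarrow> 'v \<Rightarrow> 'v"
  where "lam V x \<equiv> opr V (Lam x)"

abbreviation rho :: "('k, 'v, 'd rep_sym) opmod \<Rightarrow> 'd \<Rightarrow> 'v \<Rightarrow> 'v"
  where "rho V x \<equiv> opr V (Rho x)"

definition rep_syms :: "('g, 'a) monoid_scheme \<Rightarrow> 'e set \<Rightarrow> ('g \<times> 'e) rep_sym set"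
  where "rep_syms G E = Lam ` digroup G E \<union> Rho ` digroup G E"

definition digroup_rep ::
  "('k, 'a) ring_scheme \<Rightarrow> ('g, 'b) monoid_scheme \<Rightarrow> 'e set \<Rightarrow> ('g \<Rightarrow> 'e \<Rightarrow> 'e) \<Rightarrow>
    ('k, 'v, ('g \<times> 'e) rep_sym) opmod \<Rightarrow> bool"
  where "digroup_rep K G E \<phi> V \<longleftrightarrow>
    module K V \<and>
    (\<forall>x\<in>digroup G E. linear_map K V V (lam V x)) \<and>
    (\<forall>x\<in>digroup G E. linear_map K V V (rho V x) \<and> bij_betw (rho V x) (carrier V) (carrier V)) \<and>
    (\<forall>e\<in>halo G E. \<forall>v\<in>carrier V. rho V e v = v) \<and>
    (\<forall>x\<in>digroup G E. \<forall>y\<in>digroup G E. \<forall>v\<in>carrier V.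
      lam V (dg_dashv G x y) v = lam V x (lam V y v) \<and>
      rho V (dg_vdash G \<phi> x y) v = rho V x (rho V y v) \<and>
      rho V x (lam V y v) = lam V (dg_vdash G \<phi> x y) v \<and>
      lam V x (rho V y v) = lam V (dg_dashv G x y) v)"

text \<open>In a representation, \<open>\<rho>\<close> at \<open>(g, \<alpha>)\<close> does not depend on \<open>\<alpha>\<close>.\<close>

definition rho_grp ::
  "'e set \<Rightarrow> ('k, 'v, ('g \<times> 'e) rep_sym) opmod \<Rightarrow> 'g \<Rightarrow> 'v \<Rightarrow> 'v"
  where "rho_grp E V g = rho V (g, SOME \<alpha>. \<alpha> \<in> E)"

definition ext_rep ::
  "('k, 'a) ring_scheme \<Rightarrow> ('g, 'b) monoid_scheme \<Rightarrow> 'e set \<Rightarrow>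
    ('k, 'v, ('g \<times> 'e) rep_sym) opmod \<Rightarrow> (nat \<Rightarrow> ('k, 'w, ('g \<times> 'e) rep_sym) opmod) \<Rightarrow>
    (nat \<Rightarrow> 'w \<Rightarrow> 'w) \<Rightarrow> nat \<Rightarrow> ('k, ('v \<Rightarrow> 'w) set) module"
  where "ext_rep K G E Q I d = cohomology
    (\<lambda>n. hom_space K (rep_syms G E) Q (I n)) (\<lambda>n. compose (carrier Q) (d n))"


section \<open>The halo algebra and its modules\<close>

text \<open>The free unital algebra on \<open>E\<close>: finitely supported functions on words, with the
  concatenation product, which at a word sums over all its splittings into two words.\<close>

definition free_algebra :: "('k, 'a) ring_scheme \<Rightarrow> 'e set \<Rightarrow> ('k, 'e list \<Rightarrow> 'k) module"
  where "free_algebra K E =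
    \<lparr>carrier = {f. range f \<subseteq> carrier K \<and> finite {w. f w \<noteq> \<zero>\<^bsub>K\<^esub>} \<and> {w. f w \<noteq> \<zero>\<^bsub>K\<^esub>} \<subseteq> lists E},
     monoid.mult = (\<lambda>f g w. \<Oplus>\<^bsub>K\<^esub>i\<in>{..length w}. f (take i w) \<otimes>\<^bsub>K\<^esub> g (drop i w)),
     one = (\<lambda>w. if w = [] then \<one>\<^bsub>K\<^esub> else \<zero>\<^bsub>K\<^esub>),
     ring.zero = (\<lambda>w. \<zero>\<^bsub>K\<^esub>),
     add = (\<lambda>f g w. f w \<oplus>\<^bsub>K\<^esub> g w),
     smult = (\<lambda>k f w. k \<otimes>\<^bsub>K\<^esub> f w)\<rparr>"

definition free_gen :: "('k, 'a) ring_scheme \<Rightarrow> 'e \<Rightarrow> 'e list \<Rightarrow> 'k"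
  where "free_gen K \<alpha> = (\<lambda>w. if w = [\<alpha>] then \<one>\<^bsub>K\<^esub> else \<zero>\<^bsub>K\<^esub>)"

definition halo_ideal :: "('k, 'a) ring_scheme \<Rightarrow> 'e set \<Rightarrow> ('e list \<Rightarrow> 'k) set"
  where "halo_ideal K E = Idl\<^bsub>free_algebra K E\<^esub>
    {free_gen K \<alpha> \<otimes>\<^bsub>free_algebra K E\<^esub> free_gen K \<beta> \<ominus>\<^bsub>free_algebra K E\<^esub> free_gen K \<alpha> | \<alpha> \<beta>.
      \<alpha> \<in> E \<and> \<beta> \<in> E}"

definition halo_algebra :: "('k, 'a) ring_scheme \<Rightarrow> 'e set \<Rightarrow> ('k, ('e list \<Rightarrow> 'k) set) module"
  where "halo_algebra K E = ring.extend (free_algebra K E Quot halo_ideal K E)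
    (module.fields (\<lambda>k Y. \<Union>f\<in>Y. halo_ideal K E +>\<^bsub>free_algebra K E\<^esub> (k \<odot>\<^bsub>free_algebra K E\<^esub> f)))"

definition algebra_module ::
  "('k, 'a) ring_scheme \<Rightarrow> ('k, 'b) module \<Rightarrow> ('k, 'v, 'b) opmod \<Rightarrow> bool"
  where "algebra_module K B V \<longleftrightarrow>
    module K V \<and>
    (\<forall>b\<in>carrier B. linear_map K V V (opr V b)) \<and>
    (\<forall>v\<in>carrier V. opr V \<one>\<^bsub>B\<^esub> v = v) \<and>
    (\<forall>a\<in>carrier B. \<forall>b\<in>carrier B. \<forall>v\<in>carrier V.
      opr V (a \<otimes>\<^bsub>B\<^esub> b) v = opr V a (opr V b v) \<and>
      opr V (a \<oplus>\<^bsub>B\<^esub> b) v = opr V a v \<oplus>\<^bsub>V\<^esub> opr V b v) \<and>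
    (\<forall>k\<in>carrier K. \<forall>b\<in>carrier B. \<forall>v\<in>carrier V. opr V (k \<odot>\<^bsub>B\<^esub> b) v = k \<odot>\<^bsub>V\<^esub> opr V b v)"

text \<open>The free algebra acts on a representation with the generator \<open>\<alpha>\<close> acting as \<open>\<lambda>\<close> at
  \<open>(1, \<alpha>)\<close>. The halo ideal acts as zero, so that a class of the halo algebra acts through any
  representative.\<close>

definition free_act ::
  "('k, 'a) ring_scheme \<Rightarrow> ('g, 'b) monoid_scheme \<Rightarrow> ('k, 'v, ('g \<times> 'e) rep_sym) opmod \<Rightarrow>
    ('e list \<Rightarrow> 'k) \<Rightarrow> 'v \<Rightarrow> 'v"
  where "free_act K G V f v =
    (\<Oplus>\<^bsub>V\<^esub>w\<in>{w. f w \<noteq> \<zero>\<^bsub>K\<^esub>}. f w \<odot>\<^bsub>V\<^esub> foldr (\<lambda>\<alpha>. lam V (\<one>\<^bsub>G\<^esub>, \<alpha>)) w v)"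

definition halo_module ::
  "('k, 'a) ring_scheme \<Rightarrow> ('g, 'b) monoid_scheme \<Rightarrow> ('k, 'v, ('g \<times> 'e) rep_sym) opmod \<Rightarrow>
    ('k, 'v, ('e list \<Rightarrow> 'k) set) opmod"
  where "halo_module K G V =
    with_ops (module.truncate V) (\<lambda>Y. free_act K G V (SOME f. f \<in> Y))"

definition hom_halo ::
  "('k, 'a) ring_scheme \<Rightarrow> ('g, 'b) monoid_scheme \<Rightarrow> 'e set \<Rightarrow>
    ('k, 'v, ('g \<times> 'e) rep_sym) opmod \<Rightarrow> ('k, 'w, ('g \<times> 'e) rep_sym) opmod \<Rightarrow>
    ('k, 'v \<Rightarrow> 'w, 'g) opmod"
  where "hom_halo K G E Q W = with_ops
    (hom_space K (carrier (halo_algebra K E)) (halo_module K G Q) (halo_module K G W))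
    (\<lambda>g f. \<lambda>q\<in>carrier Q. rho_grp E W g (f (inv_into (carrier Q) (rho_grp E Q g) q)))"

definition ext_halo ::
  "('k, 'a) ring_scheme \<Rightarrow> ('g, 'b) monoid_scheme \<Rightarrow> 'e set \<Rightarrow>
    ('k, 'v, ('g \<times> 'e) rep_sym) opmod \<Rightarrow> (nat \<Rightarrow> ('k, 'w, ('g \<times> 'e) rep_sym) opmod) \<Rightarrow>
    (nat \<Rightarrow> 'w \<Rightarrow> 'w) \<Rightarrow> nat \<Rightarrow> ('k, ('v \<Rightarrow> 'w) set, 'g) opmod"
  where "ext_halo K G E Q I d = cohomology_ops
    (\<lambda>n. hom_halo K G E Q (I n)) (\<lambda>n. compose (carrier Q) (d n))"


section \<open>Modules over the group algebra and group cohomology\<close>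

definition group_module ::
  "('k, 'a) ring_scheme \<Rightarrow> ('g, 'b) monoid_scheme \<Rightarrow> ('k, 'v, 'g) opmod \<Rightarrow> bool"
  where "group_module K G M \<longleftrightarrow>
    module K M \<and>
    (\<forall>g\<in>carrier G. linear_map K M M (opr M g)) \<and>
    (\<forall>v\<in>carrier M. opr M \<one>\<^bsub>G\<^esub> v = v) \<and>
    (\<forall>g\<in>carrier G. \<forall>h\<in>carrier G. \<forall>v\<in>carrier M. opr M (g \<otimes>\<^bsub>G\<^esub> h) v = opr M g (opr M h v))"

definition fixed_space ::
  "('g, 'b) monoid_scheme \<Rightarrow> ('k, 'v, 'g) opmod \<Rightarrow> ('k, 'v, 'g) opmod"
  where "fixed_space G M =
    M\<lparr>carrier := {v \<in> carrier M. \<forall>g\<in>carrier G. opr M g v = v}\<rparr>"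

definition sgn_mult :: "('k, 'v, 'b) module_scheme \<Rightarrow> nat \<Rightarrow> 'v \<Rightarrow> 'v"
  where "sgn_mult M i v = (if even i then v else \<ominus>\<^bsub>M\<^esub> v)"

definition tuples :: "('g, 'b) monoid_scheme \<Rightarrow> nat \<Rightarrow> 'g list set"
  where "tuples G n = {gs \<in> lists (carrier G). length gs = n}"

definition cochains ::
  "('g, 'b) monoid_scheme \<Rightarrow> ('k, 'v, 'g) opmod \<Rightarrow> nat \<Rightarrow> ('k, 'g list \<Rightarrow> 'v) module"
  where "cochains G M n = vspace
    (tuples G n \<rightarrow>\<^sub>E carrier M)
    (\<lambda>gs\<in>tuples G n. \<zero>\<^bsub>M\<^esub>)
    (\<lambda>f f'. \<lambda>gs\<in>tuples G n. f gs \<oplus>\<^bsub>M\<^esub> f' gs)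
    (\<lambda>k f. \<lambda>gs\<in>tuples G n. k \<odot>\<^bsub>M\<^esub> f gs)"

text \<open>Inhomogeneous cochains:
  \<open>(d f)(g\<^sub>1, \<dots>, g\<^sub>n\<^sub>+\<^sub>1) = g\<^sub>1 f(g\<^sub>2, \<dots>, g\<^sub>n\<^sub>+\<^sub>1)
    + (\<Sum>i=1..n. (-1)\<^sup>i f(\<dots>, g\<^sub>i g\<^sub>i\<^sub>+\<^sub>1, \<dots>)) + (-1)\<^sup>n\<^sup>+\<^sup>1 f(g\<^sub>1, \<dots>, g\<^sub>n)\<close>.\<close>

definition cochain_d ::
  "('g, 'b) monoid_scheme \<Rightarrow> ('k, 'v, 'g) opmod \<Rightarrow> nat \<Rightarrow> ('g list \<Rightarrow> 'v) \<Rightarrow> 'g list \<Rightarrow> 'v"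
  where "cochain_d G M n f = (\<lambda>gs\<in>tuples G (Suc n).
    opr M (hd gs) (f (tl gs)) \<oplus>\<^bsub>M\<^esub>
    (\<Oplus>\<^bsub>M\<^esub>i\<in>{1..n}. sgn_mult M i
      (f (take (i - 1) gs @ (gs ! (i - 1) \<otimes>\<^bsub>G\<^esub> gs ! i) # drop (i + 1) gs))) \<oplus>\<^bsub>M\<^esub>
    sgn_mult M (Suc n) (f (butlast gs)))"

definition group_cohomology ::
  "('g, 'b) monoid_scheme \<Rightarrow> ('k, 'v, 'g) opmod \<Rightarrow> nat \<Rightarrow> ('k, ('g list \<Rightarrow> 'v) set) module"
  where "group_cohomology G M = cohomology (cochains G M) (cochain_d G M)"


section \<open>The Grothendieck spectral sequence\<close>

text \<open>A Cartan--Eilenberg resolution of a complex \<open>(C, \<delta>)\<close> of modules over the group algebra: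
  \<open>J p q\<close> has resolution degree \<open>p\<close> and complex degree \<open>q\<close>, with differentials \<open>dv\<close>
  raising \<open>p\<close> and \<open>dh\<close> raising \<open>q\<close>. The squares commute; the sign is put into the total
  complex.\<close>

definition cartan_eilenberg ::
  "('k, 'a) ring_scheme \<Rightarrow> ('g, 'b) monoid_scheme \<Rightarrow>
    (nat \<Rightarrow> ('k, 'c, 'g) opmod) \<Rightarrow> (nat \<Rightarrow> 'c \<Rightarrow> 'c) \<Rightarrow>
    (nat \<Rightarrow> 'c \<Rightarrow> 'm) \<Rightarrow> (nat \<Rightarrow> nat \<Rightarrow> ('k, 'm, 'g) opmod) \<Rightarrow>
    (nat \<Rightarrow> nat \<Rightarrow> 'm \<Rightarrow> 'm) \<Rightarrow> (nat \<Rightarrow> nat \<Rightarrow> 'm \<Rightarrow> 'm) \<Rightarrow> bool"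
  where "cartan_eilenberg K G C \<delta> \<epsilon> J dv dh \<longleftrightarrow>
    (let T = (group_module K G :: ('k, 'm, 'g) opmod \<Rightarrow> bool) in
    (\<forall>p q. group_module K G (J p q) \<and> injective_object K (carrier G) T (J p q)) \<and>
    (\<forall>q. equivariant_map K (carrier G) (C q) (J 0 q) (\<epsilon> q)) \<and>
    (\<forall>p q. equivariant_map K (carrier G) (J p q) (J (Suc p) q) (dv p q)) \<and>
    (\<forall>p q. equivariant_map K (carrier G) (J p q) (J p (Suc q)) (dh p q)) \<and>
    (\<forall>q. \<forall>x\<in>carrier (C q).
      \<epsilon> (Suc q) (\<delta> q x) = dh 0 q (\<epsilon> q x) \<and> dv 0 q (\<epsilon> q x) = \<zero>\<^bsub>J 1 q\<^esub>) \<and>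
    (\<forall>p q. \<forall>x\<in>carrier (J p q).
      dv (Suc p) q (dv p q x) = \<zero>\<^bsub>J (Suc (Suc p)) q\<^esub> \<and>
      dh p (Suc q) (dh p q x) = \<zero>\<^bsub>J p (Suc (Suc q))\<^esub> \<and>
      dv p (Suc q) (dh p q x) = dh (Suc p) q (dv p q x)) \<and>
    (\<forall>q. carrier (C q) = {\<zero>\<^bsub>C q\<^esub>} \<longrightarrow> (\<forall>p. carrier (J p q) = {\<zero>\<^bsub>J p q\<^esub>})) \<and>
    (\<forall>q. injective_resolution K (carrier G) (group_module K G) T
      (coboundary_space C \<delta> q) (\<epsilon> q)
      (\<lambda>p. coboundary_space (J p) (dh p) q) (\<lambda>p. dv p q)) \<and>
    (\<forall>q. injective_resolution K (carrier G) (group_module K G) T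
      (cohomology_ops C \<delta> q) (cohomology_map (J 0) (dh 0) q (\<epsilon> q))
      (\<lambda>p. cohomology_ops (J p) (dh p) q)
      (\<lambda>p. cohomology_map (J (Suc p)) (dh (Suc p)) q (dv p q))))"

text \<open>The total complex of a first quadrant double complex \<open>A\<close>. Total degree, filtration degree
  and page number are integers, so that the usual formulas need no case distinctions; the
  total complex vanishes in negative degrees. An element \<open>x\<close> of total degree \<open>n\<close> has components
  \<open>x p \<in> A p (n - p)\<close>.\<close>

definition tot :: "(nat \<Rightarrow> nat \<Rightarrow> ('k, 'm, 'b) module_scheme) \<Rightarrow> int \<Rightarrow> ('k, int \<Rightarrow> 'm) module"
  where "tot A n = vspace
    (\<Pi>\<^sub>E p\<in>{0..n}. carrier (A (nat p) (nat (n - p))))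
    (\<lambda>p\<in>{0..n}. \<zero>\<^bsub>A (nat p) (nat (n - p))\<^esub>)
    (\<lambda>x y. \<lambda>p\<in>{0..n}. x p \<oplus>\<^bsub>A (nat p) (nat (n - p))\<^esub> y p)
    (\<lambda>k x. \<lambda>p\<in>{0..n}. k \<odot>\<^bsub>A (nat p) (nat (n - p))\<^esub> x p)"

definition tot_d ::
  "(nat \<Rightarrow> nat \<Rightarrow> ('k, 'm, 'b) module_scheme) \<Rightarrow> (nat \<Rightarrow> nat \<Rightarrow> 'm \<Rightarrow> 'm) \<Rightarrow>
    (nat \<Rightarrow> nat \<Rightarrow> 'm \<Rightarrow> 'm) \<Rightarrow> int \<Rightarrow> (int \<Rightarrow> 'm) \<Rightarrow> (int \<Rightarrow> 'm)"
  where "tot_d A dv dh n x = (\<lambda>p\<in>{0..n + 1}. let M = A (nat p) (nat (n + 1 - p)) in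
    (if p = 0 then \<zero>\<^bsub>M\<^esub> else dv (nat (p - 1)) (nat (n + 1 - p)) (x (p - 1))) \<oplus>\<^bsub>M\<^esub>
    (if p = n + 1 then \<zero>\<^bsub>M\<^esub> else sgn_mult M (nat p) (dh (nat p) (nat (n - p)) (x p))))"

definition tot_filt ::
  "(nat \<Rightarrow> nat \<Rightarrow> ('k, 'm, 'b) module_scheme) \<Rightarrow> int \<Rightarrow> int \<Rightarrow> (int \<Rightarrow> 'm) set"
  where "tot_filt A s n =
    {x \<in> carrier (tot A n). \<forall>p\<in>{0..n}. p < s \<longrightarrow> x p = \<zero>\<^bsub>A (nat p) (nat (n - p))\<^esub>}"

text \<open>The spectral sequence of the total complex filtered by \<open>p\<close>:
  \<open>E\<^sub>r\<^sup>p\<^sup>q = Z\<^sub>r\<^sup>p / (Z\<^sub>r\<^sub>-\<^sub>1\<^sup>p\<^sup>+\<^sup>1 + D Z\<^sub>r\<^sub>-\<^sub>1\<^sup>p\<^sup>-\<^sup>r\<^sup>+\<^sup>1)\<close>, where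
  \<open>Z\<^sub>r\<^sup>p = {x \<in> F\<^sup>p. D x \<in> F\<^sup>p\<^sup>+\<^sup>r}\<close>, with differential induced by \<open>D\<close>.\<close>

definition ss_cycles ::
  "(nat \<Rightarrow> nat \<Rightarrow> ('k, 'm, 'b) module_scheme) \<Rightarrow> (nat \<Rightarrow> nat \<Rightarrow> 'm \<Rightarrow> 'm) \<Rightarrow>
    (nat \<Rightarrow> nat \<Rightarrow> 'm \<Rightarrow> 'm) \<Rightarrow> int \<Rightarrow> int \<Rightarrow> int \<Rightarrow> (int \<Rightarrow> 'm) set"
  where "ss_cycles A dv dh r p q =
    {x \<in> tot_filt A p (p + q). tot_d A dv dh (p + q) x \<in> tot_filt A (p + r) (p + q + 1)}"

definition ss_boundaries ::
  "(nat \<Rightarrow> nat \<Rightarrow> ('k, 'm, 'b) module_scheme) \<Rightarrow> (nat \<Rightarrow> nat \<Rightarrow> 'm \<Rightarrow> 'm) \<Rightarrow>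
    (nat \<Rightarrow> nat \<Rightarrow> 'm \<Rightarrow> 'm) \<Rightarrow> int \<Rightarrow> int \<Rightarrow> int \<Rightarrow> (int \<Rightarrow> 'm) set"
  where "ss_boundaries A dv dh r p q =
    ss_cycles A dv dh (r - 1) (p + 1) (q - 1) <+>\<^bsub>tot A (p + q)\<^esub>
    tot_d A dv dh (p + q - 1) ` ss_cycles A dv dh (r - 1) (p - r + 1) (q + r - 2)"

definition ss_page ::
  "(nat \<Rightarrow> nat \<Rightarrow> ('k, 'm, 'b) module_scheme) \<Rightarrow> (nat \<Rightarrow> nat \<Rightarrow> 'm \<Rightarrow> 'm) \<Rightarrow>
    (nat \<Rightarrow> nat \<Rightarrow> 'm \<Rightarrow> 'm) \<Rightarrow> int \<Rightarrow> int \<Rightarrow> int \<Rightarrow> ('k, (int \<Rightarrow> 'm) set) module"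
  where "ss_page A dv dh r p q =
    subquotient (tot A (p + q)) (ss_cycles A dv dh r p q) (ss_boundaries A dv dh r p q)"

definition ss_diff ::
  "(nat \<Rightarrow> nat \<Rightarrow> ('k, 'm, 'b) module_scheme) \<Rightarrow> (nat \<Rightarrow> nat \<Rightarrow> 'm \<Rightarrow> 'm) \<Rightarrow>
    (nat \<Rightarrow> nat \<Rightarrow> 'm \<Rightarrow> 'm) \<Rightarrow> int \<Rightarrow> int \<Rightarrow> int \<Rightarrow> (int \<Rightarrow> 'm) set \<Rightarrow> (int \<Rightarrow> 'm) set"
  where "ss_diff A dv dh r p q Y = (\<Union>x\<in>Y.
    ss_boundaries A dv dh r (p + r) (q - r + 1) +>\<^bsub>tot A (p + q + 1)\<^esub> tot_d A dv dh (p + q) x)"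

definition collapses_at ::
  "(int \<Rightarrow> int \<Rightarrow> int \<Rightarrow> ('k, 'v) module) \<Rightarrow> (int \<Rightarrow> int \<Rightarrow> int \<Rightarrow> 'v \<Rightarrow> 'v) \<Rightarrow> int \<Rightarrow> bool"
  where "collapses_at Er dr s \<longleftrightarrow>
    (\<forall>r\<ge>s. \<forall>p q. \<forall>Y\<in>carrier (Er r p q). dr r p q Y = \<zero>\<^bsub>Er r (p + r) (q - r + 1)\<^esub>)"

text \<open>Convergence of a first quadrant spectral sequence; \<open>E\<^sub>r\<^sup>p\<^sup>q\<close> is the limit term as soon as
  \<open>r \<ge> p + q + 2\<close>.\<close>

definition converges_to ::
  "('k, 'a) ring_scheme \<Rightarrow> (int \<Rightarrow> int \<Rightarrow> int \<Rightarrow> ('k, 'v) module) \<Rightarrow>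
    (nat \<Rightarrow> ('k, 'w) module) \<Rightarrow> bool"
  where "converges_to K Er H \<longleftrightarrow>
    (\<forall>n. \<exists>F. F 0 = carrier (H n) \<and> F (Suc n) = {\<zero>\<^bsub>H n\<^esub>} \<and>
      (\<forall>p. submodule (F p) K (H n) \<and> F (Suc p) \<subseteq> F p) \<and>
      (\<forall>p\<le>n. \<forall>r\<ge>int n + 2.
        lin_iso K (Er r (int p) (int n - int p)) (subquotient (H n) (F p) (F (Suc p)))))"

end

theory Submission
  imports Defs "HOL-Library.Equipollence"
begin

text \<open>Averaging over the finite group \<open>G\<close> in characteristic zero makes invariants exact on
  complexes of \<open>KG\<close>-modules, and each part of the theorem is a consequence of this or of an
  adjunction.

  A representation of the digroup is a representation of \<open>G\<close> with operators
  \<open>\<epsilon>\<^sub>\<alpha>\<close>, subject to \<open>\<epsilon>\<^sub>\<alpha> \<epsilon>\<^sub>\<beta> = \<epsilon>\<^sub>\<alpha>\<close>, that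
  \<open>G\<close> permutes. Hence the homomorphisms of representations are the \<open>G\<close>-invariant
  homomorphisms of modules over the halo algebra (\<open>invariant_hom\<close>), and the complex that
  computes \<open>Ext\<close> of representations is the invariant part of the complex that computes
  \<open>Ext\<close> over the halo algebra. As averaging commutes with the differentials, cohomology
  commutes with invariants (\<open>invariant_cohomology\<close>), which is the isomorphism of the two
  kinds of \<open>Ext\<close>.

  Restriction from representations to the halo algebra has the exact left adjoint
  \<open>A \<mapsto> KG \<otimes> A\<close>, so it preserves injective objects (\<open>halo_injective\<close>). As injectivity
  refers to the carriers in one type, the induced representation has to be moved into this type:
  a nonzero vector space over \<open>K\<close> is infinite, so that its finite powers embed into it
  (\<open>functions_embed\<close>).

  The spectral sequence is that of the invariants of a Cartan--Eilenberg resolution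
  \<open>J\<close>, filtered by rows. The horizontal cohomology of \<open>J\<close> resolves that of the given
  complex, and by averaging this persists for the invariants (\<open>invariants_resolved\<close>). A cycle
  of the second page in row \<open>p \<ge> 1\<close> thus has a leading entry that a differential from
  row \<open>p - 1\<close> hits, and it can be pushed into higher filtration
  (\<open>subtract_leading_entry\<close>): the pages vanish outside of row zero. Row zero is the
  cohomology of the invariant complex, by the edge map (\<open>edge_iso\<close>). This gives the collapse
  and the convergence. It also identifies the second page, because \<open>H\<^sup>p(G, M)\<close> is zero for
  \<open>p > 0\<close>, by averaging cochains over their last argument (\<open>group_cohomology_pos\<close>), and
  the space of invariants for \<open>p = 0\<close>.\<close>

section \<open>Vector spaces, linear maps and subquotients\<close>

lemma vspace_simps [simp]:
  "carrier (vspace C z a s) = C"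
  "zero (vspace C z a s) = z"
  "add (vspace C z a s) = a"
  "smult (vspace C z a s) = s"
  by (simp_all add: vspace_def)

lemma with_ops_simps [simp]:
  "carrier (with_ops M T) = carrier M"
  "zero (with_ops M T) = zero M"
  "add (with_ops M T) = add M"
  "smult (with_ops M T) = smult M"
  "opr (with_ops M T) = T"
  by (simp_all add: with_ops_def module.defs opmod.defs)

lemma truncate_simps [simp]:
  "carrier (module.truncate M) = carrier M"
  "zero (module.truncate M) = zero M"
  "add (module.truncate M) = add M"
  "smult (module.truncate M) = smult M"
  by (simp_all add: module.defs)

lemma (in abelian_group) minus_eq_zero_iff:
  assumes "x \<in> carrier G" "y \<in> carrier G"
  shows "x \<ominus> y = \<zero> \<longleftrightarrow> x = y"
  using assms by (metis a_minus_def add.inv_closed add.inv_equality minus_minus r_neg)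

lemma abelian_group_cong:
  assumes "abelian_group V" "carrier V = carrier W" "add V = add W" "zero V = zero W"
  shows "abelian_group W"
proof -
  interpret abelian_group V by fact
  show ?thesis
    using assms(2-4)
    by (intro abelian_groupI)
      (metis a_closed zero_closed a_assoc a_comm l_zero l_neg a_inv_closed)+
qed

lemma module_cong:
  assumes "module K V" "carrier V = carrier W" "add V = add W" "zero V = zero W" "smult V = smult W"
  shows "module K W"
proof -
  interpret module K V by fact
  show ?thesis
  proof (rule moduleI)
    show "cring K" ..
    show "abelian_group W"
      using abelian_group_cong[OF M.abelian_group_axioms] assms(2-4) by blast
  qed (use assms(2-5)[symmetric] in \<open>simp_all add: smult_l_distr smult_r_distr smult_assoc1\<close>)
qed

lemma linear_mapI:
  assumes "\<And>x. x \<in> carrier V \<Longrightarrow> f x \<in> carrier W"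
    and "\<And>x y. x \<in> carrier V \<Longrightarrow> y \<in> carrier V \<Longrightarrow> f (x \<oplus>\<^bsub>V\<^esub> y) = f x \<oplus>\<^bsub>W\<^esub> f y"
    and "\<And>k x. k \<in> carrier K \<Longrightarrow> x \<in> carrier V \<Longrightarrow> f (k \<odot>\<^bsub>V\<^esub> x) = k \<odot>\<^bsub>W\<^esub> f x"
  shows "linear_map K V W f"
  using assms by (auto simp: linear_map_def)

lemma linear_mapD:
  assumes "linear_map K V W f"
  shows "x \<in> carrier V \<Longrightarrow> f x \<in> carrier W"
    and "x \<in> carrier V \<Longrightarrow> y \<in> carrier V \<Longrightarrow> f (x \<oplus>\<^bsub>V\<^esub> y) = f x \<oplus>\<^bsub>W\<^esub> f y"
    and "k \<in> carrier K \<Longrightarrow> x \<in> carrier V \<Longrightarrow> f (k \<odot>\<^bsub>V\<^esub> x) = k \<odot>\<^bsub>W\<^esub> f x"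
  using assms by (auto simp: linear_map_def)

lemma linear_map_zero:
  assumes "module K V" "module K W" "linear_map K V W f"
  shows "f \<zero>\<^bsub>V\<^esub> = \<zero>\<^bsub>W\<^esub>"
proof -
  interpret V: module K V by fact
  interpret W: module K W by fact
  have "f (\<zero>\<^bsub>K\<^esub> \<odot>\<^bsub>V\<^esub> \<zero>\<^bsub>V\<^esub>) = \<zero>\<^bsub>K\<^esub> \<odot>\<^bsub>W\<^esub> f \<zero>\<^bsub>V\<^esub>"
    by (simp add: linear_mapD(3)[OF assms(3)] del: V.smult_l_null V.smult_r_null)
  then show ?thesis
    by (simp add: linear_mapD(1)[OF assms(3)])
qed

lemma linear_map_uminus:
  assumes "module K V" "module K W" "linear_map K V W f" "x \<in> carrier V"
  shows "f (\<ominus>\<^bsub>V\<^esub> x) = \<ominus>\<^bsub>W\<^esub> f x"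
proof -
  interpret V: module K V by fact
  interpret W: module K W by fact
  have "f (\<ominus>\<^bsub>V\<^esub> x) \<oplus>\<^bsub>W\<^esub> f x = f (\<ominus>\<^bsub>V\<^esub> x \<oplus>\<^bsub>V\<^esub> x)"
    using assms(4) by (simp add: linear_mapD(2)[OF assms(3)])
  also have "\<dots> = \<zero>\<^bsub>W\<^esub>"
    using assms(4) by (simp add: V.M.l_neg linear_map_zero[OF assms(1-3)])
  finally show ?thesis
    using assms(4) by (metis V.M.a_inv_closed W.M.minus_equality linear_mapD(1)[OF assms(3)])
qed

lemma linear_map_minus:
  assumes "module K V" "module K W" "linear_map K V W f" "x \<in> carrier V" "y \<in> carrier V"
  shows "f (x \<ominus>\<^bsub>V\<^esub> y) = f x \<ominus>\<^bsub>W\<^esub> f y"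
proof -
  interpret V: module K V by fact
  show ?thesis
    using assms(4,5) by (simp add: a_minus_def linear_mapD(2)[OF assms(3)] linear_map_uminus[OF assms(1-3)])
qed

lemma linear_map_finsum:
  assumes "module K V" "module K W" "linear_map K V W f" "finite A" "u \<in> A \<rightarrow> carrier V"
  shows "f (\<Oplus>\<^bsub>V\<^esub>i\<in>A. u i) = (\<Oplus>\<^bsub>W\<^esub>i\<in>A. f (u i))"
proof -
  interpret V: module K V by fact
  interpret W: module K W by fact
  show ?thesis
    using assms(4,5)
  proof (induction A rule: finite_induct)
    case empty
    then show ?case by (simp add: linear_map_zero[OF assms(1-3)])
  next
    case (insert a A)
    then have "u a \<in> carrier V" "u \<in> A \<rightarrow> carrier V" by auto
    moreover have "(\<lambda>i. f (u i)) \<in> A \<rightarrow> carrier W" "f (u a) \<in> carrier W"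
      using insert linear_mapD(1)[OF assms(3)] by auto
    ultimately show ?case
      using insert by (simp add: linear_mapD(2)[OF assms(3)])
  qed
qed

lemma linear_map_comp:
  assumes "linear_map K U V f" "linear_map K V W g"
  shows "linear_map K U W (\<lambda>x. g (f x))"
  using assms by (auto simp: linear_map_def Pi_def)

lemma lin_iso_trans:
  assumes "lin_iso K U V" "lin_iso K V W"
  shows "lin_iso K U W"
proof -
  obtain f g where f: "linear_map K U V f" "bij_betw f (carrier U) (carrier V)"
    and g: "linear_map K V W g" "bij_betw g (carrier V) (carrier W)"
    using assms by (auto simp: lin_iso_def)
  have "linear_map K U W (g \<circ> f)"
    using linear_map_comp[OF f(1) g(1)] by (simp add: comp_def)
  then show ?thesis
    using bij_betw_trans[OF f(2) g(2)] by (auto simp: lin_iso_def)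
qed

lemma lin_iso_sym:
  assumes "module K V" "lin_iso K V W"
  shows "lin_iso K W V"
proof -
  interpret module K V by fact
  obtain f where f: "linear_map K V W f" "bij_betw f (carrier V) (carrier W)"
    using assms by (auto simp: lin_iso_def)
  let ?g = "inv_into (carrier V) f"
  have g: "?g y \<in> carrier V" "f (?g y) = y" if "y \<in> carrier W" for y
    using that f(2) by (auto simp: bij_betw_def intro: inv_into_into f_inv_into_f)
  have g': "?g (f x) = x" if "x \<in> carrier V" for x
    using that f(2) by (auto simp: bij_betw_def)
  have "linear_map K W V ?g"
  proof (rule linear_mapI)
    fix x y assume "x \<in> carrier W" "y \<in> carrier W"
    then have "?g (x \<oplus>\<^bsub>W\<^esub> y) = ?g (f (?g x \<oplus>\<^bsub>V\<^esub> ?g y))"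
      using g linear_mapD(2)[OF f(1), of "?g x" "?g y"] by simp
    then show "?g (x \<oplus>\<^bsub>W\<^esub> y) = ?g x \<oplus>\<^bsub>V\<^esub> ?g y"
      using g' g \<open>x \<in> carrier W\<close> \<open>y \<in> carrier W\<close> by simp
  next
    fix k x assume "k \<in> carrier K" "x \<in> carrier W"
    then have "?g (k \<odot>\<^bsub>W\<^esub> x) = ?g (f (k \<odot>\<^bsub>V\<^esub> ?g x))"
      using g linear_mapD(3)[OF f(1), of k "?g x"] by simp
    then show "?g (k \<odot>\<^bsub>W\<^esub> x) = k \<odot>\<^bsub>V\<^esub> ?g x"
      using g' g \<open>k \<in> carrier K\<close> \<open>x \<in> carrier W\<close> by simp
  qed (use g in auto)
  moreover have "bij_betw ?g (carrier W) (carrier V)"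
    using f(2) by (rule bij_betw_inv_into)
  ultimately show ?thesis by (auto simp: lin_iso_def)
qed

lemma lin_iso_zero_spaces:
  assumes "module K V" "module K W" "carrier V = {\<zero>\<^bsub>V\<^esub>}" "carrier W = {\<zero>\<^bsub>W\<^esub>}"
  shows "lin_iso K V W"
proof -
  interpret V: module K V by fact
  interpret W: module K W by fact
  have "linear_map K V W (\<lambda>_. \<zero>\<^bsub>W\<^esub>)"
    by (rule linear_mapI) auto
  moreover have "bij_betw (\<lambda>_. \<zero>\<^bsub>W\<^esub>) (carrier V) (carrier W)"
    using assms(3,4) by (simp add: bij_betw_def)
  ultimately show ?thesis unfolding lin_iso_def by blast
qed

subsection \<open>Subspaces\<close>

lemma submoduleD:
  assumes "module K V" "submodule B K V"
  shows "b \<in> B \<Longrightarrow> b \<in> carrier V"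
    and "\<zero>\<^bsub>V\<^esub> \<in> B"
    and "b \<in> B \<Longrightarrow> c \<in> B \<Longrightarrow> b \<oplus>\<^bsub>V\<^esub> c \<in> B"
    and "b \<in> B \<Longrightarrow> \<ominus>\<^bsub>V\<^esub> b \<in> B"
    and "b \<in> B \<Longrightarrow> c \<in> B \<Longrightarrow> b \<ominus>\<^bsub>V\<^esub> c \<in> B"
    and "k \<in> carrier K \<Longrightarrow> b \<in> B \<Longrightarrow> k \<odot>\<^bsub>V\<^esub> b \<in> B"
proof -
  interpret module K V by fact
  note E = submoduleE[OF assms(2)]
  show "b \<in> B \<Longrightarrow> b \<in> carrier V" using E(1) by blast
  show "\<zero>\<^bsub>V\<^esub> \<in> B" using assms(2)
    by (metis monoid.select_convs(2) subgroup.one_closed submodule.axioms(1))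
  show "b \<in> B \<Longrightarrow> c \<in> B \<Longrightarrow> b \<oplus>\<^bsub>V\<^esub> c \<in> B" by (rule E(5))
  show "b \<in> B \<Longrightarrow> \<ominus>\<^bsub>V\<^esub> b \<in> B" by (rule E(3))
  show "b \<in> B \<Longrightarrow> c \<in> B \<Longrightarrow> b \<ominus>\<^bsub>V\<^esub> c \<in> B" unfolding a_minus_def by (intro E(3,5))
  show "k \<in> carrier K \<Longrightarrow> b \<in> B \<Longrightarrow> k \<odot>\<^bsub>V\<^esub> b \<in> B" by (rule E(4))
qed

lemma submodule_by_closure:
  assumes "module K V" "B \<subseteq> carrier V" "\<zero>\<^bsub>V\<^esub> \<in> B"
    and "\<And>x y. x \<in> B \<Longrightarrow> y \<in> B \<Longrightarrow> x \<oplus>\<^bsub>V\<^esub> y \<in> B"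
    and "\<And>k x. k \<in> carrier K \<Longrightarrow> x \<in> B \<Longrightarrow> k \<odot>\<^bsub>V\<^esub> x \<in> B"
  shows "submodule B K V"
proof -
  interpret module K V by fact
  have "\<ominus>\<^bsub>V\<^esub> x = (\<ominus>\<^bsub>K\<^esub> \<one>\<^bsub>K\<^esub>) \<odot>\<^bsub>V\<^esub> x" if "x \<in> B" for x
    using that assms(2) by (subst smult_l_minus) auto
  then show ?thesis
    using assms(2-5) by (intro submoduleI) auto
qed

lemma submodule_zero: "module K V \<Longrightarrow> submodule {\<zero>\<^bsub>V\<^esub>} K V"
proof -
  assume "module K V"
  then interpret module K V .
  show ?thesis by (rule submodule_by_closure) (auto simp: module_axioms)
qed

lemma submodule_image:
  assumes "module K V" "module K W" "linear_map K V W f" "submodule B K V"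
  shows "submodule (f ` B) K W"
proof (rule submodule_by_closure)
  note B = submoduleD[OF assms(1,4)]
  note f = linear_mapD[OF assms(3)]
  show "f ` B \<subseteq> carrier W" using B(1) f(1) by auto
  show "\<zero>\<^bsub>W\<^esub> \<in> f ` B"
    using linear_map_zero[OF assms(1-3)] B(2) by (metis imageI)
  fix x y assume "x \<in> f ` B" "y \<in> f ` B"
  then obtain a b where "a \<in> B" "b \<in> B" "x = f a" "y = f b" by auto
  then show "x \<oplus>\<^bsub>W\<^esub> y \<in> f ` B" using B f(2)[of a b] by (metis imageI)
next
  note B = submoduleD[OF assms(1,4)]
  note f = linear_mapD[OF assms(3)]
  fix k x assume "k \<in> carrier K" "x \<in> f ` B"
  then obtain a where "a \<in> B" "x = f a" by auto
  then show "k \<odot>\<^bsub>W\<^esub> x \<in> f ` B" using B f(3)[of k a] \<open>k \<in> carrier K\<close> by (metis imageI)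
qed (rule assms(2))

lemma submodule_vimage:
  assumes "module K V" "module K W" "linear_map K V W f" "submodule A K V" "submodule B K W"
  shows "submodule {x \<in> A. f x \<in> B} K V"
proof (rule submodule_by_closure[OF assms(1)])
  note A = submoduleD[OF assms(1,4)]
  note B = submoduleD[OF assms(2,5)]
  note f = linear_mapD[OF assms(3)]
  show "{x \<in> A. f x \<in> B} \<subseteq> carrier V" using A(1) by auto
  show "\<zero>\<^bsub>V\<^esub> \<in> {x \<in> A. f x \<in> B}"
    using linear_map_zero[OF assms(1-3)] A(2) B(2) by simp
qed (use submoduleD[OF assms(1,4)] submoduleD[OF assms(2,5)] linear_mapD[OF assms(3)] in auto)

lemma set_add_iff: "x \<in> A <+>\<^bsub>V\<^esub> B \<longleftrightarrow> (\<exists>a\<in>A. \<exists>b\<in>B. x = a \<oplus>\<^bsub>V\<^esub> b)"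
  by (auto simp: set_add_def set_mult_def)

lemma submodule_sum:
  assumes "module K V" "submodule A K V" "submodule B K V"
  shows "submodule (A <+>\<^bsub>V\<^esub> B) K V"
proof (rule submodule_by_closure[OF assms(1)])
  interpret module K V by fact
  note A = submoduleD[OF assms(1,2)]
  note B = submoduleD[OF assms(1,3)]
  show "A <+>\<^bsub>V\<^esub> B \<subseteq> carrier V" using A(1) B(1) by (auto simp: set_add_iff)
  show "\<zero>\<^bsub>V\<^esub> \<in> A <+>\<^bsub>V\<^esub> B" using A(2) B(2) by (auto simp: set_add_iff intro!: bexI)
  fix x y assume "x \<in> A <+>\<^bsub>V\<^esub> B" "y \<in> A <+>\<^bsub>V\<^esub> B"
  then obtain a b c d where *: "a \<in> A" "b \<in> B" "c \<in> A" "d \<in> B" "x = a \<oplus>\<^bsub>V\<^esub> b" "y = c \<oplus>\<^bsub>V\<^esub> d"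
    by (auto simp: set_add_iff)
  then have "x \<oplus>\<^bsub>V\<^esub> y = (a \<oplus>\<^bsub>V\<^esub> c) \<oplus>\<^bsub>V\<^esub> (b \<oplus>\<^bsub>V\<^esub> d)"
    using A(1) B(1) by (simp add: M.a_ac)
  then show "x \<oplus>\<^bsub>V\<^esub> y \<in> A <+>\<^bsub>V\<^esub> B"
    using A(3)[of a c] B(3)[of b d] * unfolding set_add_iff by blast
next
  interpret module K V by fact
  note A = submoduleD[OF assms(1,2)]
  note B = submoduleD[OF assms(1,3)]
  fix k x assume k: "k \<in> carrier K" and "x \<in> A <+>\<^bsub>V\<^esub> B"
  then obtain a b where *: "a \<in> A" "b \<in> B" "x = a \<oplus>\<^bsub>V\<^esub> b"
    by (auto simp: set_add_iff)
  then have "k \<odot>\<^bsub>V\<^esub> x = k \<odot>\<^bsub>V\<^esub> a \<oplus>\<^bsub>V\<^esub> k \<odot>\<^bsub>V\<^esub> b"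
    using A(1) B(1) k by (simp add: smult_r_distr)
  then show "k \<odot>\<^bsub>V\<^esub> x \<in> A <+>\<^bsub>V\<^esub> B"
    using A(6)[of k a] B(6)[of k b] * k unfolding set_add_iff by blast
qed

lemma submodule_module:
  assumes "module K V" "submodule B K V"
  shows "module K (V\<lparr>carrier := B\<rparr>)"
  using submodule.submodule_is_module[OF assms(2,1)] .

subsection \<open>Cosets\<close>

lemma coset_iff: "y \<in> B +>\<^bsub>V\<^esub> x \<longleftrightarrow> (\<exists>b\<in>B. y = b \<oplus>\<^bsub>V\<^esub> x)"
  by (auto simp: a_r_coset_def r_coset_def)

lemma coset_self:
  assumes "module K V" "submodule B K V" "x \<in> carrier V"
  shows "x \<in> B +>\<^bsub>V\<^esub> x"
proof -
  interpret module K V by fact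
  show ?thesis using submoduleD(2)[OF assms(1,2)] assms(3) unfolding coset_iff
    by (intro bexI[of _ "\<zero>\<^bsub>V\<^esub>"]) simp_all
qed

lemma coset_abelian_subgroup:
  assumes "module K V" "submodule B K V"
  shows "abelian_subgroup B V"
proof -
  interpret module K V by fact
  show ?thesis
    by (rule abelian_subgroupI3)
      (use assms(2) in \<open>auto simp: additive_subgroup_def submodule_def M.abelian_group_axioms\<close>)
qed

lemma coset_eq_iff:
  assumes "module K V" "submodule B K V" "x \<in> carrier V" "y \<in> carrier V"
  shows "B +>\<^bsub>V\<^esub> x = B +>\<^bsub>V\<^esub> y \<longleftrightarrow> x \<ominus>\<^bsub>V\<^esub> y \<in> B"
proof -
  interpret module K V by fact
  interpret B: abelian_subgroup B V by (rule coset_abelian_subgroup) fact+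
  have "x \<in> B +>\<^bsub>V\<^esub> y \<longleftrightarrow> x \<ominus>\<^bsub>V\<^esub> y \<in> B"
    using B.a_rcos_module[OF assms(4,3)] by (simp add: a_minus_def)
  then show ?thesis
    by (metis assms(3,4) B.a_repr_independence' coset_self[OF assms(1,2)])
qed

lemma coset_add:
  assumes "module K V" "submodule B K V" "x \<in> carrier V" "y \<in> carrier V"
  shows "(B +>\<^bsub>V\<^esub> x) <+>\<^bsub>V\<^esub> (B +>\<^bsub>V\<^esub> y) = B +>\<^bsub>V\<^esub> (x \<oplus>\<^bsub>V\<^esub> y)"
proof -
  interpret B: abelian_subgroup B V by (rule coset_abelian_subgroup) fact+
  show ?thesis by (rule B.a_rcos_sum) fact+
qed

lemma coset_zero:
  assumes "module K V" "submodule B K V" "b \<in> B"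
  shows "B +>\<^bsub>V\<^esub> b = B"
proof -
  interpret module K V by fact
  show ?thesis
    using assms by (metis M.a_coset_join2 submodule.axioms(1) submoduleD(1))
qed

text \<open>Operations on cosets are defined as unions over all representatives. Such a union is a single
  coset because representatives differ by elements of \<open>B\<close>, which \<open>f\<close> sends
  into \<open>B'\<close>.\<close>

lemma coset_UN:
  assumes "module K V" "module K W" "submodule B K V" "submodule B' K W"
    and "x \<in> carrier V" "f x \<in> carrier W"
    and "\<And>b. b \<in> B \<Longrightarrow> f b \<in> B' \<and> f (b \<oplus>\<^bsub>V\<^esub> x) = f b \<oplus>\<^bsub>W\<^esub> f x"
  shows "(\<Union>y\<in>B +>\<^bsub>V\<^esub> x. B' +>\<^bsub>W\<^esub> f y) = B' +>\<^bsub>W\<^esub> f x"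
proof -
  interpret W: module K W by fact
  have "B' +>\<^bsub>W\<^esub> f y = B' +>\<^bsub>W\<^esub> f x" if y: "y \<in> B +>\<^bsub>V\<^esub> x" for y
  proof -
    obtain b where b: "b \<in> B" "y = b \<oplus>\<^bsub>V\<^esub> x" using y by (auto simp: coset_iff)
    then have *: "f b \<in> carrier W" "f y = f b \<oplus>\<^bsub>W\<^esub> f x" "f b \<in> B'"
      using assms(7)[of b] submoduleD(1)[OF assms(2,4)] by auto
    then have "f y \<ominus>\<^bsub>W\<^esub> f x = f b"
      using assms(6) by (simp add: a_minus_def W.M.a_assoc W.M.r_neg)
    then show ?thesis using coset_eq_iff[OF assms(2,4), of "f y" "f x"] * assms(6) by simp
  qed
  then show ?thesis using coset_self[OF assms(1,3,5)] by blast
qed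

lemma coset_smult:
  assumes "module K V" "submodule B K V" "x \<in> carrier V" "k \<in> carrier K"
  shows "(\<Union>y\<in>B +>\<^bsub>V\<^esub> x. B +>\<^bsub>V\<^esub> (k \<odot>\<^bsub>V\<^esub> y)) = B +>\<^bsub>V\<^esub> (k \<odot>\<^bsub>V\<^esub> x)"
proof -
  interpret module K V by fact
  show ?thesis
    by (rule coset_UN) (use assms submoduleD[OF assms(1,2)] in \<open>auto simp: smult_r_distr\<close>)
qed

lemma subquotient_simps:
  "carrier (subquotient V Z B) = {B +>\<^bsub>V\<^esub> z | z. z \<in> Z}"
  "\<zero>\<^bsub>subquotient V Z B\<^esub> = B"
  by (simp_all add: subquotient_def)

lemma subquotient_add:
  assumes "module K V" "submodule B K V" "x \<in> carrier V" "y \<in> carrier V"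
  shows "(B +>\<^bsub>V\<^esub> x) \<oplus>\<^bsub>subquotient V Z B\<^esub> (B +>\<^bsub>V\<^esub> y) = B +>\<^bsub>V\<^esub> (x \<oplus>\<^bsub>V\<^esub> y)"
  using coset_add[OF assms] by (simp add: subquotient_def)

lemma subquotient_smult:
  assumes "module K V" "submodule B K V" "x \<in> carrier V" "k \<in> carrier K"
  shows "k \<odot>\<^bsub>subquotient V Z B\<^esub> (B +>\<^bsub>V\<^esub> x) = B +>\<^bsub>V\<^esub> (k \<odot>\<^bsub>V\<^esub> x)"
  using coset_smult[OF assms] by (simp add: subquotient_def)

lemma subquotient_module:
  assumes "module K V" "submodule B K V" "submodule Z K V"
  shows "module K (subquotient V Z B)"
proof -
  interpret module K V by fact
  note Z = submoduleD[OF assms(1,3)]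
  note a = subquotient_add[OF assms(1,2), where Z=Z]
  note s = subquotient_smult[OF assms(1,2), where Z=Z]
  let ?S = "subquotient V Z B"
  have el: "\<exists>z\<in>Z. X = B +>\<^bsub>V\<^esub> z" if "X \<in> carrier ?S" for X
    using that by (auto simp: subquotient_simps)
  have co: "B +>\<^bsub>V\<^esub> z \<in> carrier ?S" if "z \<in> Z" for z
    using that by (auto simp: subquotient_simps)
  have zz: "\<zero>\<^bsub>?S\<^esub> = B +>\<^bsub>V\<^esub> \<zero>\<^bsub>V\<^esub>"
    using coset_zero[OF assms(1,2) submoduleD(2)[OF assms(1,2)]] by (simp add: subquotient_simps)
  show ?thesis
  proof (rule moduleI)
    show "cring K" ..
    show "abelian_group ?S"
    proof (rule abelian_groupI)
      fix X assume "X \<in> carrier ?S"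
      then obtain x where x: "x \<in> Z" "X = B +>\<^bsub>V\<^esub> x" using el by blast
      then have "(B +>\<^bsub>V\<^esub> (\<ominus>\<^bsub>V\<^esub> x)) \<oplus>\<^bsub>?S\<^esub> X = \<zero>\<^bsub>?S\<^esub>"
        using Z by (simp add: a zz M.l_neg)
      then show "\<exists>Y\<in>carrier ?S. Y \<oplus>\<^bsub>?S\<^esub> X = \<zero>\<^bsub>?S\<^esub>"
        using co[of "\<ominus>\<^bsub>V\<^esub> x"] x Z by auto
    qed (auto dest!: el simp: a zz Z M.a_ac intro!: co)
  qed (auto dest!: el simp: a s Z smult_l_distr smult_r_distr smult_assoc1 intro!: co)
qed

text \<open>The first isomorphism theorem. It yields the isomorphisms between pages and cohomology spaces
  below, from maps given on cocycles.\<close>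

lemma lin_iso_subquotient:
  assumes V: "module K V" and B: "submodule B K V" and Z: "submodule Z K V"
    and add: "\<And>x y. x \<in> Z \<Longrightarrow> y \<in> Z \<Longrightarrow> f (x \<oplus>\<^bsub>V\<^esub> y) = f x \<oplus>\<^bsub>W\<^esub> f y"
    and smult: "\<And>k x. k \<in> carrier K \<Longrightarrow> x \<in> Z \<Longrightarrow> f (k \<odot>\<^bsub>V\<^esub> x) = k \<odot>\<^bsub>W\<^esub> f x"
    and ker: "\<And>x y. x \<in> Z \<Longrightarrow> y \<in> Z \<Longrightarrow> f x = f y \<longleftrightarrow> x \<ominus>\<^bsub>V\<^esub> y \<in> B"
    and onto: "f ` Z = carrier W"
  shows "lin_iso K (subquotient V Z B) W"
proof -
  note Zc = submoduleD[OF V Z]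
  define g where "g X = f (SOME z. z \<in> Z \<and> X = B +>\<^bsub>V\<^esub> z)" for X
  have g: "g (B +>\<^bsub>V\<^esub> z) = f z" if z: "z \<in> Z" for z
  proof -
    define y where "y = (SOME y. y \<in> Z \<and> B +>\<^bsub>V\<^esub> z = B +>\<^bsub>V\<^esub> y)"
    have y: "y \<in> Z \<and> B +>\<^bsub>V\<^esub> z = B +>\<^bsub>V\<^esub> y"
      unfolding y_def by (rule someI[of _ z]) (use z in auto)
    then have "z \<ominus>\<^bsub>V\<^esub> y \<in> B" using coset_eq_iff[OF V B] Zc(1) z by blast
    then show ?thesis using ker[OF z, of y] y unfolding g_def y_def by simp
  qed
  have "linear_map K (subquotient V Z B) W g"
  proof (rule linear_mapI)
    show "g x \<in> carrier W" if "x \<in> carrier (subquotient V Z B)" for x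
      using that onto g by (auto simp: subquotient_simps)
    show "g (x \<oplus>\<^bsub>subquotient V Z B\<^esub> y) = g x \<oplus>\<^bsub>W\<^esub> g y"
      if "x \<in> carrier (subquotient V Z B)" "y \<in> carrier (subquotient V Z B)" for x y
      using that by (auto simp: subquotient_simps subquotient_add[OF V B] Zc g add)
    show "g (k \<odot>\<^bsub>subquotient V Z B\<^esub> x) = k \<odot>\<^bsub>W\<^esub> g x"
      if "k \<in> carrier K" "x \<in> carrier (subquotient V Z B)" for k x
      using that by (auto simp: subquotient_simps subquotient_smult[OF V B] Zc g smult)
  qed
  moreover have "bij_betw g (carrier (subquotient V Z B)) (carrier W)"
    unfolding bij_betw_def
  proof
    show "inj_on g (carrier (subquotient V Z B))"
    proof (rule inj_onI)
      fix X Y assume "X \<in> carrier (subquotient V Z B)" "Y \<in> carrier (subquotient V Z B)" "g X = g Y"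
      then obtain x y where "x \<in> Z" "y \<in> Z" "X = B +>\<^bsub>V\<^esub> x" "Y = B +>\<^bsub>V\<^esub> y" "f x = f y"
        by (auto simp: subquotient_simps g)
      then show "X = Y" using ker coset_eq_iff[OF V B, of x y] Zc(1) by auto
    qed
    show "g ` carrier (subquotient V Z B) = carrier W"
      unfolding onto[symmetric] by (force simp: subquotient_simps g image_iff)
  qed
  ultimately show ?thesis by (auto simp: lin_iso_def)
qed

lemma subquotient_zero_carrier:
  assumes "module K V" "submodule B K V" "submodule Z K V" "Z \<subseteq> B"
  shows "carrier (subquotient V Z B) = {\<zero>\<^bsub>subquotient V Z B\<^esub>}"
proof -
  have "\<And>z. z \<in> Z \<Longrightarrow> B +>\<^bsub>V\<^esub> z = B" using coset_zero[OF assms(1,2)] assms(4) by blast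
  then show ?thesis
    using submoduleD(2)[OF assms(1,3)] by (auto simp: subquotient_simps)
qed

subsection \<open>Spaces of functions\<close>

text \<open>Hom spaces, cochain spaces and total complexes are subspaces of such products.\<close>

lemma pointwise_module:
  assumes "cring K" and M: "\<And>i. i \<in> S \<Longrightarrow> module K (M i)"
  shows "module K (vspace (\<Pi>\<^sub>E i\<in>S. carrier (M i)) (\<lambda>i\<in>S. \<zero>\<^bsub>M i\<^esub>)
    (\<lambda>f g. \<lambda>i\<in>S. f i \<oplus>\<^bsub>M i\<^esub> g i) (\<lambda>k f. \<lambda>i\<in>S. k \<odot>\<^bsub>M i\<^esub> f i))" (is "module K ?V")
proof -
  have ag: "abelian_group (M i)" if "i \<in> S" for i
    using M[OF that] by (simp add: module_def)
  note g = abelian_groupE[OF ag]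
  note mI = M[unfolded module_def module_axioms_def, THEN conjunct2, THEN conjunct2]
  show ?thesis
  proof (rule moduleI)
    show "cring K" by fact
    show "abelian_group ?V"
    proof (rule abelian_groupI)
      fix x assume x: "x \<in> carrier ?V"
      have "\<exists>y\<in>carrier (M i). y \<oplus>\<^bsub>M i\<^esub> x i = \<zero>\<^bsub>M i\<^esub>" if "i \<in> S" for i
        using x that g(6)[OF that] by (auto simp: PiE_iff)
      then obtain y where "\<And>i. i \<in> S \<Longrightarrow> y i \<in> carrier (M i) \<and> y i \<oplus>\<^bsub>M i\<^esub> x i = \<zero>\<^bsub>M i\<^esub>"
        by metis
      then have "restrict y S \<in> carrier ?V" "restrict y S \<oplus>\<^bsub>?V\<^esub> x = \<zero>\<^bsub>?V\<^esub>"
        by (auto simp: fun_eq_iff)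
      then show "\<exists>y\<in>carrier ?V. y \<oplus>\<^bsub>?V\<^esub> x = \<zero>\<^bsub>?V\<^esub>" by blast
    qed (auto simp: PiE_iff g(1-3,5) extensional_def fun_eq_iff intro: g(4))
  qed (use mI in \<open>auto simp: PiE_iff extensional_def fun_eq_iff g(1)\<close>)
qed

section \<open>Averaging over a finite group in characteristic zero\<close>

lemma equivariant_mapD:
  assumes "equivariant_map K S V W f"
  shows "linear_map K V W f" "x \<in> S \<Longrightarrow> v \<in> carrier V \<Longrightarrow> f (opr V x v) = opr W x (f v)"
  using assms by (auto simp: equivariant_map_def)

lemma group_moduleD:
  assumes "group_module K G M"
  shows "module K M" "g \<in> carrier G \<Longrightarrow> linear_map K M M (opr M g)"
    "v \<in> carrier M \<Longrightarrow> opr M \<one>\<^bsub>G\<^esub> v = v"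
    "g \<in> carrier G \<Longrightarrow> h \<in> carrier G \<Longrightarrow> v \<in> carrier M \<Longrightarrow> opr M (g \<otimes>\<^bsub>G\<^esub> h) v = opr M g (opr M h v)"
    "g \<in> carrier G \<Longrightarrow> v \<in> carrier M \<Longrightarrow> opr M g v \<in> carrier M"
  using assms by (auto simp: group_module_def linear_map_def)

lemma fixed_space_simps [simp]:
  "zero (fixed_space G M) = zero M"
  "add (fixed_space G M) = add M"
  "smult (fixed_space G M) = smult M"
  "opr (fixed_space G M) = opr M"
  "v \<in> carrier (fixed_space G M) \<longleftrightarrow> v \<in> carrier M \<and> (\<forall>g\<in>carrier G. opr M g v = v)"
  by (auto simp: fixed_space_def)

lemma fixed_space_module:
  assumes "group_module K G M"
  shows "module K (fixed_space G M)"
proof -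
  note M = group_moduleD[OF assms]
  interpret module K M by (rule M)
  have "submodule {v \<in> carrier M. \<forall>g\<in>carrier G. opr M g v = v} K M"
    by (rule submodule_by_closure[OF M(1)])
      (auto simp: linear_mapD[OF M(2)] linear_map_zero[OF M(1) M(1) M(2)])
  then show ?thesis unfolding fixed_space_def by (rule submodule_module[OF M(1)])
qed

lemma fixed_space_linear_map:
  assumes "group_module K G M" "group_module K G N" "equivariant_map K (carrier G) M N f"
  shows "linear_map K (fixed_space G M) (fixed_space G N) f"
proof -
  have "opr N g (f x) = f x" if "g \<in> carrier G" "x \<in> carrier M" "opr M g x = x" for g x
    using equivariant_mapD(2)[OF assms(3) that(1,2)] that(3) by simp
  then show ?thesis
    using linear_mapD[OF equivariant_mapD(1)[OF assms(3)]] by (intro linear_mapI) auto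
qed

lemma (in module) add_pow_smult:
  "v \<in> carrier M \<Longrightarrow> [(n::nat)] \<cdot>\<^bsub>M\<^esub> v = ([n] \<cdot>\<^bsub>R\<^esub> \<one>\<^bsub>R\<^esub>) \<odot>\<^bsub>M\<^esub> v"
  by (induction n) (simp_all add: smult_l_distr)

text \<open>The mean is taken over arbitrary families, not only over orbits, because the contraction of
  the cochain complex below averages over the last argument of a cochain.\<close>

definition mean ::
  "('k, 'a) ring_scheme \<Rightarrow> ('g, 'b) monoid_scheme \<Rightarrow> ('k, 'v, 'c) module_scheme \<Rightarrow> ('g \<Rightarrow> 'v) \<Rightarrow> 'v"
  where "mean K G M u =
    inv\<^bsub>K\<^esub> ([card (carrier G)] \<cdot>\<^bsub>K\<^esub> \<one>\<^bsub>K\<^esub>) \<odot>\<^bsub>M\<^esub> (\<Oplus>\<^bsub>M\<^esub>g\<in>carrier G. u g)"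

definition average ::
  "('k, 'a) ring_scheme \<Rightarrow> ('g, 'b) monoid_scheme \<Rightarrow> ('k, 'v, 'g) opmod \<Rightarrow> 'v \<Rightarrow> 'v"
  where "average K G M v = mean K G M (\<lambda>g. opr M g v)"

locale finite_group_char_zero =
  fixes K :: "('k, 'a) ring_scheme" and G :: "('g, 'b) monoid_scheme"
  assumes field_K: "field K"
    and char_K: "\<And>n::nat. n > 0 \<Longrightarrow> [n] \<cdot>\<^bsub>K\<^esub> \<one>\<^bsub>K\<^esub> \<noteq> \<zero>\<^bsub>K\<^esub>"
    and group_G: "group G" and finite_G: "finite (carrier G)"
begin

sublocale K: field K by (rule field_K)
sublocale G: group G by (rule group_G)

lemma card_unit:
  "inv\<^bsub>K\<^esub> ([card (carrier G)] \<cdot>\<^bsub>K\<^esub> \<one>\<^bsub>K\<^esub>) \<in> carrier K"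
  "inv\<^bsub>K\<^esub> ([card (carrier G)] \<cdot>\<^bsub>K\<^esub> \<one>\<^bsub>K\<^esub>) \<otimes>\<^bsub>K\<^esub> ([card (carrier G)] \<cdot>\<^bsub>K\<^esub> \<one>\<^bsub>K\<^esub>) = \<one>\<^bsub>K\<^esub>"
proof -
  have "card (carrier G) > 0" using finite_G G.one_closed by (auto simp: card_gt_0_iff)
  then have "[card (carrier G)] \<cdot>\<^bsub>K\<^esub> \<one>\<^bsub>K\<^esub> \<in> Units K"
    by (simp add: K.field_Units char_K)
  then show
    "inv\<^bsub>K\<^esub> ([card (carrier G)] \<cdot>\<^bsub>K\<^esub> \<one>\<^bsub>K\<^esub>) \<in> carrier K"
    "inv\<^bsub>K\<^esub> ([card (carrier G)] \<cdot>\<^bsub>K\<^esub> \<one>\<^bsub>K\<^esub>) \<otimes>\<^bsub>K\<^esub> ([card (carrier G)] \<cdot>\<^bsub>K\<^esub> \<one>\<^bsub>K\<^esub>) = \<one>\<^bsub>K\<^esub>"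
    by auto
qed

lemma mean_closed:
  assumes "module K M" "\<And>g. g \<in> carrier G \<Longrightarrow> u g \<in> carrier M"
  shows "mean K G M u \<in> carrier M"
proof -
  interpret module K M by fact
  show ?thesis using assms(2) card_unit(1) by (auto simp: mean_def)
qed

lemma mean_cong:
  assumes "module K M" "\<And>g. g \<in> carrier G \<Longrightarrow> u g = v g" "\<And>g. g \<in> carrier G \<Longrightarrow> v g \<in> carrier M"
  shows "mean K G M u = mean K G M v"
proof -
  interpret module K M by fact
  show ?thesis unfolding mean_def using assms(2,3) by (subst M.finsum_cong') auto
qed

lemma mean_const:
  assumes "module K M" "v \<in> carrier M"
  shows "mean K G M (\<lambda>_. v) = v"
proof -
  interpret module K M by fact
  have "(\<Oplus>\<^bsub>M\<^esub>g\<in>carrier G. v) = [card (carrier G)] \<cdot>\<^bsub>M\<^esub> v"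
    using assms(2) by (rule M.add.finprod_const)
  then show ?thesis
    using assms(2) card_unit by (simp add: mean_def add_pow_smult smult_assoc1[symmetric])
qed

lemma mean_add:
  assumes "module K M" "\<And>g. g \<in> carrier G \<Longrightarrow> u g \<in> carrier M" "\<And>g. g \<in> carrier G \<Longrightarrow> v g \<in> carrier M"
  shows "mean K G M (\<lambda>g. u g \<oplus>\<^bsub>M\<^esub> v g) = mean K G M u \<oplus>\<^bsub>M\<^esub> mean K G M v"
proof -
  interpret module K M by fact
  have "u \<in> carrier G \<rightarrow> carrier M" "v \<in> carrier G \<rightarrow> carrier M" using assms(2,3) by auto
  then show ?thesis using card_unit(1) by (simp add: mean_def M.finsum_addf smult_r_distr)
qed

lemma mean_linear_map:
  assumes "module K M" "module K N" "linear_map K M N f" "\<And>g. g \<in> carrier G \<Longrightarrow> u g \<in> carrier M"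
  shows "f (mean K G M u) = mean K G N (\<lambda>g. f (u g))"
proof -
  interpret module K M by fact
  have "u \<in> carrier G \<rightarrow> carrier M" using assms(4) by auto
  then show ?thesis using card_unit(1) unfolding mean_def
    by (simp add: linear_mapD(3)[OF assms(3)] linear_map_finsum[OF assms(1-3) finite_G])
qed

lemma mean_finsum:
  assumes "module K M" "finite A" "\<And>i g. i \<in> A \<Longrightarrow> g \<in> carrier G \<Longrightarrow> u i g \<in> carrier M"
  shows "mean K G M (\<lambda>g. \<Oplus>\<^bsub>M\<^esub>i\<in>A. u i g) = (\<Oplus>\<^bsub>M\<^esub>i\<in>A. mean K G M (u i))"
proof -
  interpret module K M by fact
  show ?thesis using assms(2,3)
  proof (induction A rule: finite_induct)
    case empty
    then show ?case by (simp add: mean_const[OF assms(1)])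
  next
    case (insert a A)
    have "mean K G M (\<lambda>g. \<Oplus>\<^bsub>M\<^esub>i\<in>insert a A. u i g) = mean K G M (\<lambda>g. u a g \<oplus>\<^bsub>M\<^esub> (\<Oplus>\<^bsub>M\<^esub>i\<in>A. u i g))"
      using insert by (intro mean_cong[OF assms(1)]) (auto simp: Pi_def)
    also have "\<dots> = mean K G M (u a) \<oplus>\<^bsub>M\<^esub> mean K G M (\<lambda>g. \<Oplus>\<^bsub>M\<^esub>i\<in>A. u i g)"
      using insert by (intro mean_add[OF assms(1)]) (auto simp: Pi_def)
    finally show ?case
      using insert by (simp add: Pi_def mean_closed[OF assms(1)])
  qed
qed

lemma mean_translate:
  assumes "module K M" "\<And>g. g \<in> carrier G \<Longrightarrow> u g \<in> carrier M" "h \<in> carrier G"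
  shows "mean K G M (\<lambda>g. u (h \<otimes>\<^bsub>G\<^esub> g)) = mean K G M u"
proof -
  interpret module K M by fact
  have "(\<lambda>g. h \<otimes>\<^bsub>G\<^esub> g) ` carrier G = carrier G"
    using assms(3) by (rule G.surj_const_mult)
  moreover have "inj_on (\<lambda>g. h \<otimes>\<^bsub>G\<^esub> g) (carrier G)"
    using assms(3) by (rule G.inj_on_cmult)
  ultimately show ?thesis
    using M.finsum_reindex[of u "\<lambda>g. h \<otimes>\<^bsub>G\<^esub> g" "carrier G"] assms(2) by (simp add: mean_def Pi_def)
qed

text \<open>Acting by a group element translates the index of the mean.\<close>

lemma average_fixed:
  assumes "group_module K G M" "v \<in> carrier M"
  shows "average K G M v \<in> carrier (fixed_space G M)"
proof -
  note M = group_moduleD[OF assms(1)]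
  have c: "\<And>g. g \<in> carrier G \<Longrightarrow> opr M g v \<in> carrier M" using M(5) assms(2) by blast
  have "opr M g (average K G M v) = average K G M v" if g: "g \<in> carrier G" for g
  proof -
    have "opr M g (average K G M v) = mean K G M (\<lambda>h. opr M g (opr M h v))"
      unfolding average_def by (rule mean_linear_map[OF M(1) M(1) M(2)[OF g] c])
    also have "\<dots> = mean K G M (\<lambda>h. opr M (g \<otimes>\<^bsub>G\<^esub> h) v)"
      using M(4)[OF g _ assms(2)] c M(5)[OF g] by (intro mean_cong[OF M(1)]) simp_all
    also have "\<dots> = average K G M v"
      unfolding average_def by (rule mean_translate[OF M(1) c g])
    finally show ?thesis .
  qed
  then show ?thesis using mean_closed[OF M(1) c] by (simp add: average_def)
qed

lemma average_id:
  assumes "group_module K G M" "v \<in> carrier (fixed_space G M)"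
  shows "average K G M v = v"
proof -
  have "average K G M v = mean K G M (\<lambda>_. v)"
    unfolding average_def using assms(2) by (intro mean_cong[OF group_moduleD(1)[OF assms(1)]]) auto
  then show ?thesis using mean_const[OF group_moduleD(1)[OF assms(1)]] assms(2) by simp
qed

text \<open>For differentials this is what makes taking invariants exact: a preimage of an invariant
  element can be averaged without losing its image.\<close>

lemma average_equivariant_map:
  assumes "group_module K G M" "group_module K G N" "equivariant_map K (carrier G) M N f" "v \<in> carrier M"
  shows "f (average K G M v) = average K G N (f v)"
proof -
  note M = group_moduleD[OF assms(1)] and N = group_moduleD[OF assms(2)]
  note f = equivariant_mapD[OF assms(3)]
  have "f (average K G M v) = mean K G N (\<lambda>g. f (opr M g v))"
    unfolding average_def using M(5)[OF _ assms(4)] by (intro mean_linear_map[OF M(1) N(1) f(1)])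
  also have "\<dots> = average K G N (f v)"
    unfolding average_def using f(2)[OF _ assms(4)] N(5) linear_mapD(1)[OF f(1) assms(4)]
    by (intro mean_cong[OF N(1)]) auto
  finally show ?thesis .
qed

lemma average_add:
  assumes "group_module K G M" "v \<in> carrier M" "w \<in> carrier M"
  shows "average K G M (v \<oplus>\<^bsub>M\<^esub> w) = average K G M v \<oplus>\<^bsub>M\<^esub> average K G M w"
proof -
  note M = group_moduleD[OF assms(1)]
  interpret module K M by (rule M(1))
  have "average K G M (v \<oplus>\<^bsub>M\<^esub> w) = mean K G M (\<lambda>g. opr M g v \<oplus>\<^bsub>M\<^esub> opr M g w)"
    unfolding average_def using assms(2,3) M(5)
    by (intro mean_cong[OF M(1)]) (simp_all add: linear_mapD(2)[OF M(2)])
  then show ?thesis unfolding average_def using mean_add[OF M(1)] M(5) assms(2,3) by simp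
qed

end

section \<open>Cohomology of a finite group in characteristic zero\<close>

lemma sgn_mult_linear:
  assumes "module K M"
  shows "linear_map K M M (sgn_mult M i)"
proof -
  interpret module K M by fact
  show ?thesis
    by (rule linear_mapI) (auto simp: sgn_mult_def smult_r_minus M.minus_add M.a_comm)
qed

lemma cochains_module:
  assumes "cring K" "module K M"
  shows "module K (cochains G M n)"
  unfolding cochains_def by (rule pointwise_module[OF assms(1), where M="\<lambda>_. M"]) (rule assms(2))

lemma tuples_iff: "gs \<in> tuples G n \<longleftrightarrow> set gs \<subseteq> carrier G \<and> length gs = n"
  by (auto simp: tuples_def in_lists_conv_set)

abbreviation merge_at :: "('g, 'b) monoid_scheme \<Rightarrow> nat \<Rightarrow> 'g list \<Rightarrow> 'g list"
  where "merge_at G i gs \<equiv> take (i - 1) gs @ (gs ! (i - 1) \<otimes>\<^bsub>G\<^esub> gs ! i) # drop (i + 1) gs"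

lemma merge_at_tuples:
  assumes "group G" "gs \<in> tuples G (Suc n)" "i \<in> {1..n}"
  shows "merge_at G i gs \<in> tuples G n"
proof -
  interpret group G by fact
  have "gs ! (i - 1) \<in> carrier G" "gs ! i \<in> carrier G"
    using assms(2,3) unfolding tuples_iff by (auto intro!: subsetD[OF _ nth_mem])
  then show ?thesis
    using assms(2,3) set_take_subset[of "i - 1" gs] set_drop_subset[of "i + 1" gs]
    by (auto simp: tuples_iff)
qed

lemma cochain_d_linear:
  assumes G: "group G" and M: "group_module K G M"
  shows "linear_map K (cochains G M n) (cochains G M (Suc n)) (cochain_d G M n)"
proof -
  note M = group_moduleD[OF M]
  interpret module K M by (rule M)
  note s = linear_mapD[OF sgn_mult_linear[OF M(1)]]
  have t: "tl gs \<in> tuples G n" "butlast gs \<in> tuples G n" "hd gs \<in> carrier G"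
    if "gs \<in> tuples G (Suc n)" for gs
    using that by (cases gs; force simp: tuples_iff dest: in_set_butlastD)+
  note m = merge_at_tuples[OF G]
  have c: "(\<lambda>i. sgn_mult M i (f (merge_at G i gs))) \<in> {1..n} \<rightarrow> carrier M"
    if "f \<in> tuples G n \<rightarrow>\<^sub>E carrier M" "gs \<in> tuples G (Suc n)" for f gs
  proof (rule Pi_I)
    fix i assume "i \<in> {1..n}"
    from PiE_mem[OF that(1) m[OF that(2) this]]
    show "sgn_mult M i (f (merge_at G i gs)) \<in> carrier M" by (rule s(1))
  qed
  show ?thesis
  proof (rule linear_mapI)
    fix f assume "f \<in> carrier (cochains G M n)"
    then have f: "f \<in> tuples G n \<rightarrow>\<^sub>E carrier M" by (simp add: cochains_def)
    show "cochain_d G M n f \<in> carrier (cochains G M (Suc n))"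
      using M.finsum_closed[OF c[OF f]] f t s(1) M(5)
      by (auto simp: cochains_def cochain_d_def PiE_iff)
  next
    fix f f' assume "f \<in> carrier (cochains G M n)" "f' \<in> carrier (cochains G M n)"
    then have f: "f \<in> tuples G n \<rightarrow>\<^sub>E carrier M" "f' \<in> tuples G n \<rightarrow>\<^sub>E carrier M"
      by (simp_all add: cochains_def)
    show "cochain_d G M n (f \<oplus>\<^bsub>cochains G M n\<^esub> f') =
      cochain_d G M n f \<oplus>\<^bsub>cochains G M (Suc n)\<^esub> cochain_d G M n f'"
    proof (rule ext)
      fix gs
      show "cochain_d G M n (f \<oplus>\<^bsub>cochains G M n\<^esub> f') gs =
        (cochain_d G M n f \<oplus>\<^bsub>cochains G M (Suc n)\<^esub> cochain_d G M n f') gs"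
      proof (cases "gs \<in> tuples G (Suc n)")
        case True
        have "(\<Oplus>\<^bsub>M\<^esub>i\<in>{1..n}. sgn_mult M i ((f \<oplus>\<^bsub>cochains G M n\<^esub> f') (merge_at G i gs))) =
          (\<Oplus>\<^bsub>M\<^esub>i\<in>{1..n}. sgn_mult M i (f (merge_at G i gs)) \<oplus>\<^bsub>M\<^esub> sgn_mult M i (f' (merge_at G i gs)))"
          using c[OF f(1) True] c[OF f(2) True] m[OF True] f
          by (intro M.finsum_cong') (auto simp: cochains_def s(2) PiE_iff)
        also have "\<dots> = (\<Oplus>\<^bsub>M\<^esub>i\<in>{1..n}. sgn_mult M i (f (merge_at G i gs))) \<oplus>\<^bsub>M\<^esub>
          (\<Oplus>\<^bsub>M\<^esub>i\<in>{1..n}. sgn_mult M i (f' (merge_at G i gs)))"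
          using c[OF f(1) True] c[OF f(2) True] by (rule M.finsum_addf)
        finally show ?thesis
          using True t[OF True] f M(5) s(1) M.finsum_closed[OF c[OF f(1) True]] M.finsum_closed[OF c[OF f(2) True]]
          by (simp add: cochain_d_def) (simp add: cochains_def PiE_iff linear_mapD(2)[OF M(2)] s(2) M.a_ac)
      qed (simp add: cochain_d_def cochains_def)
    qed
  next
    fix k f assume k: "k \<in> carrier K" and "f \<in> carrier (cochains G M n)"
    then have f: "f \<in> tuples G n \<rightarrow>\<^sub>E carrier M" by (simp_all add: cochains_def)
    show "cochain_d G M n (k \<odot>\<^bsub>cochains G M n\<^esub> f) = k \<odot>\<^bsub>cochains G M (Suc n)\<^esub> cochain_d G M n f"
    proof (rule ext)
      fix gs
      show "cochain_d G M n (k \<odot>\<^bsub>cochains G M n\<^esub> f) gs = (k \<odot>\<^bsub>cochains G M (Suc n)\<^esub> cochain_d G M n f) gs"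
      proof (cases "gs \<in> tuples G (Suc n)")
        case True
        have "(\<Oplus>\<^bsub>M\<^esub>i\<in>{1..n}. sgn_mult M i ((k \<odot>\<^bsub>cochains G M n\<^esub> f) (merge_at G i gs))) =
          (\<Oplus>\<^bsub>M\<^esub>i\<in>{1..n}. k \<odot>\<^bsub>M\<^esub> sgn_mult M i (f (merge_at G i gs)))"
          using c[OF f True] m[OF True] f k
          by (intro M.finsum_cong') (auto simp: cochains_def s(3) PiE_iff Pi_def)
        also have "\<dots> = k \<odot>\<^bsub>M\<^esub> (\<Oplus>\<^bsub>M\<^esub>i\<in>{1..n}. sgn_mult M i (f (merge_at G i gs)))"
          using c[OF f True] k by (subst finsum_smult_ldistr) auto
        finally show ?thesis
          using True t[OF True] f k M(5) s(1) M.finsum_closed[OF c[OF f True]]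
          by (simp add: cochain_d_def) (simp add: cochains_def PiE_iff linear_mapD(3)[OF M(2)] s(3) smult_r_distr)
      qed (simp add: cochain_d_def cochains_def)
    qed
  qed
qed

lemma cocycles_submodule:
  assumes "\<And>n. module K (C n)" "\<And>n. linear_map K (C n) (C (Suc n)) (d n)"
  shows "submodule (cocycles C d n) K (C n)"
  using submodule_vimage[OF assms(1,1) assms(2) module.carrier_is_submodule[OF assms(1)] submodule_zero[OF assms(1)], of n]
  by (simp add: cocycles_def)

lemma coboundaries_submodule:
  assumes "\<And>n. module K (C n)" "\<And>n. linear_map K (C n) (C (Suc n)) (d n)"
  shows "submodule (coboundaries C d n) K (C n)"
proof (cases n)
  case (Suc m)
  then show ?thesis
    using submodule_image[OF assms(1,1) assms(2) module.carrier_is_submodule[OF assms(1)], of m]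
    by (simp add: coboundaries_def)
qed (simp add: coboundaries_def submodule_zero assms)

lemma cohomology_module:
  assumes "\<And>n. module K (C n)" "\<And>n. linear_map K (C n) (C (Suc n)) (d n)"
  shows "module K (cohomology C d n)"
  unfolding cohomology_def
  by (intro subquotient_module cocycles_submodule coboundaries_submodule assms)

lemma group_cohomology_module:
  assumes "cring K" "group G" "group_module K G M"
  shows "module K (group_cohomology G M n)"
  unfolding group_cohomology_def
  using cochains_module[OF assms(1) group_moduleD(1)[OF assms(3)]] cochain_d_linear[OF assms(2,3)]
  by (rule cohomology_module)

text \<open>A cochain of degree \<open>0\<close> is its value \<open>v\<close> at the empty tuple, and the
  value of its coboundary at \<open>g\<close> is \<open>g v - v\<close>.\<close>

lemma group_cohomology_0:
  assumes "cring K" "group G" "group_module K G M"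
  shows "lin_iso K (group_cohomology G M 0) (fixed_space G M)"
proof -
  note M = group_moduleD[OF assms(3)]
  interpret module K M by (rule M(1))
  note mc = cochains_module[OF assms(1) M(1), of G]
  note ld = cochain_d_linear[OF assms(2,3)]
  have t0: "tuples G 0 = {[]}" by (auto simp: tuples_def)
  have t1: "tuples G (Suc 0) = (\<lambda>g. [g]) ` carrier G"
    by (auto simp: tuples_iff length_Suc_conv)
  have car: "x \<in> carrier (cochains G M 0) \<longleftrightarrow> x \<in> extensional {[]} \<and> x [] \<in> carrier M" for x
    by (auto simp: cochains_def t0 PiE_iff)
  have cyc: "x \<in> cocycles (cochains G M) (cochain_d G M) 0 \<longleftrightarrow>
      x \<in> extensional {[]} \<and> x [] \<in> carrier (fixed_space G M)" for x
  proof -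
    have "opr M g (x []) \<oplus>\<^bsub>M\<^esub> \<zero>\<^bsub>M\<^esub> \<oplus>\<^bsub>M\<^esub> \<ominus>\<^bsub>M\<^esub> x [] = \<zero>\<^bsub>M\<^esub> \<longleftrightarrow> opr M g (x []) = x []"
      if "x [] \<in> carrier M" "g \<in> carrier G" for g
      using that M(5)[OF that(2,1)] M.minus_eq_zero_iff[of "opr M g (x [])" "x []"] by (simp add: a_minus_def)
    then show ?thesis
      by (auto simp: cocycles_def car cochain_d_def cochains_def t0 t1 fun_eq_iff sgn_mult_def restrict_def PiE_iff
          split: if_splits)
  qed
  have mi: "(x \<ominus>\<^bsub>cochains G M 0\<^esub> y) [] = x [] \<ominus>\<^bsub>M\<^esub> y []"
    if "x \<in> carrier (cochains G M 0)" "y \<in> carrier (cochains G M 0)" for x y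
  proof -
    have "linear_map K (cochains G M 0) M (\<lambda>x. x [])"
      by (rule linear_mapI) (auto simp: car, auto simp: cochains_def t0)
    then show ?thesis using linear_map_minus[OF mc M(1), of 0 "\<lambda>x. x []"] that by blast
  qed
  show ?thesis
    unfolding group_cohomology_def cohomology_def
  proof (rule lin_iso_subquotient[where f="\<lambda>x. x []", OF mc coboundaries_submodule[where C="cochains G M" and d="cochain_d G M", OF mc ld] cocycles_submodule[where C="cochains G M" and d="cochain_d G M", OF mc ld]])
    fix x y assume xy: "x \<in> cocycles (cochains G M) (cochain_d G M) 0" "y \<in> cocycles (cochains G M) (cochain_d G M) 0"
    then have c: "x \<in> carrier (cochains G M 0)" "y \<in> carrier (cochains G M 0)"
      by (auto simp: cocycles_def)
    show "(x \<oplus>\<^bsub>cochains G M 0\<^esub> y) [] = x [] \<oplus>\<^bsub>fixed_space G M\<^esub> y []"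
      by (simp add: cochains_def t0)
    have "x \<ominus>\<^bsub>cochains G M 0\<^esub> y \<in> coboundaries (cochains G M) (cochain_d G M) 0 \<longleftrightarrow> x = y"
    proof -
      interpret C: module K "cochains G M 0" by (rule mc)
      show ?thesis using c C.M.minus_eq_zero_iff[of x y] by (simp add: coboundaries_def)
    qed
    also have "x = y \<longleftrightarrow> x [] = y []"
    proof
      assume "x [] = y []"
      then show "x = y" using c unfolding car by (intro extensionalityI[of x "{[]}" y]) auto
    qed simp
    finally show "x [] = y [] \<longleftrightarrow> x \<ominus>\<^bsub>cochains G M 0\<^esub> y \<in> coboundaries (cochains G M) (cochain_d G M) 0"
      by simp
  next
    fix k x assume "k \<in> carrier K" "x \<in> cocycles (cochains G M) (cochain_d G M) 0"
    then show "(k \<odot>\<^bsub>cochains G M 0\<^esub> x) [] = k \<odot>\<^bsub>fixed_space G M\<^esub> x []"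
      by (simp add: cochains_def t0)
  next
    show "(\<lambda>x. x []) ` cocycles (cochains G M) (cochain_d G M) 0 = carrier (fixed_space G M)"
    proof (intro equalityI subsetI)
      fix v assume "v \<in> carrier (fixed_space G M)"
      then have "(\<lambda>gs\<in>{[]}. v) \<in> cocycles (cochains G M) (cochain_d G M) 0" unfolding cyc by auto
      then show "v \<in> (\<lambda>x. x []) ` cocycles (cochains G M) (cochain_d G M) 0" 
        by (intro image_eqI[where x="\<lambda>gs\<in>{[]}. v"]) simp_all
    qed (auto simp: cyc)
  qed
qed

context finite_group_char_zero
begin

text \<open>The contraction averages over the last argument. In the cocycle identity for \<open>f\<close> at
  \<open>(g\<^sub>1, \<dots>, g\<^sub>n, h)\<close>, averaged over \<open>h\<close>, the argument
  \<open>g\<^sub>n h\<close> can be replaced by \<open>h\<close>. All terms but the last then add up to the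
  coboundary of the averaged cochain \<open>s\<close>, and the last one is
  \<open>f(g\<^sub>1, \<dots>, g\<^sub>n)\<close> up to sign.\<close>

lemma cochain_contraction:
  assumes M: "group_module K G M" and f: "f \<in> tuples G (Suc m) \<rightarrow>\<^sub>E carrier M"
    and df: "cochain_d G M (Suc m) f = (\<lambda>gs\<in>tuples G (Suc (Suc m)). \<zero>\<^bsub>M\<^esub>)"
    and gs: "gs \<in> tuples G (Suc m)"
  defines "s \<equiv> \<lambda>gs\<in>tuples G m. mean K G M (\<lambda>h. f (gs @ [h]))"
  shows "cochain_d G M m s gs \<oplus>\<^bsub>M\<^esub> sgn_mult M m (f gs) = \<zero>\<^bsub>M\<^esub>"
proof -
  note M = group_moduleD[OF M]
  interpret module K M by (rule M(1))
  note sg = linear_mapD[OF sgn_mult_linear[OF M(1)]]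
  have fc: "f xs \<in> carrier M" if "xs \<in> tuples G (Suc m)" for xs using f that by auto
  have sn: "xs @ [h] \<in> tuples G (Suc n)" if "xs \<in> tuples G n" "h \<in> carrier G" for xs h n
    using that by (auto simp: tuples_iff)
  have t: "tl gs \<in> tuples G m" "butlast gs \<in> tuples G m" "hd gs \<in> carrier G" "last gs \<in> carrier G"
    "gs \<noteq> []" "length gs = Suc m"
    using gs by (cases gs; force simp: tuples_iff dest: in_set_butlastD)+
  note mt = merge_at_tuples[OF group_G gs]
  have sv: "s xs = mean K G M (\<lambda>h. f (xs @ [h]))" if "xs \<in> tuples G m" for xs
    using that by (simp add: s_def)
  have sc: "s xs \<in> carrier M" if "xs \<in> tuples G m" for xs
    unfolding sv[OF that] using sn[OF that] fc by (intro mean_closed[OF M(1)]) blast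
  let ?A = "\<lambda>h. opr M (hd gs) (f (tl gs @ [h]))"
  let ?B = "\<lambda>h. \<Oplus>\<^bsub>M\<^esub>i\<in>{1..m}. sgn_mult M i (f (merge_at G i gs @ [h]))"
  let ?C = "\<lambda>h. sgn_mult M (Suc m) (f (butlast gs @ [last gs \<otimes>\<^bsub>G\<^esub> h]))"
  let ?D = "sgn_mult M m (f gs)"
  have cA: "?A h \<in> carrier M" if "h \<in> carrier G" for h
    using that sn[OF t(1)] fc t(3) M(5) by auto
  have cBi: "sgn_mult M i (f (merge_at G i gs @ [h])) \<in> carrier M" if "h \<in> carrier G" "i \<in> {1..m}" for h i
    using that sn[OF mt] fc sg(1) by auto
  have cB: "?B h \<in> carrier M" if "h \<in> carrier G" for h
    using that cBi by (intro M.finsum_closed) blast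
  have cC': "f (butlast gs @ [last gs \<otimes>\<^bsub>G\<^esub> h]) \<in> carrier M" if "h \<in> carrier G" for h
    using that sn[OF t(2)] fc t(4) by auto
  have cC: "?C h \<in> carrier M" if "h \<in> carrier G" for h
    using that cC' sg(1) by blast
  have cD: "?D \<in> carrier M" using fc gs sg(1) by blast
  have pt: "?A h \<oplus>\<^bsub>M\<^esub> ?B h \<oplus>\<^bsub>M\<^esub> ?C h \<oplus>\<^bsub>M\<^esub> ?D = \<zero>\<^bsub>M\<^esub>" if h: "h \<in> carrier G" for h
  proof -
    have m1: "merge_at G i (gs @ [h]) = merge_at G i gs @ [h]" if "i \<in> {1..m}" for i
      using that t(6) by (auto simp: nth_append)
    have m2: "merge_at G (Suc m) (gs @ [h]) = butlast gs @ [last gs \<otimes>\<^bsub>G\<^esub> h]"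
      using t(5,6) by (auto simp: nth_append butlast_conv_take last_conv_nth)
    have "(\<Oplus>\<^bsub>M\<^esub>i\<in>{1..Suc m}. sgn_mult M i (f (merge_at G i (gs @ [h])))) =
      ?C h \<oplus>\<^bsub>M\<^esub> (\<Oplus>\<^bsub>M\<^esub>i\<in>{1..m}. sgn_mult M i (f (merge_at G i (gs @ [h]))))"
    proof -
      have "{1..Suc m} = insert (Suc m) {1..m}" by auto
      then show ?thesis
        using cC[OF h] cBi[OF h] m1 m2 by (simp add: Pi_def)
    qed
    also have "(\<Oplus>\<^bsub>M\<^esub>i\<in>{1..m}. sgn_mult M i (f (merge_at G i (gs @ [h])))) = ?B h"
      using m1 cBi[OF h] by (intro M.finsum_cong') auto
    finally have sum: "(\<Oplus>\<^bsub>M\<^esub>i\<in>{1..Suc m}. sgn_mult M i (f (merge_at G i (gs @ [h])))) = ?C h \<oplus>\<^bsub>M\<^esub> ?B h" .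
    have "cochain_d G M (Suc m) f (gs @ [h]) = ?A h \<oplus>\<^bsub>M\<^esub> (?C h \<oplus>\<^bsub>M\<^esub> ?B h) \<oplus>\<^bsub>M\<^esub> ?D"
      unfolding cochain_d_def restrict_apply'[OF sn[OF gs h]] sum using t(5)
      by (simp add: sgn_mult_def[of M "Suc (Suc m)"] sgn_mult_def[of M m])
    then show ?thesis
      using df sn[OF gs h] cA[OF h] cB[OF h] cC[OF h] cD by (simp add: M.a_ac)
  qed
  have "\<zero>\<^bsub>M\<^esub> = mean K G M (\<lambda>h. ?A h \<oplus>\<^bsub>M\<^esub> ?B h \<oplus>\<^bsub>M\<^esub> ?C h \<oplus>\<^bsub>M\<^esub> ?D)"
  proof -
    have "mean K G M (\<lambda>h. ?A h \<oplus>\<^bsub>M\<^esub> ?B h \<oplus>\<^bsub>M\<^esub> ?C h \<oplus>\<^bsub>M\<^esub> ?D) = mean K G M (\<lambda>_. \<zero>\<^bsub>M\<^esub>)"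
      by (rule mean_cong[OF M(1) pt M.zero_closed])
    then show ?thesis by (simp only: mean_const[OF M(1) M.zero_closed])
  qed
  also have "\<dots> = mean K G M ?A \<oplus>\<^bsub>M\<^esub> mean K G M ?B \<oplus>\<^bsub>M\<^esub> mean K G M ?C \<oplus>\<^bsub>M\<^esub> ?D"
    using mean_add[OF M(1), of "\<lambda>h. ?A h \<oplus>\<^bsub>M\<^esub> ?B h \<oplus>\<^bsub>M\<^esub> ?C h" "\<lambda>_. ?D"]
      mean_add[OF M(1), of "\<lambda>h. ?A h \<oplus>\<^bsub>M\<^esub> ?B h" ?C] mean_add[OF M(1), of ?A ?B]
      mean_const[OF M(1) cD] M.a_closed cA cB cC cD by presburger
  also have "mean K G M ?A = opr M (hd gs) (s (tl gs))"
    unfolding sv[OF t(1)] using sn[OF t(1)] fc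
    by (intro mean_linear_map[OF M(1) M(1) M(2)[OF t(3)], symmetric]) blast
  also have "mean K G M ?B = (\<Oplus>\<^bsub>M\<^esub>i\<in>{1..m}. sgn_mult M i (s (merge_at G i gs)))"
  proof -
    have "mean K G M ?B = (\<Oplus>\<^bsub>M\<^esub>i\<in>{1..m}. mean K G M (\<lambda>h. sgn_mult M i (f (merge_at G i gs @ [h]))))"
      using cBi by (intro mean_finsum[OF M(1)]) auto
    also have "\<dots> = (\<Oplus>\<^bsub>M\<^esub>i\<in>{1..m}. sgn_mult M i (s (merge_at G i gs)))"
    proof (rule M.finsum_cong'[OF refl])
      fix i assume i: "i \<in> {1..m}"
      show "mean K G M (\<lambda>h. sgn_mult M i (f (merge_at G i gs @ [h]))) = sgn_mult M i (s (merge_at G i gs))"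
        unfolding sv[OF mt[OF i]] using sn[OF mt[OF i]] fc
        by (intro mean_linear_map[OF M(1) M(1) sgn_mult_linear[OF M(1)], symmetric]) blast
    qed (use sc mt sg(1) in auto)
    finally show ?thesis .
  qed
  also have "mean K G M ?C = sgn_mult M (Suc m) (s (butlast gs))"
  proof -
    have "mean K G M ?C = sgn_mult M (Suc m) (mean K G M (\<lambda>h. f (butlast gs @ [last gs \<otimes>\<^bsub>G\<^esub> h])))"
      using cC' by (intro mean_linear_map[OF M(1) M(1) sgn_mult_linear[OF M(1)], symmetric]) blast
    also have "mean K G M (\<lambda>h. f (butlast gs @ [last gs \<otimes>\<^bsub>G\<^esub> h])) = s (butlast gs)"
      unfolding sv[OF t(2)] using mean_translate[OF M(1) _ t(4), of "\<lambda>h. f (butlast gs @ [h])"] sn[OF t(2)] fc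
      by blast
    finally show ?thesis .
  qed
  finally show ?thesis
    using gs by (simp add: cochain_d_def)
qed

text \<open>A cocycle \<open>f\<close> of degree \<open>m + 1\<close> is
  \<open>(-1)\<^sup>m\<^sup>+\<^sup>1\<close> times the coboundary of its contraction.\<close>

lemma group_cohomology_pos:
  assumes M: "group_module K G M" and "n > 0"
  shows "carrier (group_cohomology G M n) = {\<zero>\<^bsub>group_cohomology G M n\<^esub>}"
proof -
  obtain m where n: "n = Suc m" using \<open>n > 0\<close> by (cases n) auto
  note Md = group_moduleD[OF M]
  interpret module K M by (rule Md(1))
  note mc = cochains_module[OF K.is_cring Md(1), of G]
  note ld = cochain_d_linear[OF group_G M]
  let ?B = "coboundaries (cochains G M) (cochain_d G M) n"
  have "f \<in> ?B" if f: "f \<in> cocycles (cochains G M) (cochain_d G M) n" for f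
  proof -
    interpret C: module K "cochains G M n" by (rule mc)
    define s where "s = (\<lambda>gs\<in>tuples G m. mean K G M (\<lambda>h. f (gs @ [h])))"
    have fE: "f \<in> tuples G (Suc m) \<rightarrow>\<^sub>E carrier M"
      using f by (auto simp: cocycles_def cochains_def n)
    then have fC: "f \<in> carrier (cochains G M n)" by (simp add: cochains_def n)
    have sC: "s \<in> carrier (cochains G M m)"
      using fE mean_closed[OF Md(1)] unfolding s_def cochains_def
      by (auto simp: tuples_iff PiE_iff)
    have dC: "cochain_d G M m s \<in> carrier (cochains G M n)"
      unfolding n by (rule linear_mapD(1)[OF ld sC])
    have con: "cochain_d G M m s gs \<oplus>\<^bsub>M\<^esub> sgn_mult M m (f gs) = \<zero>\<^bsub>M\<^esub>" if "gs \<in> tuples G n" for gs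
      unfolding s_def using f that fE
      by (intro cochain_contraction[OF M]) (auto simp: cocycles_def cochains_def n)
    have dB: "cochain_d G M m s \<in> ?B"
      using sC by (auto simp: coboundaries_def n)
    have dc: "cochain_d G M m s gs \<in> carrier M" "f gs \<in> carrier M" if "gs \<in> tuples G n" for gs
      using dC fC that by (auto simp: cochains_def)
    show ?thesis
    proof (cases "even m")
      case True
      have "cochain_d G M m s \<oplus>\<^bsub>cochains G M n\<^esub> f = \<zero>\<^bsub>cochains G M n\<^esub>"
        using con True by (auto simp: cochains_def sgn_mult_def fun_eq_iff)
      then have "f = \<ominus>\<^bsub>cochains G M n\<^esub> cochain_d G M m s"
        using dC fC by (metis C.M.a_comm C.M.minus_equality)
      then show ?thesis using submoduleD(4)[OF mc coboundaries_submodule[where C="cochains G M" and d="cochain_d G M", OF mc ld]] dB by simp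
    next
      case False
      have "cochain_d G M m s gs = f gs" if "gs \<in> tuples G n" for gs
        using con[OF that] dc[OF that] False M.minus_eq_zero_iff[of "cochain_d G M m s gs" "f gs"]
        by (simp add: sgn_mult_def a_minus_def)
      then have "cochain_d G M m s = f"
        using dC fC unfolding cochains_def by (intro extensionalityI[of _ "tuples G n"]) (auto simp: PiE_iff)
      then show ?thesis using dB by simp
    qed
  qed
  then show ?thesis
    unfolding group_cohomology_def cohomology_def
    by (intro subquotient_zero_carrier[OF mc coboundaries_submodule[where C="cochains G M" and d="cochain_d G M", OF mc ld] cocycles_submodule[where C="cochains G M" and d="cochain_d G M", OF mc ld]]) auto
qed

end

section \<open>Double complexes whose rows have a resolved cohomology\<close>

text \<open>As in the total complex, the row \<open>p\<close> consists of the entries \<open>A p q\<close>, between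
  which \<open>dh\<close> acts, and the filtration is by rows.\<close>

locale double_complex =
  fixes K :: "('k, 'a) ring_scheme"
    and A :: "nat \<Rightarrow> nat \<Rightarrow> ('k, 'm, 'b) module_scheme"
    and dv dh :: "nat \<Rightarrow> nat \<Rightarrow> 'm \<Rightarrow> 'm"
  assumes A_module: "\<And>p q. module K (A p q)"
    and dv_linear: "\<And>p q. linear_map K (A p q) (A (Suc p) q) (dv p q)"
    and dh_linear: "\<And>p q. linear_map K (A p q) (A p (Suc q)) (dh p q)"
    and dv_dv: "\<And>p q x. x \<in> carrier (A p q) \<Longrightarrow> dv (Suc p) q (dv p q x) = \<zero>\<^bsub>A (Suc (Suc p)) q\<^esub>"
    and dh_dh: "\<And>p q x. x \<in> carrier (A p q) \<Longrightarrow> dh p (Suc q) (dh p q x) = \<zero>\<^bsub>A p (Suc (Suc q))\<^esub>"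
    and dv_dh: "\<And>p q x. x \<in> carrier (A p q) \<Longrightarrow> dv p (Suc q) (dh p q x) = dh (Suc p) q (dv p q x)"
begin

abbreviation D :: "int \<Rightarrow> (int \<Rightarrow> 'm) \<Rightarrow> (int \<Rightarrow> 'm)"
  where "D \<equiv> tot_d A dv dh"

abbreviation Fil :: "int \<Rightarrow> int \<Rightarrow> (int \<Rightarrow> 'm) set"
  where "Fil \<equiv> tot_filt A"

abbreviation comp :: "int \<Rightarrow> int \<Rightarrow> ('k, 'm, 'b) module_scheme"
  where "comp n p \<equiv> A (nat p) (nat (n - p))"

lemma base_cring: "cring K"
  using A_module[of 0 0] by (simp add: module_def)

lemma tot_module: "module K (tot A n)"
  unfolding tot_def by (rule pointwise_module[OF base_cring A_module])

lemma tot_simps: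
  "x \<in> carrier (tot A n) \<longleftrightarrow> x \<in> extensional {0..n} \<and> (\<forall>p\<in>{0..n}. x p \<in> carrier (comp n p))"
  "\<zero>\<^bsub>tot A n\<^esub> = (\<lambda>p\<in>{0..n}. \<zero>\<^bsub>comp n p\<^esub>)"
  "p \<in> {0..n} \<Longrightarrow> (x \<oplus>\<^bsub>tot A n\<^esub> y) p = x p \<oplus>\<^bsub>comp n p\<^esub> y p"
  "p \<in> {0..n} \<Longrightarrow> (k \<odot>\<^bsub>tot A n\<^esub> x) p = k \<odot>\<^bsub>comp n p\<^esub> x p"
  by (auto simp: tot_def PiE_iff)

lemma tot_proj_linear:
  assumes "p \<in> {0..n}"
  shows "linear_map K (tot A n) (comp n p) (\<lambda>x. x p)"
  using assms by (intro linear_mapI) (auto simp: tot_simps)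

lemma tot_minus:
  assumes "x \<in> carrier (tot A n)" "y \<in> carrier (tot A n)" "p \<in> {0..n}"
  shows "(x \<ominus>\<^bsub>tot A n\<^esub> y) p = x p \<ominus>\<^bsub>comp n p\<^esub> y p"
  using linear_map_minus[OF tot_module A_module tot_proj_linear[OF assms(3)] assms(1,2)] .

text \<open>The two summands of \<open>D x\<close> in row \<open>p\<close>, one for each differential.
  Separating them leaves the two boundary cases of \<open>tot_d\<close> to one summand each.\<close>

definition vpart :: "int \<Rightarrow> int \<Rightarrow> (int \<Rightarrow> 'm) \<Rightarrow> 'm"
  where "vpart n p x =
    (if p = 0 then \<zero>\<^bsub>comp (n + 1) p\<^esub> else dv (nat (p - 1)) (nat (n + 1 - p)) (x (p - 1)))"

definition hpart :: "int \<Rightarrow> int \<Rightarrow> (int \<Rightarrow> 'm) \<Rightarrow> 'm"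
  where "hpart n p x =
    (if p = n + 1 then \<zero>\<^bsub>comp (n + 1) p\<^esub>
     else sgn_mult (comp (n + 1) p) (nat p) (dh (nat p) (nat (n - p)) (x p)))"

lemma D_apply: "p \<in> {0..n + 1} \<Longrightarrow> D n x p = vpart n p x \<oplus>\<^bsub>comp (n + 1) p\<^esub> hpart n p x"
  by (simp add: tot_d_def vpart_def hpart_def Let_def)

lemma zero_linear: "linear_map K (tot A n) (A p q) (\<lambda>_. \<zero>\<^bsub>A p q\<^esub>)"
proof -
  interpret module K "A p q" by (rule A_module)
  show ?thesis by (rule linear_mapI) auto
qed

lemma vpart_linear:
  assumes "p \<in> {0..n + 1}"
  shows "linear_map K (tot A n) (comp (n + 1) p) (vpart n p)"
proof (cases "p = 0")
  case False
  then have *: "p - 1 \<in> {0..n}" "n - (p - 1) = n + 1 - p" "Suc (nat (p - 1)) = nat p"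
    using assms by auto
  then show ?thesis
    using linear_map_comp[OF tot_proj_linear[OF *(1)] dv_linear[of "nat (p - 1)" "nat (n + 1 - p)", folded *(2)]] False
    unfolding *(2,3) vpart_def by simp
qed (simp add: vpart_def[abs_def] zero_linear)

lemma hpart_linear:
  assumes "p \<in> {0..n + 1}"
  shows "linear_map K (tot A n) (comp (n + 1) p) (hpart n p)"
proof (cases "p = n + 1")
  case False
  then have *: "p \<in> {0..n}" "Suc (nat (n - p)) = nat (n + 1 - p)"
    using assms by auto
  show ?thesis
    using linear_map_comp[OF linear_map_comp[OF tot_proj_linear[OF *(1)] dh_linear]
        sgn_mult_linear[OF A_module]] False
    unfolding *(2) hpart_def by simp
qed (simp add: hpart_def[abs_def] zero_linear)

lemma D_linear: "linear_map K (tot A n) (tot A (n + 1)) (D n)"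
proof (rule linear_mapI)
  fix x assume x: "x \<in> carrier (tot A n)"
  have "D n x p \<in> carrier (comp (n + 1) p)" if p: "p \<in> {0..n + 1}" for p
  proof -
    interpret module K "comp (n + 1) p" by (rule A_module)
    show ?thesis
      using x linear_mapD(1)[OF vpart_linear[OF p]] linear_mapD(1)[OF hpart_linear[OF p]]
      by (simp add: D_apply[OF p])
  qed
  then show "D n x \<in> carrier (tot A (n + 1))" by (simp add: tot_simps) (simp add: tot_d_def)
next
  fix x y assume x: "x \<in> carrier (tot A n)" and y: "y \<in> carrier (tot A n)"
  have "D n (x \<oplus>\<^bsub>tot A n\<^esub> y) p = (D n x \<oplus>\<^bsub>tot A (n + 1)\<^esub> D n y) p" if p: "p \<in> {0..n + 1}" for p
  proof -
    interpret module K "comp (n + 1) p" by (rule A_module)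
    note v = linear_mapD[OF vpart_linear[OF p]] and h = linear_mapD[OF hpart_linear[OF p]]
    show ?thesis
      using x y v(1)[OF x] v(1)[OF y] h(1)[OF x] h(1)[OF y]
      by (simp add: D_apply[OF p] tot_simps(3)[OF p] v(2) h(2) M.a_ac)
  qed
  then show "D n (x \<oplus>\<^bsub>tot A n\<^esub> y) = D n x \<oplus>\<^bsub>tot A (n + 1)\<^esub> D n y"
    by (intro extensionalityI[of _ "{0..n + 1}"]) (simp_all add: tot_def tot_d_def)
next
  fix k x assume k: "k \<in> carrier K" and x: "x \<in> carrier (tot A n)"
  have "D n (k \<odot>\<^bsub>tot A n\<^esub> x) p = (k \<odot>\<^bsub>tot A (n + 1)\<^esub> D n x) p" if p: "p \<in> {0..n + 1}" for p
  proof -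
    interpret module K "comp (n + 1) p" by (rule A_module)
    note v = linear_mapD[OF vpart_linear[OF p]] and h = linear_mapD[OF hpart_linear[OF p]]
    show ?thesis
      using k x v(1)[OF x] h(1)[OF x]
      by (simp add: D_apply[OF p] tot_simps(4)[OF p] v(3) h(3) smult_r_distr)
  qed
  then show "D n (k \<odot>\<^bsub>tot A n\<^esub> x) = k \<odot>\<^bsub>tot A (n + 1)\<^esub> D n x"
    by (intro extensionalityI[of _ "{0..n + 1}"]) (simp_all add: tot_def tot_d_def)
qed

lemma zero_maps [simp]:
  "dv p q \<zero>\<^bsub>A p q\<^esub> = \<zero>\<^bsub>A (Suc p) q\<^esub>"
  "dh p q \<zero>\<^bsub>A p q\<^esub> = \<zero>\<^bsub>A p (Suc q)\<^esub>"
  "sgn_mult (A p q) i \<zero>\<^bsub>A p q\<^esub> = \<zero>\<^bsub>A p q\<^esub>"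
  using linear_map_zero[OF A_module A_module dv_linear] linear_map_zero[OF A_module A_module dh_linear]
    linear_map_zero[OF A_module A_module sgn_mult_linear[OF A_module]] by auto

lemma sgn_mult_eq_zero:
  assumes "x \<in> carrier (A p q)"
  shows "sgn_mult (A p q) i x = \<zero>\<^bsub>A p q\<^esub> \<longleftrightarrow> x = \<zero>\<^bsub>A p q\<^esub>"
proof -
  interpret module K "A p q" by (rule A_module)
  show ?thesis using assms by (auto simp: sgn_mult_def)
qed

text \<open>In row \<open>p\<close> only the two ways around one square survive, and they cancel because the
  sign of the horizontal differential alternates with the row.\<close>

lemma D_D:
  assumes x: "x \<in> carrier (tot A n)"
  shows "D (n + 1) (D n x) = \<zero>\<^bsub>tot A (n + 2)\<^esub>"
proof -
  have "D (n + 1) (D n x) p = \<zero>\<^bsub>comp (n + 2) p\<^esub>" if p: "p \<in> {0..n + 2}" for p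
  proof -
    interpret C: module K "comp (n + 2) p" by (rule A_module)
    define y where "y = sgn_mult (comp (n + 2) p) (nat p) (dv (nat (p - 1)) (nat (n + 2 - p)) (dh (nat (p - 1)) (nat (n + 1 - p)) (x (p - 1))))"
    have xp: "x (p - 1) \<in> carrier (A (nat (p - 1)) (nat (n + 1 - p)))" if "p \<noteq> 0" "p \<noteq> n + 2"
      using that p x unfolding tot_simps(1) by (auto dest: bspec[of _ _ "p - 1"] simp: algebra_simps)
    have v: "vpart (n + 1) p (D n x) = (if p = 0 \<or> p = n + 2 then \<zero>\<^bsub>comp (n + 2) p\<^esub> else \<ominus>\<^bsub>comp (n + 2) p\<^esub> y)"
    proof (cases "p = 0")
      case False
      then have q: "p - 1 \<in> {0..n + 1}" "Suc (nat (p - 1)) = nat p" "n + 1 + 1 - p = n + 1 - (p - 1)"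
        "n + 2 - p = n + 1 - (p - 1)"
        using p by auto
      interpret B: module K "comp (n + 1) (p - 1)" by (rule A_module)
      note dvl = linear_mapD[OF dv_linear[of "nat (p - 1)" "nat (n + 1 - (p - 1))"], unfolded q(2)]
      have vc: "vpart n (p - 1) x \<in> carrier (comp (n + 1) (p - 1))"
        and hc: "hpart n (p - 1) x \<in> carrier (comp (n + 1) (p - 1))"
        using linear_mapD(1)[OF vpart_linear[OF q(1)] x] linear_mapD(1)[OF hpart_linear[OF q(1)] x] by auto
      have "dv (nat (p - 1)) (nat (n + 1 - (p - 1))) (vpart n (p - 1) x) = \<zero>\<^bsub>comp (n + 2) p\<^esub>"
      proof (cases "p - 1 = 0")
        case True
        then show ?thesis using q(2,4) zero_maps(1)[of "nat (p - 1)" "nat (n + 1 - (p - 1))"]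
          by (simp add: vpart_def add.commute)
      next
        case False
        then have r: "Suc (nat (p - 2)) = nat (p - 1)" "p - 2 \<in> {0..n}" "n - (p - 2) = n + 1 - (p - 1)"
          using q(1) by auto
        have "x (p - 2) \<in> carrier (A (nat (p - 2)) (nat (n + 1 - (p - 1))))"
          using x r(2) unfolding tot_simps(1) r(3)[symmetric] by blast
        from dv_dv[OF this] show ?thesis
          using False unfolding vpart_def r(1) q(2) q(4) by simp
      qed
      moreover have "vpart (n + 1) p (D n x) = dv (nat (p - 1)) (nat (n + 1 - (p - 1))) (D n x (p - 1))"
        using False unfolding vpart_def q(3) by simp
      ultimately have "vpart (n + 1) p (D n x) = dv (nat (p - 1)) (nat (n + 1 - (p - 1))) (hpart n (p - 1) x)"
        unfolding D_apply[OF q(1)] dvl(2)[OF vc hc] q(4) C.M.l_zero[unfolded q(4), OF dvl(1)[OF hc]]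
        by (simp only: C.M.l_zero[unfolded q(4), OF dvl(1)[OF hc]])
      also have "\<dots> = (if p = n + 2 then \<zero>\<^bsub>comp (n + 2) p\<^esub> else \<ominus>\<^bsub>comp (n + 2) p\<^esub> y)"
      proof (cases "p = n + 2")
        case True
        then show ?thesis using q(2,4) zero_maps(1)[of "nat (p - 1)" "nat (n + 1 - (p - 1))"] by (simp add: hpart_def)
      next
        case False
        then have r: "Suc (nat (n + 1 - p)) = nat (n + 2 - p)" "n - (p - 1) = n + 1 - p" "nat p = Suc (nat (p - 1))"
          using p \<open>p \<noteq> 0\<close> by auto
        let ?u = "dh (nat (p - 1)) (nat (n + 1 - p)) (x (p - 1))"
        have u: "?u \<in> carrier (comp (n + 1) (p - 1))"
          using linear_mapD(1)[OF dh_linear xp[OF \<open>p \<noteq> 0\<close> False]] unfolding r(1) q(4) .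
        have "dv (nat (p - 1)) (nat (n + 1 - (p - 1))) (sgn_mult (comp (n + 1) (p - 1)) (nat (p - 1)) ?u)
          = sgn_mult (comp (n + 2) p) (nat (p - 1)) (dv (nat (p - 1)) (nat (n + 1 - (p - 1))) ?u)"
          using linear_map_uminus[OF A_module A_module dv_linear u] unfolding sgn_mult_def q(2,4) by simp
        also have "\<dots> = \<ominus>\<^bsub>comp (n + 2) p\<^esub> y"
        proof -
          have "even (nat p) \<longleftrightarrow> odd (nat (p - 1))" using r(3) by simp
          then show ?thesis
            using C.M.minus_minus[unfolded q(4), OF dvl(1)[OF u]]
            unfolding y_def sgn_mult_def q(4) by simp
        qed
        finally show ?thesis using False by (simp add: hpart_def r(2))
      qed
      finally show ?thesis using False by simp
    qed (simp add: vpart_def add.commute)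
    have h: "hpart (n + 1) p (D n x) = (if p = 0 \<or> p = n + 2 then \<zero>\<^bsub>comp (n + 2) p\<^esub> else y)"
    proof (cases "p = n + 2")
      case False
      then have q: "p \<in> {0..n + 1}" "Suc (nat (n + 1 - p)) = nat (n + 2 - p)" using p by auto
      note dhl = linear_mapD[OF dh_linear[of "nat p" "nat (n + 1 - p)"], unfolded q(2)]
      interpret B: module K "comp (n + 1) p" by (rule A_module)
      have vc: "vpart n p x \<in> carrier (comp (n + 1) p)" and hc: "hpart n p x \<in> carrier (comp (n + 1) p)"
        using linear_mapD(1)[OF vpart_linear[OF q(1)] x] linear_mapD(1)[OF hpart_linear[OF q(1)] x] by auto
      have "dh (nat p) (nat (n + 1 - p)) (hpart n p x) = \<zero>\<^bsub>comp (n + 2) p\<^esub>"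
      proof (cases "p = n + 1")
        case True
        then show ?thesis using zero_maps(2)[of "nat p" "nat (n + 1 - p)"] by (simp add: hpart_def q(2))
      next
        case False
        then have r: "Suc (nat (n - p)) = nat (n + 1 - p)" "p \<in> {0..n}" using q by auto
        have xc: "x p \<in> carrier (A (nat p) (nat (n - p)))" using x r(2) unfolding tot_simps(1) by blast
        note u = linear_mapD(1)[OF dh_linear xc, unfolded r(1)]
        have "dh (nat p) (nat (n + 1 - p)) (dh (nat p) (nat (n - p)) (x p)) = \<zero>\<^bsub>comp (n + 2) p\<^esub>"
          using dh_dh[OF xc] unfolding r(1) q(2) .
        then show ?thesis using False linear_map_uminus[OF A_module A_module dh_linear u]
          unfolding q(2) by (simp add: hpart_def sgn_mult_def)
      qed
      moreover have "hpart (n + 1) p (D n x) =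
        sgn_mult (comp (n + 2) p) (nat p) (dh (nat p) (nat (n + 1 - p)) (D n x p))"
      proof -
        have "n + 1 + 1 = n + 2" by simp
        then show ?thesis unfolding hpart_def using False by (simp only: if_False)
      qed
      ultimately have "hpart (n + 1) p (D n x) =
        sgn_mult (comp (n + 2) p) (nat p) (dh (nat p) (nat (n + 1 - p)) (vpart n p x))"
        unfolding D_apply[OF q(1)] dhl(2)[OF vc hc] using dhl(1)[OF vc] by simp
      also have "\<dots> = (if p = 0 then \<zero>\<^bsub>comp (n + 2) p\<^esub> else y)"
      proof (cases "p = 0")
        case True
        then show ?thesis using zero_maps(2)[of "nat p" "nat (n + 1 - p)"] q(2) by (simp add: vpart_def)
      next
        case False
        then have r: "Suc (nat (p - 1)) = nat p" using p by auto
        show ?thesis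
          using False dv_dh[OF xp[OF False \<open>p \<noteq> n + 2\<close>]] by (simp add: vpart_def y_def r q(2))
      qed
      finally show ?thesis using False by simp
    qed (simp add: hpart_def)
    have "y \<in> carrier (comp (n + 2) p)" if "\<not> (p = 0 \<or> p = n + 2)"
    proof -
      have r: "Suc (nat (p - 1)) = nat p" "Suc (nat (n + 1 - p)) = nat (n + 2 - p)" using p that by auto
      show ?thesis
        unfolding y_def using linear_mapD(1)[OF dv_linear linear_mapD(1)[OF dh_linear xp]] that
        unfolding r by (intro linear_mapD(1)[OF sgn_mult_linear[OF A_module]]) auto
    qed
    moreover have "D (n + 1) (D n x) p = vpart (n + 1) p (D n x) \<oplus>\<^bsub>comp (n + 2) p\<^esub> hpart (n + 1) p (D n x)"
      using D_apply[of p "n + 1"] p by (simp add: add.commute)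
    ultimately show ?thesis unfolding v h by (simp add: C.M.l_neg)
  qed
  moreover have "D m y \<in> extensional {0..m + 1}" for m y by (simp add: tot_d_def)
  from this[of "n + 1"] have "D (n + 1) (D n x) \<in> extensional {0..n + 2}" by (simp only: add.assoc one_add_one)
  ultimately show ?thesis by (intro extensionalityI[of _ "{0..n + 2}"]) (auto simp: tot_simps)
qed


subsection \<open>Filtration and pages\<close>

lemma Fil_iff:
  "x \<in> Fil s n \<longleftrightarrow> x \<in> carrier (tot A n) \<and> (\<forall>p\<in>{0..n}. p < s \<longrightarrow> x p = \<zero>\<^bsub>comp n p\<^esub>)"
  by (auto simp: tot_filt_def)

lemma Fil_carrier: "x \<in> Fil s n \<Longrightarrow> x \<in> carrier (tot A n)"
  by (simp add: Fil_iff)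

lemma Fil_antimono: "s \<le> t \<Longrightarrow> x \<in> Fil t n \<Longrightarrow> x \<in> Fil s n"
  by (auto simp: Fil_iff)

lemma Fil_nonpos: "s \<le> 0 \<Longrightarrow> Fil s n = carrier (tot A n)"
  by (auto simp: Fil_iff)

lemma Fil_submodule: "submodule (Fil s n) K (tot A n)"
proof (rule submodule_by_closure[OF tot_module])
  interpret T: module K "tot A n" by (rule tot_module)
  show "\<zero>\<^bsub>tot A n\<^esub> \<in> Fil s n" by (simp add: Fil_iff) (simp add: tot_simps)
  fix x y assume "x \<in> Fil s n" "y \<in> Fil s n"
  moreover have "\<zero>\<^bsub>comp n p\<^esub> \<oplus>\<^bsub>comp n p\<^esub> \<zero>\<^bsub>comp n p\<^esub> = \<zero>\<^bsub>comp n p\<^esub>" for p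
    using A_module[of "nat p" "nat (n - p)"] by (metis abelian_groupE(2,5) module_def)
  ultimately show "x \<oplus>\<^bsub>tot A n\<^esub> y \<in> Fil s n" by (auto simp: Fil_iff tot_simps(3))
next
  interpret T: module K "tot A n" by (rule tot_module)
  fix k x assume "k \<in> carrier K" "x \<in> Fil s n"
  moreover have "k \<odot>\<^bsub>comp n p\<^esub> \<zero>\<^bsub>comp n p\<^esub> = \<zero>\<^bsub>comp n p\<^esub>" if "k \<in> carrier K" for p
    using module.smult_r_null[OF A_module that] .
  ultimately show "k \<odot>\<^bsub>tot A n\<^esub> x \<in> Fil s n" by (auto simp: Fil_iff tot_simps(4))
qed (simp add: Fil_iff subset_iff)

abbreviation Zr :: "int \<Rightarrow> int \<Rightarrow> int \<Rightarrow> (int \<Rightarrow> 'm) set"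
  where "Zr \<equiv> ss_cycles A dv dh"

abbreviation Br :: "int \<Rightarrow> int \<Rightarrow> int \<Rightarrow> (int \<Rightarrow> 'm) set"
  where "Br \<equiv> ss_boundaries A dv dh"

text \<open>The second index is written as \<open>n - p\<close> throughout, which makes the total degree
  \<open>n\<close> a variable.\<close>

lemma Zr_iff: "x \<in> Zr r p (n - p) \<longleftrightarrow> x \<in> Fil p n \<and> D n x \<in> Fil (p + r) (n + 1)"
  by (simp add: ss_cycles_def)

lemma Br_iff:
  "x \<in> Br r p (n - p) \<longleftrightarrow> (\<exists>y\<in>Fil (p + 1) n. D n y \<in> Fil (p + r) (n + 1) \<and>
    (\<exists>w\<in>Fil (p - r + 1) (n - 1). D (n - 1) w \<in> Fil p n \<and> x = y \<oplus>\<^bsub>tot A n\<^esub> D (n - 1) w))"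
proof -
  have "y \<in> Zr (r - 1) (p + 1) (n - p - 1) \<longleftrightarrow> y \<in> Fil (p + 1) n \<and> D n y \<in> Fil (p + r) (n + 1)"
    and "y \<in> Zr (r - 1) (p - r + 1) (n - p + r - 2) \<longleftrightarrow>
      y \<in> Fil (p - r + 1) (n - 1) \<and> D (n - 1) y \<in> Fil p n" for y
    by (simp_all add: ss_cycles_def algebra_simps)
  then show ?thesis
    unfolding ss_boundaries_def set_add_iff by (auto simp add: bex_simps Bex_def)
qed

lemma Zr_submodule: "submodule (Zr r p (n - p)) K (tot A n)"
  using submodule_vimage[OF tot_module tot_module D_linear Fil_submodule Fil_submodule]
  by (simp add: ss_cycles_def)

lemma Br_submodule: "submodule (Br r p (n - p)) K (tot A n)"
proof -
  have "Br r p (n - p) = Zr (r - 1) (p + 1) (n - (p + 1)) <+>\<^bsub>tot A n\<^esub>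
      D (n - 1) ` Zr (r - 1) (p - r + 1) (n - 1 - (p - r + 1))"
    by (simp add: ss_boundaries_def algebra_simps)
  moreover have "linear_map K (tot A (n - 1)) (tot A n) (D (n - 1))" using D_linear[of "n - 1"] by simp
  ultimately show ?thesis
    using submodule_sum[OF tot_module Zr_submodule submodule_image[OF tot_module tot_module _ Zr_submodule]]
    by metis
qed

lemma page_module: "module K (ss_page A dv dh r p (n - p))"
  unfolding ss_page_def using subquotient_module[OF tot_module Br_submodule Zr_submodule] by simp

text \<open>The page at \<open>p + r\<close> divides out the differentials of the cycles
  \<open>Z\<^sub>r\<^sub>-\<^sub>1\<close> of filtration \<open>(p + r) - r + 1 = p + 1\<close>.\<close>

lemma D_cycles_in_Br:
  assumes "x \<in> Fil (p + 1) n" "D n x \<in> Fil (p + r) (n + 1)"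
  shows "D n x \<in> Br r (p + r) (n + 1 - (p + r))"
proof -
  interpret T: module K "tot A (n + 1)" by (rule tot_module)
  have z: "\<zero>\<^bsub>tot A (n + 1)\<^esub> \<in> Fil s (n + 1)" for s
    by (rule submoduleD(2)[OF tot_module Fil_submodule])
  have "D (n + 1) \<zero>\<^bsub>tot A (n + 1)\<^esub> = \<zero>\<^bsub>tot A (n + 1 + 1)\<^esub>"
    by (rule linear_map_zero[OF tot_module tot_module D_linear])
  then have "D (n + 1) \<zero>\<^bsub>tot A (n + 1)\<^esub> \<in> Fil (p + r + r) (n + 1 + 1)"
    using submoduleD(2)[OF tot_module Fil_submodule] by simp
  moreover have "\<exists>w\<in>Fil (p + r - r + 1) (n + 1 - 1). D (n + 1 - 1) w \<in> Fil (p + r) (n + 1) \<and>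
    D n x = \<zero>\<^bsub>tot A (n + 1)\<^esub> \<oplus>\<^bsub>tot A (n + 1)\<^esub> D (n + 1 - 1) w"
    using assms Fil_carrier[OF assms(2)] by (intro bexI[of _ x]) simp_all
  ultimately show ?thesis
    unfolding Br_iff using z by blast
qed

text \<open>The elements whose differentials are subtracted below have this shape, and so do the values
  of the edge map.\<close>

definition two_rows :: "int \<Rightarrow> int \<Rightarrow> 'm \<Rightarrow> 'm \<Rightarrow> int \<Rightarrow> 'm"
  where "two_rows n p a b =
    (\<lambda>i\<in>{0..n}. if i = p then a else if i = p + 1 then b else \<zero>\<^bsub>comp n i\<^esub>)"

lemma two_rows_Fil:
  assumes "p \<in> {0..n} \<Longrightarrow> a \<in> carrier (comp n p)"
    and "p + 1 \<in> {0..n} \<Longrightarrow> b \<in> carrier (comp n (p + 1))"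
  shows "two_rows n p a b \<in> Fil p n"
proof -
  have "\<zero>\<^bsub>comp n i\<^esub> \<in> carrier (comp n i)" for i
    using A_module[of "nat i" "nat (n - i)"] by (metis abelian_groupE(2) module_def)
  then show ?thesis
    using assms by (auto simp: Fil_iff tot_simps two_rows_def)
qed

lemma D_two_rows:
  assumes a: "p \<in> {0..n} \<Longrightarrow> a \<in> carrier (comp n p) \<and> dh (nat p) (nat (n - p)) a = \<zero>\<^bsub>comp (n + 1) p\<^esub>"
    and b: "p + 1 \<in> {0..n} \<Longrightarrow> b \<in> carrier (comp n (p + 1))"
  shows "D n (two_rows n p a b) \<in> Fil (p + 1) (n + 1)"
    and "p + 1 \<in> {0..n + 1} \<Longrightarrow> D n (two_rows n p a b) (p + 1) =
      (if p < 0 then \<zero>\<^bsub>comp (n + 1) (p + 1)\<^esub> else dv (nat p) (nat (n - p)) a) \<oplus>\<^bsub>comp (n + 1) (p + 1)\<^esub>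
      (if p = n then \<zero>\<^bsub>comp (n + 1) (p + 1)\<^esub>
       else sgn_mult (comp (n + 1) (p + 1)) (nat (p + 1)) (dh (nat (p + 1)) (nat (n - (p + 1))) b))"
proof -
  let ?w = "two_rows n p a b"
  have w: "?w \<in> Fil p n" using two_rows_Fil a b by blast
  have "D n ?w i = \<zero>\<^bsub>comp (n + 1) i\<^esub>" if i: "i \<in> {0..n + 1}" "i < p + 1" for i
  proof -
    interpret C: module K "comp (n + 1) i" by (rule A_module)
    have "vpart n i ?w = \<zero>\<^bsub>comp (n + 1) i\<^esub>"
    proof (cases "i = 0")
      case False
      then have r: "Suc (nat (i - 1)) = nat i" "n + 1 - i = n - (i - 1)" using i by auto
      have "?w (i - 1) = \<zero>\<^bsub>comp n (i - 1)\<^esub>" using w i False by (auto simp: Fil_iff)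
      then show ?thesis using False zero_maps(1)[of "nat (i - 1)" "nat (n - (i - 1))"]
        by (simp only: vpart_def r if_False)
    qed (simp add: vpart_def)
    moreover have "hpart n i ?w = \<zero>\<^bsub>comp (n + 1) i\<^esub>"
    proof (cases "i = n + 1")
      case False
      then have r: "Suc (nat (n - i)) = nat (n + 1 - i)" "i \<in> {0..n}" using i by auto
      have "dh (nat i) (nat (n - i)) (?w i) = \<zero>\<^bsub>comp (n + 1) i\<^esub>"
      proof (cases "i = p")
        case True
        then show ?thesis using a r(2) by (simp add: two_rows_def)
      next
        case False
        then have "?w i = \<zero>\<^bsub>comp n i\<^esub>" using w i r(2) by (auto simp: Fil_iff)
        then show ?thesis using zero_maps(2)[of "nat i" "nat (n - i)"] by (simp add: r(1))
      qed
      then show ?thesis using False by (simp add: hpart_def)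
    qed (simp add: hpart_def)
    ultimately show ?thesis by (simp add: D_apply[OF i(1)])
  qed
  then show "D n ?w \<in> Fil (p + 1) (n + 1)"
    using linear_mapD(1)[OF D_linear Fil_carrier[OF w]] by (auto simp: Fil_iff)
  assume i: "p + 1 \<in> {0..n + 1}"
  have "vpart n (p + 1) ?w = (if p < 0 then \<zero>\<^bsub>comp (n + 1) (p + 1)\<^esub> else dv (nat p) (nat (n - p)) a)"
    using i by (auto simp: vpart_def two_rows_def)
  moreover have "hpart n (p + 1) ?w = (if p = n then \<zero>\<^bsub>comp (n + 1) (p + 1)\<^esub>
       else sgn_mult (comp (n + 1) (p + 1)) (nat (p + 1)) (dh (nat (p + 1)) (nat (n - (p + 1))) b))"
    using i by (auto simp: hpart_def two_rows_def)
  ultimately show "D n (two_rows n p a b) (p + 1) =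
      (if p < 0 then \<zero>\<^bsub>comp (n + 1) (p + 1)\<^esub> else dv (nat p) (nat (n - p)) a) \<oplus>\<^bsub>comp (n + 1) (p + 1)\<^esub>
      (if p = n then \<zero>\<^bsub>comp (n + 1) (p + 1)\<^esub>
       else sgn_mult (comp (n + 1) (p + 1)) (nat (p + 1)) (dh (nat (p + 1)) (nat (n - (p + 1))) b))"
    by (simp add: D_apply[OF i])
qed

text \<open>In row \<open>p\<close> the differential of \<open>x\<close> is the horizontal differential of the leading
  entry, and in row \<open>p + 1\<close> it is the sum of the vertical differential of the leading entry
  and a horizontal coboundary. Both vanish when \<open>D x\<close> gains two steps of filtration, so that the
  leading entry represents a horizontal cohomology class that is a vertical cocycle.\<close>

lemma leading_entry:
  assumes x: "x \<in> Fil (int p) (int (p + q))" and Dx: "D (int (p + q)) x \<in> Fil (int p + 2) (int (p + q) + 1)"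
  shows "x (int p) \<in> cocycles (A p) (dh p) q"
    and "dv p q (x (int p)) \<in> coboundaries (A (Suc p)) (dh (Suc p)) q"
proof -
  (* The degree is kept as one variable, since the simplifier would split it into a sum. *)
  define n where "n = int (p + q)"
  note x = x[folded n_def] and Dx = Dx[folded n_def]
  let ?a = "x (int p)"
  have xc: "x i \<in> carrier (comp n i)" if "i \<in> {0..n}" for i
    using x that by (auto simp: Fil_iff tot_simps)
  have idx: "nat (int p - 1) = p - 1" "nat (n + 1 - int p) = Suc q" "nat (n - int p) = q"
    "nat (n + 1 - (int p + 1)) = q" "nat (int p + 1) = Suc p" "nat (n - (int p + 1)) = q - 1"
    by (simp_all add: n_def nat_diff_distrib')
  have pn: "int p \<in> {0..n}" "int p \<in> {0..n + 1}" "int p + 1 \<in> {0..n + 1}" "int p \<noteq> n + 1" by (simp_all add: n_def)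
  have ac: "?a \<in> carrier (A p q)" using xc[OF pn(1)] by (simp add: idx)
  have D0: "D n x (int p) = \<zero>\<^bsub>A p (Suc q)\<^esub>" and D1: "D n x (int p + 1) = \<zero>\<^bsub>A (Suc p) q\<^esub>"
    using Dx pn(2,3) unfolding Fil_iff by (auto simp: idx dest: bspec[of _ _ "int p"] bspec[of _ _ "int p + 1"])
  interpret M: module K "A p (Suc q)" by (rule A_module)
  interpret N: module K "A (Suc p) q" by (rule A_module)
  have dha: "dh p q ?a \<in> carrier (A p (Suc q))" by (rule linear_mapD(1)[OF dh_linear ac])
  have dva: "dv p q ?a \<in> carrier (A (Suc p) q)" by (rule linear_mapD(1)[OF dv_linear ac])
  have "vpart n (int p) x = \<zero>\<^bsub>A p (Suc q)\<^esub>"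
  proof (cases "p = 0")
    case False
    then have "x (int p - 1) = \<zero>\<^bsub>A (p - 1) (Suc q)\<^esub>"
      using x pn(1) idx(1) unfolding Fil_iff
      by (auto dest!: bspec[of _ _ "int p - 1"] simp: n_def nat_diff_distrib' nat_int_add)
    then show ?thesis
      using zero_maps(1)[of "p - 1" "Suc q"] False by (simp add: vpart_def idx)
  qed (use idx(2) in \<open>simp add: vpart_def\<close>)
  then have "sgn_mult (A p (Suc q)) p (dh p q ?a) = \<zero>\<^bsub>A p (Suc q)\<^esub>"
    using D0 D_apply[OF pn(2), of x] linear_mapD(1)[OF sgn_mult_linear[OF A_module] dha] pn(4)
    by (simp add: hpart_def idx)
  then have "dh p q ?a = \<zero>\<^bsub>A p (Suc q)\<^esub>" by (simp add: sgn_mult_eq_zero dha)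
  then show "?a \<in> cocycles (A p) (dh p) q" using ac by (simp add: cocycles_def)
  have "dv p q ?a \<oplus>\<^bsub>A (Suc p) q\<^esub> hpart n (int p + 1) x = \<zero>\<^bsub>A (Suc p) q\<^esub>"
    using D1 D_apply[OF pn(3), of x] by (simp add: vpart_def idx)
  moreover have hB: "hpart n (int p + 1) x \<in> coboundaries (A (Suc p)) (dh (Suc p)) q"
  proof (cases q)
    case 0
    then have "n = int p" by (simp add: n_def)
    then show ?thesis unfolding hpart_def 0 coboundaries_def by (simp add: nat_add_distrib)
  next
    case (Suc q')
    have "x (int p + 1) \<in> carrier (A (Suc p) q')" using xc[of "int p + 1"] by (simp add: idx Suc) (simp add: n_def Suc)
    then have "dh (Suc p) q' (x (int p + 1)) \<in> coboundaries (A (Suc p)) (dh (Suc p)) q"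
      by (simp add: coboundaries_def Suc)
    moreover have "int p \<noteq> n" by (simp add: n_def Suc)
    ultimately show ?thesis
      using submoduleD(4)[OF A_module coboundaries_submodule[where C="A (Suc p)" and d="dh (Suc p)", OF A_module dh_linear]]
      by (simp add: hpart_def sgn_mult_def idx) (simp add: Suc)
  qed
  ultimately have "dv p q ?a = \<ominus>\<^bsub>A (Suc p) q\<^esub> hpart n (int p + 1) x"
    using dva submoduleD(1)[OF A_module coboundaries_submodule[where C="A (Suc p)" and d="dh (Suc p)", OF A_module dh_linear] hB]
    by (metis N.M.minus_equality)
  then show "dv p q ?a \<in> coboundaries (A (Suc p)) (dh (Suc p)) q"
    using submoduleD(4)[OF A_module coboundaries_submodule[where C="A (Suc p)" and d="dh (Suc p)", OF A_module dh_linear] hB]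
    by simp
qed

end

text \<open>The last three axioms say, in terms of representatives, that \<open>\<epsilon>\<close> and
  \<open>dv\<close> make the horizontal cohomology of the rows \<open>A 0\<close>, \<open>A 1\<close>, \<dots> into an
  exact resolution of the cohomology of \<open>(C, \<delta>)\<close>.\<close>

locale resolved_double_complex = double_complex K A dv dh
  for K :: "('k, 'a) ring_scheme" and A :: "nat \<Rightarrow> nat \<Rightarrow> ('k, 'm, 'b) module_scheme" and dv dh +
  fixes C :: "nat \<Rightarrow> ('k, 'c, 'd) module_scheme" and \<delta> :: "nat \<Rightarrow> 'c \<Rightarrow> 'c" and \<epsilon> :: "nat \<Rightarrow> 'c \<Rightarrow> 'm"
  assumes C_module: "\<And>q. module K (C q)"
    and \<delta>_linear: "\<And>q. linear_map K (C q) (C (Suc q)) (\<delta> q)"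
    and \<epsilon>_linear: "\<And>q. linear_map K (C q) (A 0 q) (\<epsilon> q)"
    and \<epsilon>_\<delta>: "\<And>q c. c \<in> carrier (C q) \<Longrightarrow> \<epsilon> (Suc q) (\<delta> q c) = dh 0 q (\<epsilon> q c)"
    and dv_\<epsilon>: "\<And>q c. c \<in> carrier (C q) \<Longrightarrow> dv 0 q (\<epsilon> q c) = \<zero>\<^bsub>A 1 q\<^esub>"
    and exact_column: "\<And>p q x. x \<in> cocycles (A (Suc p)) (dh (Suc p)) q \<Longrightarrow>
      dv (Suc p) q x \<in> coboundaries (A (Suc (Suc p))) (dh (Suc (Suc p))) q \<Longrightarrow>
      \<exists>z\<in>cocycles (A p) (dh p) q. x \<ominus>\<^bsub>A (Suc p) q\<^esub> dv p q z \<in> coboundaries (A (Suc p)) (dh (Suc p)) q"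
    and exact_start: "\<And>q x. x \<in> cocycles (A 0) (dh 0) q \<Longrightarrow>
      dv 0 q x \<in> coboundaries (A 1) (dh 1) q \<Longrightarrow>
      \<exists>c\<in>cocycles C \<delta> q. x \<ominus>\<^bsub>A 0 q\<^esub> \<epsilon> q c \<in> coboundaries (A 0) (dh 0) q"
    and injective_start: "\<And>q c. c \<in> cocycles C \<delta> q \<Longrightarrow>
      \<epsilon> q c \<in> coboundaries (A 0) (dh 0) q \<Longrightarrow> c \<in> coboundaries C \<delta> q"
begin

text \<open>The leading entry represents a vertical cocycle in horizontal cohomology, which by exactness
  is the vertical coboundary of a class \<open>z\<close> in row \<open>p\<close>. Representatives agree
  up to a horizontal coboundary of some \<open>b\<close>, and the differential of the element with entries
  \<open>z\<close> and \<open>b\<close> has the given leading entry.\<close>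

lemma subtract_leading_entry:
  assumes x: "x \<in> Fil (int (Suc p)) (int (Suc p + q))"
    and Dx: "D (int (Suc p + q)) x \<in> Fil (int (Suc p) + 2) (int (Suc p + q) + 1)"
  shows "\<exists>w\<in>Fil (int p) (int (p + q)). D (int (p + q)) w \<in> Fil (int (Suc p)) (int (Suc p + q)) \<and>
    x \<ominus>\<^bsub>tot A (int (Suc p + q))\<^esub> D (int (p + q)) w \<in> Fil (int (Suc p) + 1) (int (Suc p + q))"
proof -
  define n where "n = int (p + q)"
  have n1: "int (Suc p + q) = n + 1" by (simp add: n_def)
  note L = leading_entry[OF x Dx]
  note x = x[unfolded n1]
  obtain z where z: "z \<in> cocycles (A p) (dh p) q"
    "x (int (Suc p)) \<ominus>\<^bsub>A (Suc p) q\<^esub> dv p q z \<in> coboundaries (A (Suc p)) (dh (Suc p)) q"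
    using exact_column[OF L] by blast
  have zc: "z \<in> carrier (A p q)" "dh p q z = \<zero>\<^bsub>A p (Suc q)\<^esub>" using z(1) by (auto simp: cocycles_def)
  have idx: "nat (n - int p) = q" "nat (n + 1 - int p) = Suc q" "nat (int p + 1) = Suc p"
    "nat (n + 1 - (int p + 1)) = q" "int (Suc p) = int p + 1"
    by (simp_all add: n_def)
  interpret M: module K "A (Suc p) q" by (rule A_module)
  have dvz: "dv p q z \<in> carrier (A (Suc p) q)" by (rule linear_mapD(1)[OF dv_linear zc(1)])
  obtain b where b: "q > 0 \<Longrightarrow> b \<in> carrier (A (Suc p) (q - 1))"
    "x (int p + 1) \<ominus>\<^bsub>A (Suc p) q\<^esub> dv p q z =
      (if q = 0 then \<zero>\<^bsub>A (Suc p) q\<^esub> else sgn_mult (A (Suc p) q) (Suc p) (dh (Suc p) (q - 1) b))"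
  proof (cases q)
    case 0
    then show ?thesis using that z(2) by (auto simp: coboundaries_def idx add.commute)
  next
    case (Suc q')
    then obtain b where b: "b \<in> carrier (A (Suc p) q')" "x (int p + 1) \<ominus>\<^bsub>A (Suc p) q\<^esub> dv p q z = dh (Suc p) q' b"
      using z(2) by (auto simp: coboundaries_def idx add.commute)
    interpret N: module K "A (Suc p) q'" by (rule A_module)
    have dhb: "dh (Suc p) q' b \<in> carrier (A (Suc p) q)"
      using linear_mapD(1)[OF dh_linear b(1)] Suc by simp
    have "dh (Suc p) q' (sgn_mult (A (Suc p) q') (Suc p) b) = sgn_mult (A (Suc p) q) (Suc p) (dh (Suc p) q' b)"
      using linear_map_uminus[OF A_module A_module dh_linear b(1)] Suc by (simp add: sgn_mult_def)
    moreover have "sgn_mult (A (Suc p) q) (Suc p) (sgn_mult (A (Suc p) q) (Suc p) (dh (Suc p) q' b)) = dh (Suc p) q' b"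
      using dhb by (simp add: sgn_mult_def)
    ultimately show ?thesis
      using that[of "sgn_mult (A (Suc p) q') (Suc p) b"] b linear_mapD(1)[OF sgn_mult_linear[OF A_module] b(1)] Suc
      by simp
  qed
  let ?w = "two_rows n (int p) z b"
  have qn: "int p + 1 \<in> {0..n} \<longleftrightarrow> q > 0" "int p = n \<longleftrightarrow> q = 0" "int p \<in> {0..n}" "int p + 1 \<in> {0..n + 1}"
    "q > 0 \<Longrightarrow> nat (n - (int p + 1)) = q - 1" "\<not> int p < 0"
    by (auto simp: n_def)
  have za: "int p \<in> {0..n} \<Longrightarrow> z \<in> carrier (comp n (int p)) \<and>
      dh (nat (int p)) (nat (n - int p)) z = \<zero>\<^bsub>comp (n + 1) (int p)\<^esub>"
    using zc by (simp add: idx)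
  have ba: "int p + 1 \<in> {0..n} \<Longrightarrow> b \<in> carrier (comp n (int p + 1))"
  proof -
    assume "int p + 1 \<in> {0..n}"
    then have "q > 0" by (simp only: qn(1))
    then show ?thesis using b(1) by (simp only: qn(5) idx(3))
  qed
  have w: "?w \<in> Fil (int p) n"
    using two_rows_Fil za ba by blast
  have Dw: "D n ?w \<in> Fil (int p + 1) (n + 1)" by (rule D_two_rows(1)[OF za ba])
  have xc: "x (int p + 1) \<in> carrier (A (Suc p) q)"
    using L(1) unfolding cocycles_def idx(5) by simp
  have "D n ?w (int p + 1) =
      (if int p < 0 then \<zero>\<^bsub>comp (n + 1) (int p + 1)\<^esub> else dv (nat (int p)) (nat (n - int p)) z)
      \<oplus>\<^bsub>comp (n + 1) (int p + 1)\<^esub>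
      (if int p = n then \<zero>\<^bsub>comp (n + 1) (int p + 1)\<^esub>
       else sgn_mult (comp (n + 1) (int p + 1)) (nat (int p + 1)) (dh (nat (int p + 1)) (nat (n - (int p + 1))) b))"
    using D_two_rows(2)[of "int p" n z b] za ba qn(4) by blast
  also have "\<dots> = dv p q z \<oplus>\<^bsub>A (Suc p) q\<^esub> (x (int p + 1) \<ominus>\<^bsub>A (Suc p) q\<^esub> dv p q z)"
    unfolding b(2) using qn(2,5) by (auto simp: idx)
  also have "\<dots> = x (int p + 1)"
    using xc dvz M.M.a_comm[of "dv p q z" "x (int p + 1) \<ominus>\<^bsub>A (Suc p) q\<^esub> dv p q z"]
    by (simp add: a_minus_def M.M.a_assoc M.M.l_neg)
  finally have Dwp: "D n ?w (int p + 1) = x (int p + 1)" .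
  have xF: "x \<in> Fil (int p + 1) (n + 1)" using x unfolding idx(5) .
  have d: "x \<ominus>\<^bsub>tot A (n + 1)\<^esub> D n ?w \<in> Fil (int p + 1) (n + 1)"
    by (rule submoduleD(5)[OF tot_module Fil_submodule xF Dw])
  have "(x \<ominus>\<^bsub>tot A (n + 1)\<^esub> D n ?w) (int p + 1) = \<zero>\<^bsub>A (Suc p) q\<^esub>"
    unfolding tot_minus[OF Fil_carrier[OF xF] Fil_carrier[OF Dw] qn(4)] Dwp
    using xc by (simp add: idx a_minus_def M.M.r_neg)
  then have "x \<ominus>\<^bsub>tot A (n + 1)\<^esub> D n ?w \<in> Fil (int p + 2) (n + 1)"
    using d unfolding Fil_iff
  proof (safe)
    fix i assume i: "i \<in> {0..n + 1}" "i < int p + 2"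
      and *: "(x \<ominus>\<^bsub>tot A (n + 1)\<^esub> D n ?w) (int p + 1) = \<zero>\<^bsub>A (Suc p) q\<^esub>"
      and **: "\<forall>i\<in>{0..n + 1}. i < int p + 1 \<longrightarrow> (x \<ominus>\<^bsub>tot A (n + 1)\<^esub> D n ?w) i = \<zero>\<^bsub>comp (n + 1) i\<^esub>"
    show "(x \<ominus>\<^bsub>tot A (n + 1)\<^esub> D n ?w) i = \<zero>\<^bsub>comp (n + 1) i\<^esub>"
    proof (cases "i = int p + 1")
      case True
      then show ?thesis using * by (simp only: idx)
    qed (use i ** in auto)
  qed
  then show ?thesis
    unfolding n1 unfolding n_def[symmetric] using w Dw by (intro bexI[of _ ?w]) (simp_all add: idx(5) add.commute)
qed

text \<open>This kills every page from the second one on outside of row zero. In rows outside of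
  \<open>{0..n}\<close> the filtration does not change between \<open>p\<close> and \<open>p + 1\<close>; in the
  other ones the leading entry of a cycle can be subtracted.\<close>

lemma cycles_are_boundaries:
  assumes "p \<noteq> 0" "r \<ge> 2"
  shows "Zr r p (n - p) \<subseteq> Br r p (n - p)"
proof
  fix x assume "x \<in> Zr r p (n - p)"
  then have x: "x \<in> Fil p n" "D n x \<in> Fil (p + r) (n + 1)" by (simp_all add: Zr_iff)
  interpret T: module K "tot A n" by (rule tot_module)
  have lin: "linear_map K (tot A (n - 1)) (tot A n) (D (n - 1))" using D_linear[of "n - 1"] by simp
  have xc: "x \<in> carrier (tot A n)" by (rule Fil_carrier[OF x(1)])
  have zero: "\<zero>\<^bsub>tot A (n - 1)\<^esub> \<in> Fil s (n - 1)" "D (n - 1) \<zero>\<^bsub>tot A (n - 1)\<^esub> = \<zero>\<^bsub>tot A n\<^esub>"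
    "\<zero>\<^bsub>tot A n\<^esub> \<in> Fil s n" for s
    using submoduleD(2)[OF tot_module Fil_submodule] linear_map_zero[OF tot_module tot_module lin] by auto
  show "x \<in> Br r p (n - p)"
  proof (cases "p < 0 \<or> p > n")
    case True
    have "x \<in> Fil (p + 1) n" using x(1) True unfolding Fil_iff by auto
    then show ?thesis
      unfolding Br_iff using x(2) zero xc
      by (intro bexI[of _ x] conjI bexI[of _ "\<zero>\<^bsub>tot A (n - 1)\<^esub>"]) simp_all
  next
    case False
    define p' q' where "p' = nat (p - 1)" and "q' = nat (n - p)"
    have e: "p = int (Suc p')" "n = int (Suc p' + q')" "n - 1 = int (p' + q')" "p - 1 = int p'"
      using False assms(1) by (auto simp: p'_def q'_def)
    have "D n x \<in> Fil (p + 2) (n + 1)" using Fil_antimono[OF _ x(2)] assms(2) by simp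
    from subtract_leading_entry[OF x(1)[unfolded e(1,2)] this[unfolded e(1,2)], folded e]
    obtain w where w: "w \<in> Fil (p - 1) (n - 1)" "D (n - 1) w \<in> Fil p n"
      "x \<ominus>\<^bsub>tot A n\<^esub> D (n - 1) w \<in> Fil (p + 1) n" by blast
    have wc: "w \<in> carrier (tot A (n - 1))" and Dwc: "D (n - 1) w \<in> carrier (tot A n)"
      using w Fil_carrier by blast+
    have DD: "D n (D (n - 1) w) = \<zero>\<^bsub>tot A (n + 1)\<^esub>"
      using D_D[OF wc] by (simp add: add.commute)
    interpret T': module K "tot A (n + 1)" by (rule tot_module)
    have "D n (x \<ominus>\<^bsub>tot A n\<^esub> D (n - 1) w) = D n x"
      using linear_map_minus[OF tot_module tot_module D_linear xc Dwc] DD Fil_carrier[OF x(2)]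
      by (simp add: a_minus_def)
    moreover have "x = (x \<ominus>\<^bsub>tot A n\<^esub> D (n - 1) w) \<oplus>\<^bsub>tot A n\<^esub> D (n - 1) w"
      using xc Dwc by (simp add: a_minus_def T.M.a_assoc T.M.l_neg)
    moreover have "w \<in> Fil (p - r + 1) (n - 1)" using Fil_antimono[OF _ w(1)] assms(2) by simp
    ultimately show ?thesis
      unfolding Br_iff using w(2,3) x(2) by metis
  qed
qed

definition edge :: "nat \<Rightarrow> 'c \<Rightarrow> int \<Rightarrow> 'm"
  where "edge n c = two_rows (int n) 0 (\<epsilon> n c) \<zero>\<^bsub>comp (int n) 1\<^esub>"

lemma edge_linear: "linear_map K (C n) (tot A (int n)) (edge n)"
proof -
  note z = module.axioms(2)[OF A_module, THEN abelian_groupE(2)]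
    and zz = module.axioms(2)[OF A_module, THEN abelian_groupE(5), OF z]
  note \<epsilon> = linear_mapD[OF \<epsilon>_linear]
  have ap: "edge n c i = (if i = 0 then \<epsilon> n c else \<zero>\<^bsub>comp (int n) i\<^esub>)" if "i \<in> {0..int n}" for i c
    using that by (auto simp: edge_def two_rows_def)
  have ex: "edge n c \<in> extensional {0..int n}" for c by (simp add: edge_def two_rows_def)
  show ?thesis
  proof (rule linear_mapI)
    fix c assume "c \<in> carrier (C n)"
    then show "edge n c \<in> carrier (tot A (int n))"
      using \<epsilon>(1) z by (auto simp: tot_simps(1) ex ap)
  next
    fix c c' assume "c \<in> carrier (C n)" "c' \<in> carrier (C n)"
    then show "edge n (c \<oplus>\<^bsub>C n\<^esub> c') = edge n c \<oplus>\<^bsub>tot A (int n)\<^esub> edge n c'"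
      by (intro extensionalityI[OF ex])
        (auto simp: tot_simps(3) ap \<epsilon>(2) zz, auto simp: tot_def)
  next
    fix k c assume "k \<in> carrier K" "c \<in> carrier (C n)"
    then show "edge n (k \<odot>\<^bsub>C n\<^esub> c) = k \<odot>\<^bsub>tot A (int n)\<^esub> edge n c"
      by (intro extensionalityI[OF ex])
        (auto simp: tot_simps(4) ap \<epsilon>(3) module.smult_r_null[OF A_module], auto simp: tot_def)
  qed
qed

lemma D_edge:
  assumes c: "c \<in> carrier (C n)"
  shows "D (int n) (edge n c) = edge (Suc n) (\<delta> n c)"
proof -
  note z = module.axioms(2)[OF A_module, THEN abelian_groupE(2)]
    and zz = module.axioms(2)[OF A_module, THEN abelian_groupE(5), OF z]
  note \<epsilon> = linear_mapD[OF \<epsilon>_linear]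
  have \<epsilon>c: "\<epsilon> n c \<in> carrier (A 0 n)" by (rule \<epsilon>(1)[OF c])
  interpret M: module K "A 0 (Suc n)" by (rule A_module)
  have ap: "edge m c i = (if i = 0 then \<epsilon> m c else \<zero>\<^bsub>comp (int m) i\<^esub>)" if "i \<in> {0..int m}" for m i c
    using that by (auto simp: edge_def two_rows_def)
  have "D (int n) (edge n c) i = edge (Suc n) (\<delta> n c) i" if i: "i \<in> {0..int n + 1}" for i
  proof -
    have v: "vpart (int n) i (edge n c) = \<zero>\<^bsub>comp (int n + 1) i\<^esub>"
    proof (cases "i = 0")
      case False
      then have "i - 1 \<in> {0..int n}" "Suc (nat (i - 1)) = nat i" "nat (int n + 1 - i) = nat (int n - (i - 1))"
        using i by auto
      then show ?thesis
        using False ap[of "i - 1" n c] dv_\<epsilon>[OF c] zero_maps(1)[of "nat (i - 1)" "nat (int n - (i - 1))"]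
        by (auto simp: vpart_def)
    qed (simp add: vpart_def)
    have h: "hpart (int n) i (edge n c) = (if i = 0 then dh 0 n (\<epsilon> n c) else \<zero>\<^bsub>comp (int n + 1) i\<^esub>)"
    proof (cases "i = int n + 1")
      case False
      then have "i \<in> {0..int n}" "Suc (nat (int n - i)) = nat (int n + 1 - i)" using i by auto
      then show ?thesis
        using False ap[of i n c] zero_maps(2)[of "nat i" "nat (int n - i)"]
        by (auto simp: hpart_def sgn_mult_def[of _ 0])
    qed (simp add: hpart_def)
    have "nat (int n + 1) = Suc n" by simp
    then show ?thesis
      using i \<epsilon>_\<delta>[OF c] ap[of i "Suc n" "\<delta> n c"] zz linear_mapD(1)[OF dh_linear \<epsilon>c]
      by (auto simp: D_apply v h add.commute)
  qed
  moreover have "edge (Suc n) (\<delta> n c) \<in> extensional {0..int n + 1}"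
    by (simp add: edge_def two_rows_def add.commute)
  ultimately show ?thesis
    by (intro extensionalityI[of _ "{0..int n + 1}"]) (simp_all add: tot_d_def)
qed

lemma edge_at_0: "edge n c 0 = \<epsilon> n c"
  by (simp add: edge_def two_rows_def)

lemma edge_zero: "edge n \<zero>\<^bsub>C n\<^esub> = \<zero>\<^bsub>tot A (int n)\<^esub>"
  by (rule linear_map_zero[OF C_module tot_module edge_linear])

lemma edge_cocycle:
  assumes "c \<in> cocycles C \<delta> n"
  shows "edge n c \<in> Zr r 0 (int n - 0)"
proof -
  have c: "c \<in> carrier (C n)" "\<delta> n c = \<zero>\<^bsub>C (Suc n)\<^esub>" using assms by (auto simp: cocycles_def)
  have "D (int n) (edge n c) = \<zero>\<^bsub>tot A (int n + 1)\<^esub>"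
    using D_edge[OF c(1)] edge_zero[of "Suc n"] by (simp add: c(2) add.commute)
  then show ?thesis
    unfolding Zr_iff using linear_mapD(1)[OF edge_linear c(1)] submoduleD(2)[OF tot_module Fil_submodule]
    by (simp add: Fil_nonpos)
qed

text \<open>Elements of filtration \<open>1\<close> do not contribute to row zero, so that \<open>\<epsilon> c\<close> is
  a horizontal coboundary if \<open>c\<close> dies in the page.\<close>

lemma edge_boundary_iff:
  assumes "r \<ge> 2" and c: "c \<in> cocycles C \<delta> n"
  shows "edge n c \<in> Br r 0 (int n - 0) \<longleftrightarrow> c \<in> coboundaries C \<delta> n"
proof
  have cc: "c \<in> carrier (C n)" using c by (simp add: cocycles_def)
  assume "edge n c \<in> Br r 0 (int n - 0)"
  then obtain y w where y: "y \<in> Fil 1 (int n)" and w: "w \<in> Fil (0 - r + 1) (int n - 1)"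
    and Dw: "D (int n - 1) w \<in> Fil 0 (int n)" and eq: "edge n c = y \<oplus>\<^bsub>tot A (int n)\<^esub> D (int n - 1) w"
    unfolding Br_iff by auto
  interpret M: module K "A 0 n" by (rule A_module)
  have y0: "y 0 = \<zero>\<^bsub>A 0 n\<^esub>" using y by (auto simp: Fil_iff)
  have Dw0: "D (int n - 1) w 0 \<in> carrier (A 0 n)" using Fil_carrier[OF Dw] by (auto simp: tot_simps dest: bspec[of _ _ 0])
  have "\<epsilon> n c = D (int n - 1) w 0"
    using edge_at_0[of n c] y0 Dw0 unfolding eq by (simp add: tot_simps(3))
  also have "\<dots> \<in> coboundaries (A 0) (dh 0) n"
  proof (cases n)
    case 0
    have "vpart (- 1) 0 w = \<zero>\<^bsub>A 0 0\<^esub>" "hpart (- 1) 0 w = \<zero>\<^bsub>A 0 0\<^esub>"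
      by (simp_all add: vpart_def hpart_def)
    then show ?thesis using D_apply[of 0 "- 1" w] M.M.l_zero[OF M.M.zero_closed] 0 by (simp add: coboundaries_def)
  next
    case (Suc m)
    have wc: "w 0 \<in> carrier (A 0 m)" using Fil_carrier[OF w] by (auto simp: tot_simps Suc dest: bspec[of _ _ 0])
    have "hpart (int m) 0 w = dh 0 m (w 0)" by (simp add: hpart_def sgn_mult_def)
    moreover have "dh 0 m (w 0) \<in> carrier (A 0 n)" using linear_mapD(1)[OF dh_linear wc] Suc by simp
    moreover have "nat (int m + 1) = n" using Suc by simp
    ultimately have "D (int n - 1) w 0 = dh 0 m (w 0)"
      using D_apply[of 0 "int m" w] M.M.l_zero[of "dh 0 m (w 0)"] Suc by (simp add: vpart_def)
    then show ?thesis using wc by (auto simp: coboundaries_def Suc)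
  qed
  finally show "c \<in> coboundaries C \<delta> n" by (rule injective_start[OF c])
next
  assume "c \<in> coboundaries C \<delta> n"
  show "edge n c \<in> Br r 0 (int n - 0)"
  proof (cases n)
    case 0
    then have "edge n c = \<zero>\<^bsub>tot A (int n)\<^esub>"
      using \<open>c \<in> coboundaries C \<delta> n\<close> edge_zero[of 0] by (simp add: coboundaries_def)
    then show ?thesis using submoduleD(2)[OF tot_module Br_submodule[where r=r and p=0 and n="int n"]] by simp
  next
    case (Suc m)
    then obtain c' where c': "c' \<in> carrier (C m)" "c = \<delta> m c'"
      using \<open>c \<in> coboundaries C \<delta> n\<close> by (auto simp: coboundaries_def)
    have e: "edge m c' \<in> carrier (tot A (int m))" by (rule linear_mapD(1)[OF edge_linear c'(1)])
    have "D (int m) (edge m c') = edge n c" using D_edge[OF c'(1)] c'(2) Suc by simp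
    moreover have "edge n c \<in> carrier (tot A (int n))"
      using c linear_mapD(1)[OF edge_linear] by (auto simp: cocycles_def)
    ultimately have "D (int m) (edge m c') \<in> Br r (- r + r) (int m + 1 - (- r + r))"
      using e assms(1) Suc by (intro D_cycles_in_Br) (simp_all add: Fil_nonpos add.commute)
    then show ?thesis using \<open>D (int m) (edge m c') = edge n c\<close> Suc by (simp add: add.commute)
  qed
qed

text \<open>By exactness at the start, the leading entry of a cycle is \<open>\<epsilon> c\<close> up to a horizontal
  coboundary, whose preimage \<open>w\<close> is put into row zero of the total complex.\<close>

lemma edge_onto:
  assumes "r \<ge> 2" and x: "x \<in> Zr r 0 (int n - 0)"
  shows "\<exists>c\<in>cocycles C \<delta> n. x \<ominus>\<^bsub>tot A (int n)\<^esub> edge n c \<in> Br r 0 (int n - 0)"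
proof -
  have x0: "x \<in> Fil 0 (int n)" and Dx: "D (int n) x \<in> Fil r (int n + 1)"
    using x[unfolded Zr_iff] by auto
  have Dx2: "D (int n) x \<in> Fil 2 (int n + 1)" by (rule Fil_antimono[OF assms(1) Dx])
  note L = leading_entry[of x 0 n, simplified, OF x0 Dx2]
  obtain c where c: "c \<in> cocycles C \<delta> n" "x 0 \<ominus>\<^bsub>A 0 n\<^esub> \<epsilon> n c \<in> coboundaries (A 0) (dh 0) n"
    using exact_start[OF L(1)] L(2) by auto
  have ec: "edge n c \<in> Zr r 0 (int n - 0)" by (rule edge_cocycle[OF c(1)])
  define y where "y = x \<ominus>\<^bsub>tot A (int n)\<^esub> edge n c"
  have "y \<in> Zr r 0 (int n - 0)"
    unfolding y_def by (rule submoduleD(5)[OF tot_module Zr_submodule x ec])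
  then have y: "y \<in> Fil 0 (int n)" "D (int n) y \<in> Fil r (int n + 1)" using Zr_iff[of y r 0 "int n"] by auto
  have yc: "y \<in> carrier (tot A (int n))" by (rule Fil_carrier[OF y(1)])
  have "edge n c \<in> carrier (tot A (int n))" using ec[unfolded Zr_iff] by (simp add: Fil_nonpos)
  then have y0: "y 0 = x 0 \<ominus>\<^bsub>A 0 n\<^esub> \<epsilon> n c"
    unfolding y_def using tot_minus[OF Fil_carrier[OF x0], of "edge n c" 0] by (simp add: edge_at_0)
  interpret T: module K "tot A (int n)" by (rule tot_module)
  interpret T': module K "tot A (int n + 1)" by (rule tot_module)
  interpret M: module K "A 0 n" by (rule A_module)
  have "\<exists>w\<in>carrier (tot A (int n - 1)). D (int n - 1) w 0 = y 0"
  proof (cases n)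
    case 0
    have "vpart (- 1) 0 w = \<zero>\<^bsub>A 0 0\<^esub>" "hpart (- 1) 0 w = \<zero>\<^bsub>A 0 0\<^esub>" for w
      by (simp_all add: vpart_def hpart_def)
    then have "D (- 1) w 0 = y 0" for w
      using D_apply[of 0 "- 1" w] M.M.l_zero[OF M.M.zero_closed] 0 c(2) y0 by (simp add: coboundaries_def)
    moreover have "\<zero>\<^bsub>tot A (- 1)\<^esub> \<in> carrier (tot A (- 1))"
      using submoduleD(2)[OF tot_module Fil_submodule, of "- 1" 0] by (rule Fil_carrier)
    ultimately show ?thesis using 0 by auto
  next
    case (Suc m)
    then obtain b where b: "b \<in> carrier (A 0 m)" "y 0 = dh 0 m b"
      using c(2) y0 by (auto simp: coboundaries_def)
    (* Row -1 is empty, so that its entry is irrelevant. *)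
    let ?w = "two_rows (int m) (- 1) undefined b"
    have w: "?w \<in> Fil (- 1) (int m)" using b by (intro two_rows_Fil) auto
    have "D (int m) ?w (- 1 + 1) = \<zero>\<^bsub>comp (int m + 1) (- 1 + 1)\<^esub> \<oplus>\<^bsub>comp (int m + 1) (- 1 + 1)\<^esub>
      sgn_mult (comp (int m + 1) (- 1 + 1)) (nat (- 1 + 1)) (dh (nat (- 1 + 1)) (nat (int m - (- 1 + 1))) b)"
      using D_two_rows(2)[of "- 1" "int m" undefined b] b by simp
    moreover have "nat (int m + 1) = n" "dh 0 m b \<in> carrier (A 0 n)"
      using Suc linear_mapD(1)[OF dh_linear b(1)] by simp_all
    ultimately have "D (int m) ?w 0 = y 0" using b(2) by (simp add: sgn_mult_def)
    then show ?thesis using Fil_carrier[OF w] Suc by auto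
  qed
  then obtain w where w: "w \<in> carrier (tot A (int n - 1))" "D (int n - 1) w 0 = y 0" by blast
  have lin: "linear_map K (tot A (int n - 1)) (tot A (int n)) (D (int n - 1))" using D_linear[of "int n - 1"] by simp
  have Dwc: "D (int n - 1) w \<in> carrier (tot A (int n))" by (rule linear_mapD(1)[OF lin w(1)])
  define v where "v = y \<ominus>\<^bsub>tot A (int n)\<^esub> D (int n - 1) w"
  have vc: "v \<in> carrier (tot A (int n))" using yc Dwc by (simp add: v_def)
  have "y 0 \<in> carrier (A 0 n)" using yc by (auto simp: tot_simps dest: bspec[of _ _ 0])
  then have "v 0 = \<zero>\<^bsub>A 0 n\<^esub>"
    using tot_minus[OF yc Dwc, of 0] w(2) by (simp add: v_def a_minus_def M.M.r_neg)
  then have "v \<in> Fil (0 + 1) (int n)" using vc by (auto simp: Fil_iff dest!: order_antisym)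
  moreover have "D (int n) v = D (int n) y"
  proof -
    have "D (int n) (D (int n - 1) w) = \<zero>\<^bsub>tot A (int n + 1)\<^esub>"
      using D_D[OF w(1)] by (simp add: add.commute)
    then show ?thesis
      using linear_map_minus[OF tot_module tot_module D_linear yc Dwc] Fil_carrier[OF y(2)]
      by (simp add: v_def a_minus_def)
  qed
  moreover have "y = v \<oplus>\<^bsub>tot A (int n)\<^esub> D (int n - 1) w"
    using yc Dwc by (simp add: v_def a_minus_def T.M.a_assoc T.M.l_neg)
  moreover have "w \<in> Fil (0 - r + 1) (int n - 1)" "D (int n - 1) w \<in> Fil 0 (int n)"
    using w(1) Dwc assms(1) by (simp_all add: Fil_nonpos)
  ultimately have "y \<in> Br r 0 (int n - 0)"
    unfolding Br_iff using y(2) by (metis add_0)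
  then show ?thesis using c(1) unfolding y_def by blast
qed

lemma page_zero:
  assumes "p \<noteq> 0" "r \<ge> 2"
  shows "carrier (ss_page A dv dh r p (n - p)) = {\<zero>\<^bsub>ss_page A dv dh r p (n - p)\<^esub>}"
  using subquotient_zero_carrier[OF tot_module Br_submodule Zr_submodule cycles_are_boundaries[OF assms]]
  by (simp add: ss_page_def)

lemma edge_iso:
  assumes "r \<ge> 2"
  shows "lin_iso K (cohomology C \<delta> n) (ss_page A dv dh r 0 (int n))"
proof -
  let ?B = "Br r 0 (int n - 0)" and ?T = "tot A (int n)"
  have page: "ss_page A dv dh r 0 (int n) = subquotient ?T (Zr r 0 (int n - 0)) ?B"
    by (simp add: ss_page_def)
  note el = linear_mapD[OF edge_linear]
  have cyc: "c \<in> cocycles C \<delta> n \<Longrightarrow> c \<in> carrier (C n)" for c by (simp add: cocycles_def)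
  show ?thesis
    unfolding cohomology_def page
  proof (rule lin_iso_subquotient[where f="\<lambda>c. ?B +>\<^bsub>?T\<^esub> edge n c", OF C_module
        coboundaries_submodule[where C=C, OF C_module \<delta>_linear] cocycles_submodule[where C=C, OF C_module \<delta>_linear]])
    fix x y assume xy: "x \<in> cocycles C \<delta> n" "y \<in> cocycles C \<delta> n"
    note xyc = xy[THEN cyc]
    show "?B +>\<^bsub>?T\<^esub> edge n (x \<oplus>\<^bsub>C n\<^esub> y) =
      (?B +>\<^bsub>?T\<^esub> edge n x) \<oplus>\<^bsub>subquotient ?T (Zr r 0 (int n - 0)) ?B\<^esub> (?B +>\<^bsub>?T\<^esub> edge n y)"
      using xyc by (simp only: el(2) subquotient_add[OF tot_module Br_submodule el(1) el(1)])
    have d: "x \<ominus>\<^bsub>C n\<^esub> y \<in> cocycles C \<delta> n"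
      by (rule submoduleD(5)[OF C_module cocycles_submodule[where C=C, OF C_module \<delta>_linear] xy])
    have "?B +>\<^bsub>?T\<^esub> edge n x = ?B +>\<^bsub>?T\<^esub> edge n y \<longleftrightarrow> edge n (x \<ominus>\<^bsub>C n\<^esub> y) \<in> ?B"
      unfolding coset_eq_iff[OF tot_module Br_submodule el(1)[OF xyc(1)] el(1)[OF xyc(2)]]
        linear_map_minus[OF C_module tot_module edge_linear xyc] ..
    then show "?B +>\<^bsub>?T\<^esub> edge n x = ?B +>\<^bsub>?T\<^esub> edge n y \<longleftrightarrow> x \<ominus>\<^bsub>C n\<^esub> y \<in> coboundaries C \<delta> n"
      unfolding edge_boundary_iff[OF assms d] .
  next
    fix k x assume "k \<in> carrier K" "x \<in> cocycles C \<delta> n"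
    then show "?B +>\<^bsub>?T\<^esub> edge n (k \<odot>\<^bsub>C n\<^esub> x) =
      k \<odot>\<^bsub>subquotient ?T (Zr r 0 (int n - 0)) ?B\<^esub> (?B +>\<^bsub>?T\<^esub> edge n x)"
      by (simp only: cyc el(3) subquotient_smult[OF tot_module Br_submodule el(1)])
  next
    show "(\<lambda>c. ?B +>\<^bsub>?T\<^esub> edge n c) ` cocycles C \<delta> n = carrier (subquotient ?T (Zr r 0 (int n - 0)) ?B)"
      unfolding subquotient_simps
    proof (intro equalityI subsetI)
      fix X assume "X \<in> {?B +>\<^bsub>?T\<^esub> z |z. z \<in> Zr r 0 (int n - 0)}"
      then obtain z where z: "z \<in> Zr r 0 (int n - 0)" "X = ?B +>\<^bsub>?T\<^esub> z" by blast
      then obtain c where c: "c \<in> cocycles C \<delta> n" "z \<ominus>\<^bsub>?T\<^esub> edge n c \<in> ?B"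
        using edge_onto[OF assms] by blast
      have "X = ?B +>\<^bsub>?T\<^esub> edge n c"
        unfolding z(2) using coset_eq_iff[OF tot_module Br_submodule _ el(1)[OF cyc[OF c(1)]]] c(2)
          submoduleD(1)[OF tot_module Zr_submodule z(1)] by blast
      then show "X \<in> (\<lambda>c. ?B +>\<^bsub>?T\<^esub> edge n c) ` cocycles C \<delta> n" using c(1) by blast
    qed (use edge_cocycle in blast)
  qed
qed

text \<open>A differential of page \<open>r\<close> moves the row by \<open>r\<close>, and only row zero is
  nonzero, so that its source or its target vanishes.\<close>

lemma collapse: "collapses_at (ss_page A dv dh) (ss_diff A dv dh) 2"
  unfolding collapses_at_def
proof (intro allI impI ballI)
  fix r p q :: int and Y assume r: "2 \<le> r" and "Y \<in> carrier (ss_page A dv dh r p q)"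
  define n where "n = p + q"
  have q: "q = n - p" "q - r + 1 = n + 1 - (p + r)" "p + q = n" by (simp_all add: n_def)
  obtain x where x: "x \<in> Zr r p (n - p)" "Y = Br r p (n - p) +>\<^bsub>tot A n\<^esub> x"
    using \<open>Y \<in> _\<close> unfolding ss_page_def subquotient_simps q(1) by auto
  let ?B = "Br r (p + r) (n + 1 - (p + r))"
  have xF: "x \<in> Fil p n" "D n x \<in> Fil (p + r) (n + 1)" using x(1) by (simp_all add: Zr_iff)
  have xc: "x \<in> carrier (tot A n)" "D n x \<in> carrier (tot A (n + 1))" using xF Fil_carrier by blast+
  have DB: "D n b \<in> ?B" if b: "b \<in> Br r p (n - p)" for b
  proof -
    from b obtain y w where y: "y \<in> Fil (p + 1) n" "D n y \<in> Fil (p + r) (n + 1)"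
      and w: "w \<in> Fil (p - r + 1) (n - 1)" "D (n - 1) w \<in> Fil p n" and eq: "b = y \<oplus>\<^bsub>tot A n\<^esub> D (n - 1) w"
      unfolding Br_iff by blast
    interpret T': module K "tot A (n + 1)" by (rule tot_module)
    have "D n (D (n - 1) w) = \<zero>\<^bsub>tot A (n + 1)\<^esub>"
      using D_D[OF Fil_carrier[OF w(1)]] by (simp add: add.commute)
    then have "D n b = D n y"
      using linear_mapD(2)[OF D_linear Fil_carrier[OF y(1)] Fil_carrier[OF w(2)]] Fil_carrier[OF y(2)]
      by (simp add: eq)
    then show ?thesis using D_cycles_in_Br[OF y] by simp
  qed
  have "D n x \<in> ?B"
  proof (cases "p + r = 0")
    case True
    then have "p \<noteq> 0" using r by auto
    then show ?thesis using DB cycles_are_boundaries[OF _ r] x(1) by blast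
  next
    case False
    have "D (n + 1) (D n x) \<in> Fil (p + r + r) (n + 1 + 1)"
      using D_D[OF xc(1)] submoduleD(2)[OF tot_module Fil_submodule, of "n + 2"] by (simp add: add.commute)
    then show ?thesis using cycles_are_boundaries[OF False r, of "n + 1"] xF(2) unfolding Zr_iff[symmetric]
      by (meson Zr_iff subsetD)
  qed
  then have "?B +>\<^bsub>tot A (n + 1)\<^esub> D n x = ?B" by (rule coset_zero[OF tot_module Br_submodule])
  moreover have "(\<Union>v\<in>Br r p (n - p) +>\<^bsub>tot A n\<^esub> x. ?B +>\<^bsub>tot A (n + 1)\<^esub> D n v) = ?B +>\<^bsub>tot A (n + 1)\<^esub> D n x"
    using DB linear_mapD(2)[OF D_linear submoduleD(1)[OF tot_module Br_submodule] xc(1)]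
    by (intro coset_UN[where f="D n", OF tot_module tot_module Br_submodule Br_submodule xc]) blast
  ultimately show "ss_diff A dv dh r p q Y = \<zero>\<^bsub>ss_page A dv dh r (p + r) (q - r + 1)\<^esub>"
    unfolding ss_diff_def ss_page_def subquotient_simps q(2) q(3) x(2) by simp
qed

text \<open>Only row zero contributes to the limit, so the filtration of the cohomology drops from
  everything to zero in one step.\<close>

lemma convergence: "converges_to K (ss_page A dv dh) (cohomology C \<delta>)"
  unfolding converges_to_def
proof
  fix n
  let ?H = "cohomology C \<delta> n"
  define F where "F p = (if p = 0 then carrier ?H else {\<zero>\<^bsub>?H\<^esub>})" for p :: nat
  have H: "module K ?H" by (rule cohomology_module[where C=C, OF C_module \<delta>_linear])
  interpret H: module K ?H by (rule H)
  have F: "submodule (F p) K ?H" for p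
    using submodule_zero[OF H] H.carrier_is_submodule by (simp add: F_def)
  have "lin_iso K (ss_page A dv dh r (int p) (int n - int p)) (subquotient ?H (F p) (F (Suc p)))"
    if r: "r \<ge> int n + 2" for p r
  proof (cases "p = 0")
    case True
    have r2: "r \<ge> 2" using r by simp
    have "lin_iso K (subquotient ?H (carrier ?H) {\<zero>\<^bsub>?H\<^esub>}) ?H"
      by (rule lin_iso_subquotient[where f="\<lambda>x. x", OF H submodule_zero[OF H] H.carrier_is_submodule])
        (auto simp: H.M.minus_eq_zero_iff)
    then have "lin_iso K ?H (subquotient ?H (carrier ?H) {\<zero>\<^bsub>?H\<^esub>})"
      by (rule lin_iso_sym[OF subquotient_module[OF H submodule_zero[OF H] H.carrier_is_submodule]])
    moreover have "lin_iso K (ss_page A dv dh r 0 (int n)) ?H"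
      by (rule lin_iso_sym[OF H edge_iso[OF r2]])
    ultimately show ?thesis using True by (auto simp: F_def intro: lin_iso_trans)
  next
    case False
    show ?thesis
    proof (rule lin_iso_zero_spaces)
      show "carrier (ss_page A dv dh r (int p) (int n - int p)) = {\<zero>\<^bsub>ss_page A dv dh r (int p) (int n - int p)\<^esub>}"
        using False r by (intro page_zero) auto
      show "carrier (subquotient ?H (F p) (F (Suc p))) = {\<zero>\<^bsub>subquotient ?H (F p) (F (Suc p))\<^esub>}"
        using False by (intro subquotient_zero_carrier[OF H F F]) (simp add: F_def)
    qed (intro page_module subquotient_module[OF H F F])+
  qed
  then show "\<exists>F. F 0 = carrier ?H \<and> F (Suc n) = {\<zero>\<^bsub>?H\<^esub>} \<and>
      (\<forall>p. submodule (F p) K ?H \<and> F (Suc p) \<subseteq> F p) \<and>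
      (\<forall>p\<le>n. \<forall>r\<ge>int n + 2. lin_iso K (ss_page A dv dh r (int p) (int n - int p))
        (subquotient ?H (F p) (F (Suc p))))"
    by (intro exI[of _ F] conjI allI impI F) (simp_all add: F_def)
qed

end

section \<open>Invariants of complexes of group representations\<close>

lemma (in finite_group_char_zero) average_minus:
  assumes "group_module K G M" "v \<in> carrier M" "w \<in> carrier M"
  shows "average K G M (v \<ominus>\<^bsub>M\<^esub> w) = average K G M v \<ominus>\<^bsub>M\<^esub> average K G M w"
proof -
  note M = group_moduleD[OF assms(1)]
  interpret module K M by (rule M(1))
  have c: "average K G M u \<in> carrier M" if "u \<in> carrier M" for u
    using average_fixed[OF assms(1) that] by simp
  have "average K G M v = average K G M ((v \<ominus>\<^bsub>M\<^esub> w) \<oplus>\<^bsub>M\<^esub> w)"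
    using assms(2,3) by (simp add: a_minus_def M.a_assoc M.l_neg)
  also have "\<dots> = average K G M (v \<ominus>\<^bsub>M\<^esub> w) \<oplus>\<^bsub>M\<^esub> average K G M w"
    using assms by (intro average_add) auto
  finally show ?thesis
    using c[of "v \<ominus>\<^bsub>M\<^esub> w"] c[OF assms(3)] assms(2,3) by (simp add: a_minus_def M.a_assoc M.r_neg)
qed

lemma group_module_submodule:
  assumes "group_module K G M" "submodule B K M"
    and "\<And>g v. g \<in> carrier G \<Longrightarrow> v \<in> B \<Longrightarrow> opr M g v \<in> B"
  shows "group_module K G (M\<lparr>carrier := B\<rparr>)"
proof -
  note M = group_moduleD[OF assms(1)] and B = submoduleD[OF group_moduleD(1)[OF assms(1)] assms(2)]
  show ?thesis
    unfolding group_module_def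
    using submodule_module[OF M(1) assms(2)] assms(3) M(3,4) B(1) linear_mapD(2,3)[OF M(2)]
    by (auto simp: linear_map_def)
qed

lemma cohomology_simps:
  "carrier (cohomology C d n) = {coboundaries C d n +>\<^bsub>C n\<^esub> z | z. z \<in> cocycles C d n}"
  "\<zero>\<^bsub>cohomology C d n\<^esub> = coboundaries C d n"
  "carrier (cohomology_ops C' d' n) = carrier (cohomology C' d' n)"
  "\<zero>\<^bsub>cohomology_ops C' d' n\<^esub> = \<zero>\<^bsub>cohomology C' d' n\<^esub>"
  "add (cohomology_ops C' d' n) = add (cohomology C' d' n)"
  "smult (cohomology_ops C' d' n) = smult (cohomology C' d' n)"
  by (simp_all add: cohomology_def subquotient_simps cohomology_ops_def)

lemma cohomology_map_coset:
  assumes C: "\<And>n. module K (C n)" "\<And>n. linear_map K (C n) (C (Suc n)) (d n)"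
    and C': "\<And>n. module K (C' n)" "\<And>n. linear_map K (C' n) (C' (Suc n)) (d' n)"
    and f: "linear_map K (C n) (C' n) f"
    and fB: "\<And>b. b \<in> coboundaries C d n \<Longrightarrow> f b \<in> coboundaries C' d' n"
    and z: "z \<in> carrier (C n)"
  shows "cohomology_map C' d' n f (coboundaries C d n +>\<^bsub>C n\<^esub> z) = coboundaries C' d' n +>\<^bsub>C' n\<^esub> f z"
proof -
  note B = coboundaries_submodule[where C=C and d=d, OF C]
  note B' = coboundaries_submodule[where C=C' and d=d', OF C']
  show ?thesis
    unfolding cohomology_map_def
    using fB linear_mapD(2)[OF f submoduleD(1)[OF C(1) B] z] linear_mapD(1)[OF f z]
    by (intro coset_UN[where f=f, OF C(1) C'(1) B B' z]) auto
qed

lemma chain_map_coboundaries: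
  assumes "\<And>n. module K (C n)" "\<And>n. module K (C' n)" "\<And>n. linear_map K (C n) (C' n) (f n)"
    and "\<And>n x. x \<in> carrier (C n) \<Longrightarrow> f (Suc n) (d n x) = d' n (f n x)"
    and "b \<in> coboundaries C d n"
  shows "f n b \<in> coboundaries C' d' n"
proof (cases n)
  case 0
  then show ?thesis using assms(5) linear_map_zero[OF assms(1-3)] by (simp add: coboundaries_def)
next
  case (Suc m)
  then show ?thesis
    using assms(5) linear_mapD(1)[OF assms(3)] by (auto simp: coboundaries_def assms(4))
qed

locale group_complex = finite_group_char_zero K G
  for K :: "('k, 'a) ring_scheme" and G :: "('g, 'b) monoid_scheme" +
  fixes C :: "nat \<Rightarrow> ('k, 'v, 'g) opmod" and \<delta> :: "nat \<Rightarrow> 'v \<Rightarrow> 'v"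
  assumes C_group_module: "\<And>n. group_module K G (C n)"
    and \<delta>_equivariant: "\<And>n. equivariant_map K (carrier G) (C n) (C (Suc n)) (\<delta> n)"
begin

abbreviation invariant_complex :: "nat \<Rightarrow> ('k, 'v, 'g) opmod"
  where "invariant_complex \<equiv> \<lambda>n. fixed_space G (C n)"

lemma C_mod: "module K (C n)" and \<delta>_lin: "linear_map K (C n) (C (Suc n)) (\<delta> n)"
  using group_moduleD(1)[OF C_group_module] equivariant_mapD(1)[OF \<delta>_equivariant] by auto

lemma inv_mod: "module K (invariant_complex n)"
  by (rule fixed_space_module[OF C_group_module])

lemma inv_\<delta>: "linear_map K (invariant_complex n) (invariant_complex (Suc n)) (\<delta> n)"
  by (rule fixed_space_linear_map[OF C_group_module C_group_module \<delta>_equivariant])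

lemmas Z_submodule = cocycles_submodule[where C=C and d=\<delta>, OF C_mod \<delta>_lin]
lemmas B_submodule = coboundaries_submodule[where C=C and d=\<delta>, OF C_mod \<delta>_lin]
lemmas inv_Z_submodule = cocycles_submodule[where C=invariant_complex and d=\<delta>, OF inv_mod inv_\<delta>]
lemmas inv_B_submodule = coboundaries_submodule[where C=invariant_complex and d=\<delta>, OF inv_mod inv_\<delta>]

lemma opr_chain:
  "g \<in> carrier G \<Longrightarrow> x \<in> carrier (C n) \<Longrightarrow> opr (C (Suc n)) g (\<delta> n x) = \<delta> n (opr (C n) g x)"
  using equivariant_mapD(2)[OF \<delta>_equivariant] by simp

lemma opr_coboundary:
  assumes "g \<in> carrier G" "b \<in> coboundaries C \<delta> n"
  shows "opr (C n) g b \<in> coboundaries C \<delta> n"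
  by (rule chain_map_coboundaries[where f="\<lambda>n. opr (C n) g" and C=C and d=\<delta>,
        OF C_mod C_mod group_moduleD(2)[OF C_group_module assms(1)] opr_chain[OF assms(1)] assms(2)])

lemma opr_cocycle:
  assumes "g \<in> carrier G" "z \<in> cocycles C \<delta> n"
  shows "opr (C n) g z \<in> cocycles C \<delta> n"
  using assms group_moduleD(5)[OF C_group_module] opr_chain[OF assms(1), of z n, symmetric]
    linear_map_zero[OF C_mod C_mod group_moduleD(2)[OF C_group_module assms(1)]]
  by (simp add: cocycles_def)

lemma inv_cocycles_iff:
  "z \<in> cocycles invariant_complex \<delta> n \<longleftrightarrow> z \<in> cocycles C \<delta> n \<and> z \<in> carrier (invariant_complex n)"
  by (auto simp: cocycles_def)

text \<open>The average of \<open>\<delta> u\<close> is the coboundary of the average of \<open>u\<close>.\<close>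

lemma average_coboundary:
  assumes "b \<in> coboundaries C \<delta> n"
  shows "average K G (C n) b \<in> coboundaries invariant_complex \<delta> n"
proof (cases n)
  case 0
  interpret M: module K "C 0" by (rule C_mod)
  have "\<zero>\<^bsub>C 0\<^esub> \<in> carrier (fixed_space G (C 0))"
    using linear_map_zero[OF C_mod C_mod group_moduleD(2)[OF C_group_module]] by simp
  then show ?thesis
    using assms 0 average_id[OF C_group_module] by (simp add: coboundaries_def)
next
  case (Suc m)
  then obtain u where u: "u \<in> carrier (C m)" "b = \<delta> m u" using assms by (auto simp: coboundaries_def)
  have "average K G (C n) b = \<delta> m (average K G (C m) u)"
    using average_equivariant_map[OF C_group_module C_group_module \<delta>_equivariant u(1)] u(2) Suc by simp
  then show ?thesis
    using average_fixed[OF C_group_module u(1)] Suc unfolding coboundaries_def by simp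
qed

lemma average_cocycle:
  assumes "z \<in> cocycles C \<delta> n"
  shows "average K G (C n) z \<in> cocycles invariant_complex \<delta> n"
proof -
  have z: "z \<in> carrier (C n)" "\<delta> n z = \<zero>\<^bsub>C (Suc n)\<^esub>" using assms by (auto simp: cocycles_def)
  interpret M: module K "C (Suc n)" by (rule C_mod)
  have "\<zero>\<^bsub>C (Suc n)\<^esub> \<in> carrier (fixed_space G (C (Suc n)))"
    using linear_map_zero[OF C_mod C_mod group_moduleD(2)[OF C_group_module]] by simp
  then show ?thesis
    using average_fixed[OF C_group_module z(1)] z(2) average_id[OF C_group_module]
      average_equivariant_map[OF C_group_module C_group_module \<delta>_equivariant z(1)]
    by (simp add: cocycles_def)
qed

lemma inv_coboundaries_iff:
  "b \<in> coboundaries invariant_complex \<delta> n \<longleftrightarrow> b \<in> coboundaries C \<delta> n \<and> b \<in> carrier (invariant_complex n)"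
proof
  assume b: "b \<in> coboundaries invariant_complex \<delta> n"
  then have "b \<in> coboundaries C \<delta> n" by (cases n) (auto simp: coboundaries_def)
  then show "b \<in> coboundaries C \<delta> n \<and> b \<in> carrier (invariant_complex n)"
    using submoduleD(1)[OF inv_mod inv_B_submodule b] by simp
next
  assume "b \<in> coboundaries C \<delta> n \<and> b \<in> carrier (invariant_complex n)"
  then show "b \<in> coboundaries invariant_complex \<delta> n"
    using average_coboundary[of b n] average_id[OF C_group_module, of b n] by simp
qed

lemma cohomology_opr:
  assumes "g \<in> carrier G" "z \<in> carrier (C n)"
  shows "opr (cohomology_ops C \<delta> n) g (coboundaries C \<delta> n +>\<^bsub>C n\<^esub> z) =
    coboundaries C \<delta> n +>\<^bsub>C n\<^esub> opr (C n) g z"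
  unfolding cohomology_ops_def with_ops_simps
  using opr_coboundary[OF assms(1)] group_moduleD(5)[OF C_group_module assms]
    linear_mapD(2)[OF group_moduleD(2)[OF C_group_module assms(1)] submoduleD(1)[OF C_mod B_submodule] assms(2)]
  by (intro coset_UN[where f="opr (C n) g", OF C_mod C_mod B_submodule B_submodule assms(2)]) auto

lemma cohomology_add:
  assumes "x \<in> carrier (C n)" "y \<in> carrier (C n)"
  shows "(coboundaries C \<delta> n +>\<^bsub>C n\<^esub> x) \<oplus>\<^bsub>cohomology C \<delta> n\<^esub> (coboundaries C \<delta> n +>\<^bsub>C n\<^esub> y) =
    coboundaries C \<delta> n +>\<^bsub>C n\<^esub> (x \<oplus>\<^bsub>C n\<^esub> y)"
  unfolding cohomology_def by (rule subquotient_add[OF C_mod B_submodule assms])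

lemma cohomology_smult:
  assumes "k \<in> carrier K" "x \<in> carrier (C n)"
  shows "k \<odot>\<^bsub>cohomology C \<delta> n\<^esub> (coboundaries C \<delta> n +>\<^bsub>C n\<^esub> x) =
    coboundaries C \<delta> n +>\<^bsub>C n\<^esub> (k \<odot>\<^bsub>C n\<^esub> x)"
  unfolding cohomology_def by (rule subquotient_smult[OF C_mod B_submodule assms(2,1)])

lemma cohomology_ops_module: "module K (cohomology_ops C \<delta> n)"
  by (rule module_cong[OF cohomology_module[where C=C and d=\<delta>, OF C_mod \<delta>_lin, of n]]) (simp_all add: cohomology_simps)

lemma cohomology_group_module: "group_module K G (cohomology_ops C \<delta> n)"
  unfolding group_module_def
proof (intro conjI ballI)
  let ?H = "cohomology_ops C \<delta> n"
  note M = group_moduleD[OF C_group_module[of n]]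
  have el: "\<exists>z. z \<in> cocycles C \<delta> n \<and> z \<in> carrier (C n) \<and> X = coboundaries C \<delta> n +>\<^bsub>C n\<^esub> z"
    if "X \<in> carrier ?H" for X
    using that by (auto simp: cohomology_simps cocycles_def)
  show "module K ?H" by (rule cohomology_ops_module)
  interpret M: module K "C n" by (rule C_mod)
  fix g assume g: "g \<in> carrier G"
  show "linear_map K ?H ?H (opr ?H g)"
  proof (rule linear_mapI)
    fix X assume "X \<in> carrier ?H"
    then obtain z where z: "z \<in> cocycles C \<delta> n" "z \<in> carrier (C n)" "X = coboundaries C \<delta> n +>\<^bsub>C n\<^esub> z"
      using el by blast
    show "opr ?H g X \<in> carrier ?H"
      using opr_cocycle[OF g z(1)] unfolding z(3) cohomology_opr[OF g z(2)] by (auto simp: cohomology_simps)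
  next
    fix X Y assume "X \<in> carrier ?H" "Y \<in> carrier ?H"
    then obtain z y where z: "z \<in> carrier (C n)" "X = coboundaries C \<delta> n +>\<^bsub>C n\<^esub> z"
      and y: "y \<in> carrier (C n)" "Y = coboundaries C \<delta> n +>\<^bsub>C n\<^esub> y"
      using el by metis
    show "opr ?H g (X \<oplus>\<^bsub>?H\<^esub> Y) = opr ?H g X \<oplus>\<^bsub>?H\<^esub> opr ?H g Y"
      using z(1) y(1) g M(5) unfolding z(2) y(2)
      by (simp add: cohomology_simps cohomology_add cohomology_opr linear_mapD(2)[OF M(2)])
  next
    fix k X assume "k \<in> carrier K" "X \<in> carrier ?H"
    moreover then obtain z where z: "z \<in> carrier (C n)" "X = coboundaries C \<delta> n +>\<^bsub>C n\<^esub> z"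
      using el by metis
    ultimately show "opr ?H g (k \<odot>\<^bsub>?H\<^esub> X) = k \<odot>\<^bsub>?H\<^esub> opr ?H g X"
      using g M(5) by (simp add: cohomology_simps cohomology_smult cohomology_opr linear_mapD(3)[OF M(2)])
  qed
  fix h X assume h: "h \<in> carrier G" and "X \<in> carrier ?H"
  then obtain z where z: "z \<in> carrier (C n)" "X = coboundaries C \<delta> n +>\<^bsub>C n\<^esub> z"
    using el by metis
  then show "opr ?H (g \<otimes>\<^bsub>G\<^esub> h) X = opr ?H g (opr ?H h X)"
    using g h M(4,5) by (simp add: cohomology_opr)
next
  fix X assume "X \<in> carrier (cohomology_ops C \<delta> n)"
  then obtain z where z: "z \<in> carrier (C n)" "X = coboundaries C \<delta> n +>\<^bsub>C n\<^esub> z"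
    by (auto simp: cohomology_simps cocycles_def)
  then show "opr (cohomology_ops C \<delta> n) \<one>\<^bsub>G\<^esub> X = X"
    by (simp add: cohomology_opr group_moduleD(3)[OF C_group_module])
qed

text \<open>Taking invariants is exact: an invariant class has an invariant representative, the average
  of any representative, and an invariant coboundary is the coboundary of an invariant cochain.\<close>

lemma invariant_cohomology:
  "lin_iso K (cohomology invariant_complex \<delta> n) (fixed_space G (cohomology_ops C \<delta> n))"
proof -
  let ?B = "coboundaries C \<delta> n" and ?H = "cohomology_ops C \<delta> n"
  have c: "z \<in> cocycles C \<delta> n" "z \<in> carrier (C n)" "\<And>g. g \<in> carrier G \<Longrightarrow> opr (C n) g z = z"
    if "z \<in> cocycles invariant_complex \<delta> n" for z
    using that unfolding inv_cocycles_iff by auto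
  have minus: "a_minus (fixed_space G (C n)) x y = a_minus (C n) x y"
    if "x \<in> carrier (invariant_complex n)" "y \<in> carrier (invariant_complex n)" for x y
  proof -
    have "linear_map K (invariant_complex n) (C n) (\<lambda>x. x)" by (rule linear_mapI) auto
    then show ?thesis using linear_map_minus[OF inv_mod C_mod _ that] by blast
  qed
  show ?thesis
    unfolding cohomology_def[of invariant_complex]
  proof (rule lin_iso_subquotient[where f="\<lambda>z. ?B +>\<^bsub>C n\<^esub> z", OF inv_mod inv_B_submodule inv_Z_submodule])
    fix x y assume "x \<in> cocycles invariant_complex \<delta> n" "y \<in> cocycles invariant_complex \<delta> n"
    then show "?B +>\<^bsub>C n\<^esub> (x \<oplus>\<^bsub>fixed_space G (C n)\<^esub> y) =
        (?B +>\<^bsub>C n\<^esub> x) \<oplus>\<^bsub>fixed_space G ?H\<^esub> (?B +>\<^bsub>C n\<^esub> y)"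
      by (simp add: cohomology_simps cohomology_add c)
  next
    fix k x assume "k \<in> carrier K" "x \<in> cocycles invariant_complex \<delta> n"
    then show "?B +>\<^bsub>C n\<^esub> (k \<odot>\<^bsub>fixed_space G (C n)\<^esub> x) = k \<odot>\<^bsub>fixed_space G ?H\<^esub> (?B +>\<^bsub>C n\<^esub> x)"
      by (simp add: cohomology_simps cohomology_smult c)
  next
    fix x y assume xy: "x \<in> cocycles invariant_complex \<delta> n" "y \<in> cocycles invariant_complex \<delta> n"
    then have i: "x \<in> carrier (invariant_complex n)" "y \<in> carrier (invariant_complex n)"
      unfolding inv_cocycles_iff by auto
    interpret I: module K "invariant_complex n" by (rule inv_mod)
    show "?B +>\<^bsub>C n\<^esub> x = ?B +>\<^bsub>C n\<^esub> y \<longleftrightarrow>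
        x \<ominus>\<^bsub>fixed_space G (C n)\<^esub> y \<in> coboundaries invariant_complex \<delta> n"
      using coset_eq_iff[OF C_mod B_submodule c(2)[OF xy(1)] c(2)[OF xy(2)]] I.M.minus_closed[OF i] minus[OF i]
      unfolding inv_coboundaries_iff by metis
  next
    show "(\<lambda>z. ?B +>\<^bsub>C n\<^esub> z) ` cocycles invariant_complex \<delta> n = carrier (fixed_space G ?H)"
    proof (intro equalityI subsetI)
      fix X assume "X \<in> (\<lambda>z. ?B +>\<^bsub>C n\<^esub> z) ` cocycles invariant_complex \<delta> n"
      then show "X \<in> carrier (fixed_space G ?H)"
        using c by (auto simp: cohomology_simps cohomology_opr)
    next
      fix X assume X: "X \<in> carrier (fixed_space G ?H)"
      then obtain z where z: "z \<in> cocycles C \<delta> n" "X = ?B +>\<^bsub>C n\<^esub> z" by (auto simp: cohomology_simps)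
      let ?Z = "(C n)\<lparr>carrier := cocycles C \<delta> n\<rparr>"
      have Zm: "group_module K G ?Z"
        by (rule group_module_submodule[OF C_group_module Z_submodule opr_cocycle])
      have Zc: "z \<in> cocycles C \<delta> n \<Longrightarrow> z \<in> carrier (C n)" for z by (simp add: cocycles_def)
      have \<pi>: "equivariant_map K (carrier G) ?Z ?H (\<lambda>z. ?B +>\<^bsub>C n\<^esub> z)"
        unfolding equivariant_map_def
        by (auto intro!: linear_mapI simp: cohomology_simps cohomology_add cohomology_smult cohomology_opr Zc)
      have \<iota>: "equivariant_map K (carrier G) ?Z (C n) (\<lambda>z. z)"
        unfolding equivariant_map_def by (auto intro!: linear_mapI simp: Zc)
      have "average K G ?Z z = average K G (C n) z"
        using average_equivariant_map[OF Zm C_group_module \<iota>, of z] z(1) by simp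
      then have "?B +>\<^bsub>C n\<^esub> average K G (C n) z = average K G ?H X"
        using average_equivariant_map[OF Zm cohomology_group_module \<pi>, of z] z by simp
      also have "\<dots> = X" by (rule average_id[OF cohomology_group_module X])
      finally show "X \<in> (\<lambda>z. ?B +>\<^bsub>C n\<^esub> z) ` cocycles invariant_complex \<delta> n"
        using average_cocycle[OF z(1)] by (metis imageI)
    qed
  qed
qed

end

section \<open>Invariants of a Cartan--Eilenberg resolution\<close>

lemma injective_resolutionD:
  assumes "injective_resolution K S P T M \<eta> R d"
  shows "P (R n)" "injective_object K S T (R n)" "equivariant_map K S M (R 0) \<eta>"
    "equivariant_map K S (R n) (R (Suc n)) (d n)" "inj_on \<eta> (carrier M)"
    "\<eta> ` carrier M = cocycles R d 0" "d n ` carrier (R n) = cocycles R d (Suc n)"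
  using assms unfolding injective_resolution_def by blast+

locale cartan_eilenberg_resolution = group_complex K G C \<delta>
  for K :: "('k, 'a) ring_scheme" and G :: "('g, 'b) monoid_scheme"
    and C :: "nat \<Rightarrow> ('k, 'c, 'g) opmod" and \<delta> :: "nat \<Rightarrow> 'c \<Rightarrow> 'c" +
  fixes \<epsilon> :: "nat \<Rightarrow> 'c \<Rightarrow> 'm" and J :: "nat \<Rightarrow> nat \<Rightarrow> ('k, 'm, 'g) opmod"
    and dv dh :: "nat \<Rightarrow> nat \<Rightarrow> 'm \<Rightarrow> 'm"
  assumes ce: "cartan_eilenberg K G C \<delta> \<epsilon> J dv dh"
begin

lemma ceD:
  "group_module K G (J p q)"
  "equivariant_map K (carrier G) (C q) (J 0 q) (\<epsilon> q)"
  "equivariant_map K (carrier G) (J p q) (J (Suc p) q) (dv p q)"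
  "equivariant_map K (carrier G) (J p q) (J p (Suc q)) (dh p q)"
  "c \<in> carrier (C q) \<Longrightarrow> \<epsilon> (Suc q) (\<delta> q c) = dh 0 q (\<epsilon> q c)"
  "c \<in> carrier (C q) \<Longrightarrow> dv 0 q (\<epsilon> q c) = \<zero>\<^bsub>J 1 q\<^esub>"
  "x \<in> carrier (J p q) \<Longrightarrow> dv (Suc p) q (dv p q x) = \<zero>\<^bsub>J (Suc (Suc p)) q\<^esub>"
  "x \<in> carrier (J p q) \<Longrightarrow> dh p (Suc q) (dh p q x) = \<zero>\<^bsub>J p (Suc (Suc q))\<^esub>"
  "x \<in> carrier (J p q) \<Longrightarrow> dv p (Suc q) (dh p q x) = dh (Suc p) q (dv p q x)"
  using ce unfolding cartan_eilenberg_def Let_def by blast+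

abbreviation H_row :: "nat \<Rightarrow> nat \<Rightarrow> ('k, 'm set, 'g) opmod"
  where "H_row q p \<equiv> cohomology_ops (J p) (dh p) q"

abbreviation H_dv :: "nat \<Rightarrow> nat \<Rightarrow> 'm set \<Rightarrow> 'm set"
  where "H_dv q p \<equiv> cohomology_map (J (Suc p)) (dh (Suc p)) q (dv p q)"

lemma cohomology_resolution:
  "inj_on (cohomology_map (J 0) (dh 0) q (\<epsilon> q)) (carrier (cohomology_ops C \<delta> q))"
  "cohomology_map (J 0) (dh 0) q (\<epsilon> q) ` carrier (cohomology_ops C \<delta> q) = cocycles (H_row q) (H_dv q) 0"
  "H_dv q p ` carrier (H_row q p) = cocycles (H_row q) (H_dv q) (Suc p)"
proof -
  have "injective_resolution K (carrier G) (group_module K G) (group_module K G :: ('k, 'm, 'g) opmod \<Rightarrow> bool)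
      (cohomology_ops C \<delta> q) (cohomology_map (J 0) (dh 0) q (\<epsilon> q)) (H_row q) (H_dv q)"
    using ce unfolding cartan_eilenberg_def Let_def by blast
  from injective_resolutionD(5-7)[OF this]
  show "inj_on (cohomology_map (J 0) (dh 0) q (\<epsilon> q)) (carrier (cohomology_ops C \<delta> q))"
    "cohomology_map (J 0) (dh 0) q (\<epsilon> q) ` carrier (cohomology_ops C \<delta> q) = cocycles (H_row q) (H_dv q) 0"
    "H_dv q p ` carrier (H_row q p) = cocycles (H_row q) (H_dv q) (Suc p)" .
qed

sublocale row: group_complex K G "J p" "dh p" for p
  by unfold_locales (rule ceD)+

lemma dv_coset:
  assumes "z \<in> carrier (J p q)"
  shows "H_dv q p (coboundaries (J p) (dh p) q +>\<^bsub>J p q\<^esub> z) =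
    coboundaries (J (Suc p)) (dh (Suc p)) q +>\<^bsub>J (Suc p) q\<^esub> dv p q z"
  using chain_map_coboundaries[where C="J p" and C'="J (Suc p)" and d="dh p" and d'="dh (Suc p)" and f="dv p",
      OF row.C_mod row.C_mod equivariant_mapD(1)[OF ceD(3)] ceD(9)]
  by (intro cohomology_map_coset[where C="J p" and C'="J (Suc p)", OF row.C_mod row.\<delta>_lin row.C_mod row.\<delta>_lin
        equivariant_mapD(1)[OF ceD(3)] _ assms]) auto

lemma \<epsilon>_coset:
  assumes "z \<in> carrier (C q)"
  shows "cohomology_map (J 0) (dh 0) q (\<epsilon> q) (coboundaries C \<delta> q +>\<^bsub>C q\<^esub> z) =
    coboundaries (J 0) (dh 0) q +>\<^bsub>J 0 q\<^esub> \<epsilon> q z"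
  using chain_map_coboundaries[where C=C and C'="J 0" and d=\<delta> and d'="dh 0" and f=\<epsilon>,
      OF C_mod row.C_mod equivariant_mapD(1)[OF ceD(2)] ceD(5)]
  by (intro cohomology_map_coset[where C=C and C'="J 0", OF C_mod \<delta>_lin row.C_mod row.\<delta>_lin
        equivariant_mapD(1)[OF ceD(2)] _ assms]) auto

lemma row_cocycle_vertical:
  assumes "x \<in> cocycles (J p) (dh p) q" "dv p q x \<in> coboundaries (J (Suc p)) (dh (Suc p)) q"
  shows "coboundaries (J p) (dh p) q +>\<^bsub>J p q\<^esub> x \<in> cocycles (H_row q) (H_dv q) p"
proof -
  have "x \<in> carrier (J p q)" using assms(1) by (simp add: cocycles_def)
  then show ?thesis
    using assms(1) dv_coset coset_zero[OF row.C_mod row.B_submodule assms(2)]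
    by (auto simp: cocycles_def[of "H_row q"] cohomology_simps)
qed

lemma fixed_minus:
  assumes "group_module K G M" "x \<in> carrier (fixed_space G M)" "y \<in> carrier (fixed_space G M)"
  shows "x \<ominus>\<^bsub>fixed_space G M\<^esub> y = x \<ominus>\<^bsub>M\<^esub> y"
proof -
  have "linear_map K (fixed_space G M) M (\<lambda>x. x)" by (rule linear_mapI) auto
  then show ?thesis
    using linear_map_minus[OF fixed_space_module[OF assms(1)] group_moduleD(1)[OF assms(1)] _ assms(2,3)] by blast
qed

text \<open>An invariant element is its own average, and the average of a coboundary is the coboundary of
  an invariant cochain.\<close>

lemma average_correction:
  assumes M: "group_module K G M" and f: "equivariant_map K (carrier G) M (J p q) f"
    and x: "x \<in> carrier (fixed_space G (J p q))" and z: "z \<in> carrier M"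
    and "x \<ominus>\<^bsub>J p q\<^esub> f z \<in> coboundaries (J p) (dh p) q"
  shows "x \<ominus>\<^bsub>fixed_space G (J p q)\<^esub> f (average K G M z) \<in> coboundaries (\<lambda>q. fixed_space G (J p q)) (dh p) q"
proof -
  have fz: "f z \<in> carrier (J p q)" using linear_mapD(1)[OF equivariant_mapD(1)[OF f] z] .
  have "average K G (J p q) (x \<ominus>\<^bsub>J p q\<^esub> f z) = x \<ominus>\<^bsub>J p q\<^esub> average K G (J p q) (f z)"
    using average_minus[OF ceD(1) _ fz, of x] average_id[OF ceD(1) x] x by simp
  also have "\<dots> = x \<ominus>\<^bsub>fixed_space G (J p q)\<^esub> f (average K G M z)"
    using fixed_minus[OF ceD(1) x average_fixed[OF ceD(1) fz]] average_equivariant_map[OF M ceD(1) f z] by simp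
  finally show ?thesis using row.average_coboundary[OF assms(5)] by simp
qed

text \<open>A Cartan--Eilenberg resolution resolves the cohomology of \<open>(C, \<delta>)\<close> by its
  horizontal cohomology. Exactness gives representatives in \<open>J\<close> and \<open>C\<close>, and
  averaging makes them invariant.\<close>

lemma invariants_resolved:
  "resolved_double_complex K (\<lambda>p q. fixed_space G (J p q)) dv dh invariant_complex \<delta> \<epsilon>"
proof (intro resolved_double_complex.intro double_complex.intro resolved_double_complex_axioms.intro)
  fix p q
  show "module K (fixed_space G (J p q))" by (rule row.inv_mod)
  show "linear_map K (fixed_space G (J p q)) (fixed_space G (J (Suc p) q)) (dv p q)"
    by (rule fixed_space_linear_map[OF ceD(1,1,3)])
  show "linear_map K (fixed_space G (J p q)) (fixed_space G (J p (Suc q))) (dh p q)"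
    by (rule row.inv_\<delta>)
  show "module K (invariant_complex q)" by (rule inv_mod)
  show "linear_map K (invariant_complex q) (invariant_complex (Suc q)) (\<delta> q)" by (rule inv_\<delta>)
  show "linear_map K (invariant_complex q) (fixed_space G (J 0 q)) (\<epsilon> q)"
    by (rule fixed_space_linear_map[OF C_group_module ceD(1,2)])
next
  fix p q x
  assume x: "x \<in> cocycles (\<lambda>q. fixed_space G (J (Suc p) q)) (dh (Suc p)) q"
    and dx: "dv (Suc p) q x \<in> coboundaries (\<lambda>q. fixed_space G (J (Suc (Suc p)) q)) (dh (Suc (Suc p))) q"
  have x': "x \<in> cocycles (J (Suc p)) (dh (Suc p)) q" "x \<in> carrier (fixed_space G (J (Suc p) q))"
    using x unfolding row.inv_cocycles_iff by auto
  then have xc: "x \<in> carrier (J (Suc p) q)" by simp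
  have "dv (Suc p) q x \<in> coboundaries (J (Suc (Suc p))) (dh (Suc (Suc p))) q"
    using dx unfolding row.inv_coboundaries_iff by simp
  from row_cocycle_vertical[OF x'(1) this, folded cohomology_resolution(3)]
  obtain z where z: "z \<in> cocycles (J p) (dh p) q"
    "coboundaries (J (Suc p)) (dh (Suc p)) q +>\<^bsub>J (Suc p) q\<^esub> x =
      H_dv q p (coboundaries (J p) (dh p) q +>\<^bsub>J p q\<^esub> z)"
    by (auto simp: cohomology_simps)
  have zc: "z \<in> carrier (J p q)" using z(1) by (simp add: cocycles_def)
  have "x \<ominus>\<^bsub>J (Suc p) q\<^esub> dv p q z \<in> coboundaries (J (Suc p)) (dh (Suc p)) q"
    using z(2) coset_eq_iff[OF row.C_mod row.B_submodule xc linear_mapD(1)[OF equivariant_mapD(1)[OF ceD(3)] zc]]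
    unfolding dv_coset[OF zc] by blast
  from average_correction[OF ceD(1,3) x'(2) zc this] row.average_cocycle[OF z(1)]
  show "\<exists>z\<in>cocycles (\<lambda>q. fixed_space G (J p q)) (dh p) q.
      x \<ominus>\<^bsub>fixed_space G (J (Suc p) q)\<^esub> dv p q z \<in> coboundaries (\<lambda>q. fixed_space G (J (Suc p) q)) (dh (Suc p)) q"
    by blast
next
  fix q x
  assume x: "x \<in> cocycles (\<lambda>q. fixed_space G (J 0 q)) (dh 0) q"
    and dx: "dv 0 q x \<in> coboundaries (\<lambda>q. fixed_space G (J 1 q)) (dh 1) q"
  have x': "x \<in> cocycles (J 0) (dh 0) q" "x \<in> carrier (fixed_space G (J 0 q))"
    using x unfolding row.inv_cocycles_iff by auto
  then have xc: "x \<in> carrier (J 0 q)" by simp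
  have "dv 0 q x \<in> coboundaries (J (Suc 0)) (dh (Suc 0)) q"
    using dx unfolding row.inv_coboundaries_iff by simp
  from row_cocycle_vertical[OF x'(1) this, folded cohomology_resolution(2)]
  obtain z where z: "z \<in> cocycles C \<delta> q"
    "coboundaries (J 0) (dh 0) q +>\<^bsub>J 0 q\<^esub> x =
      cohomology_map (J 0) (dh 0) q (\<epsilon> q) (coboundaries C \<delta> q +>\<^bsub>C q\<^esub> z)"
    by (auto simp: cohomology_simps)
  have zc: "z \<in> carrier (C q)" using z(1) by (simp add: cocycles_def)
  have "x \<ominus>\<^bsub>J 0 q\<^esub> \<epsilon> q z \<in> coboundaries (J 0) (dh 0) q"
    using z(2) coset_eq_iff[OF row.C_mod row.B_submodule xc linear_mapD(1)[OF equivariant_mapD(1)[OF ceD(2)] zc]]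
    unfolding \<epsilon>_coset[OF zc] by blast
  from average_correction[OF C_group_module ceD(2) x'(2) zc this] average_cocycle[OF z(1)]
  show "\<exists>c\<in>cocycles invariant_complex \<delta> q.
      x \<ominus>\<^bsub>fixed_space G (J 0 q)\<^esub> \<epsilon> q c \<in> coboundaries (\<lambda>q. fixed_space G (J 0 q)) (dh 0) q"
    by blast
next
  fix q c
  assume c: "c \<in> cocycles invariant_complex \<delta> q"
    and ec: "\<epsilon> q c \<in> coboundaries (\<lambda>q. fixed_space G (J 0 q)) (dh 0) q"
  have c': "c \<in> cocycles C \<delta> q" "c \<in> carrier (invariant_complex q)" using c unfolding inv_cocycles_iff by auto
  have cc: "c \<in> carrier (C q)" using c'(2) by simp
  have "\<epsilon> q c \<in> coboundaries (J 0) (dh 0) q" using ec unfolding row.inv_coboundaries_iff by simp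
  interpret M: module K "C q" by (rule C_mod)
  have z0: "\<zero>\<^bsub>C q\<^esub> \<in> cocycles C \<delta> q" by (rule submoduleD(2)[OF C_mod Z_submodule])
  have "cohomology_map (J 0) (dh 0) q (\<epsilon> q) (coboundaries C \<delta> q +>\<^bsub>C q\<^esub> c) =
      cohomology_map (J 0) (dh 0) q (\<epsilon> q) (coboundaries C \<delta> q +>\<^bsub>C q\<^esub> \<zero>\<^bsub>C q\<^esub>)"
    using coset_zero[OF row.C_mod row.B_submodule \<open>\<epsilon> q c \<in> coboundaries (J 0) (dh 0) q\<close>]
      coset_zero[OF row.C_mod row.B_submodule submoduleD(2)[OF row.C_mod row.B_submodule]]
      linear_map_zero[OF C_mod row.C_mod equivariant_mapD(1)[OF ceD(2)]]
    by (simp add: \<epsilon>_coset cc)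
  then have "coboundaries C \<delta> q +>\<^bsub>C q\<^esub> c = coboundaries C \<delta> q +>\<^bsub>C q\<^esub> \<zero>\<^bsub>C q\<^esub>"
    by (rule inj_onD[OF cohomology_resolution(1)]) (use c'(1) z0 in \<open>auto simp: cohomology_simps\<close>)
  then have "c \<in> coboundaries C \<delta> q"
    using coset_self[OF C_mod B_submodule cc] coset_zero[OF C_mod B_submodule submoduleD(2)[OF C_mod B_submodule]]
    by simp
  then show "c \<in> coboundaries invariant_complex \<delta> q" unfolding inv_coboundaries_iff using c'(2) by simp
qed (use ceD in auto)

end

section \<open>The free algebra and the halo algebra\<close>

text \<open>When \<open>j \<le> i\<close> are the positions at which a word is cut into three parts, this is
  the associativity of the concatenation product.\<close>

lemma (in abelian_monoid) finsum_triangle: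
  assumes "\<And>i j. i \<le> n \<Longrightarrow> j \<le> i \<Longrightarrow> a i j \<in> carrier G"
  shows "(\<Oplus>i\<in>{..n::nat}. \<Oplus>j\<in>{..i}. a i j) = (\<Oplus>j\<in>{..n}. \<Oplus>k\<in>{..n - j}. a (j + k) j)"
  using assms
proof (induction n)
  case 0
  then show ?case by simp
next
  case (Suc n)
  have c: "(\<Oplus>k\<in>{..n - j}. a (j + k) j) \<in> carrier G" if "j \<le> n" for j
    using Suc.prems that by (intro finsum_closed Pi_I) auto
  have "(\<Oplus>j\<in>{..n}. \<Oplus>k\<in>{..Suc n - j}. a (j + k) j)
    = (\<Oplus>j\<in>{..n}. a (Suc n) j \<oplus> (\<Oplus>k\<in>{..n - j}. a (j + k) j))"
  proof (rule finsum_cong'[OF refl])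
    fix j assume j: "j \<in> {..n}"
    then have e: "Suc n - j = Suc (n - j)" "j + Suc (n - j) = Suc n" by auto
    show "(\<Oplus>k\<in>{..Suc n - j}. a (j + k) j) = a (Suc n) j \<oplus> (\<Oplus>k\<in>{..n - j}. a (j + k) j)"
      unfolding e(1) using j e(2) Suc.prems by (subst finsum_Suc) (auto simp: Pi_def)
  qed (use Suc.prems c in auto)
  also have "\<dots> = (\<Oplus>j\<in>{..n}. a (Suc n) j) \<oplus> (\<Oplus>j\<in>{..n}. \<Oplus>k\<in>{..n - j}. a (j + k) j)"
    using Suc.prems c by (intro finsum_addf Pi_I) auto
  finally have inner: "(\<Oplus>j\<in>{..n}. \<Oplus>k\<in>{..Suc n - j}. a (j + k) j)
    = (\<Oplus>j\<in>{..n}. a (Suc n) j) \<oplus> (\<Oplus>j\<in>{..n}. \<Oplus>k\<in>{..n - j}. a (j + k) j)" .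
  have cl: "(\<Oplus>j\<in>{..i}. a i j) \<in> carrier G" if "i \<le> Suc n" for i
    using Suc.prems that by (intro finsum_closed Pi_I) auto
  have cn: "(\<Oplus>j\<in>{..n}. a (Suc n) j) \<in> carrier G" "a (Suc n) (Suc n) \<in> carrier G"
    using Suc.prems by (auto intro!: finsum_closed)
  have cr: "(\<Oplus>j\<in>{..n}. \<Oplus>k\<in>{..n - j}. a (j + k) j) \<in> carrier G"
    using c by (intro finsum_closed) auto
  have "(\<Oplus>i\<in>{..Suc n}. \<Oplus>j\<in>{..i}. a i j) = (\<Oplus>j\<in>{..Suc n}. a (Suc n) j) \<oplus> (\<Oplus>i\<in>{..n}. \<Oplus>j\<in>{..i}. a i j)"
    using cl by (intro finsum_Suc Pi_I) auto
  also have "(\<Oplus>i\<in>{..n}. \<Oplus>j\<in>{..i}. a i j) = (\<Oplus>j\<in>{..n}. \<Oplus>k\<in>{..n - j}. a (j + k) j)"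
    using Suc by simp
  also have "(\<Oplus>j\<in>{..Suc n}. a (Suc n) j) = a (Suc n) (Suc n) \<oplus> (\<Oplus>j\<in>{..n}. a (Suc n) j)"
    using Suc.prems by (intro finsum_Suc Pi_I) auto
  also have "(a (Suc n) (Suc n) \<oplus> (\<Oplus>j\<in>{..n}. a (Suc n) j)) \<oplus> (\<Oplus>j\<in>{..n}. \<Oplus>k\<in>{..n - j}. a (j + k) j)
    = a (Suc n) (Suc n) \<oplus> (\<Oplus>j\<in>{..n}. \<Oplus>k\<in>{..Suc n - j}. a (j + k) j)"
    unfolding inner using cn cr by (simp add: a_assoc)
  also have "\<dots> = (\<Oplus>j\<in>{..Suc n}. \<Oplus>k\<in>{..Suc n - j}. a (j + k) j)"
  proof -
    have "(\<Oplus>k\<in>{..Suc n - j}. a (j + k) j) \<in> carrier G" if "j \<le> Suc n" for j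
      using Suc.prems that by (intro finsum_closed Pi_I) auto
    then have "(\<Oplus>j\<in>{..Suc n}. \<Oplus>k\<in>{..Suc n - j}. a (j + k) j)
      = (\<Oplus>k\<in>{..Suc n - Suc n}. a (Suc n + k) (Suc n)) \<oplus> (\<Oplus>j\<in>{..n}. \<Oplus>k\<in>{..Suc n - j}. a (j + k) j)"
      by (intro finsum_Suc Pi_I) auto
    then show ?thesis using cn by simp
  qed
  finally show ?case .
qed

definition support :: "('k, 'a) ring_scheme \<Rightarrow> ('e list \<Rightarrow> 'k) \<Rightarrow> 'e list set"
  where "support K f = {w. f w \<noteq> \<zero>\<^bsub>K\<^esub>}"

definition word :: "('k, 'a) ring_scheme \<Rightarrow> 'e list \<Rightarrow> 'e list \<Rightarrow> 'k"
  where "word K w = (\<lambda>u. if u = w then \<one>\<^bsub>K\<^esub> else \<zero>\<^bsub>K\<^esub>)"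

text \<open>The value at \<open>f\<close> of the algebra homomorphism that sends the generator \<open>\<alpha>\<close> to
  \<open>T \<alpha>\<close>.\<close>

definition word_act ::
  "('k, 'a) ring_scheme \<Rightarrow> ('k, 'v, 'c) module_scheme \<Rightarrow> ('e \<Rightarrow> 'v \<Rightarrow> 'v) \<Rightarrow> ('e list \<Rightarrow> 'k) \<Rightarrow> 'v \<Rightarrow> 'v"
  where "word_act K V T f v = (\<Oplus>\<^bsub>V\<^esub>w\<in>support K f. f w \<odot>\<^bsub>V\<^esub> foldr T w v)"

locale words = K: cring K
  for K :: "('k, 'a) ring_scheme" and E :: "'e set"
begin

abbreviation F :: "('k, 'e list \<Rightarrow> 'k) module" where "F \<equiv> free_algebra K E"
abbreviation supp :: "('e list \<Rightarrow> 'k) \<Rightarrow> 'e list set" where "supp \<equiv> support K"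

lemma F_simps:
  "f \<in> carrier F \<longleftrightarrow> (\<forall>w. f w \<in> carrier K) \<and> finite (supp f) \<and> supp f \<subseteq> lists E"
  "\<zero>\<^bsub>F\<^esub> = (\<lambda>_. \<zero>\<^bsub>K\<^esub>)"
  "f \<oplus>\<^bsub>F\<^esub> g = (\<lambda>w. f w \<oplus>\<^bsub>K\<^esub> g w)"
  "k \<odot>\<^bsub>F\<^esub> f = (\<lambda>w. k \<otimes>\<^bsub>K\<^esub> f w)"
  "\<one>\<^bsub>F\<^esub> = word K []"
  "f \<otimes>\<^bsub>F\<^esub> g = (\<lambda>w. \<Oplus>\<^bsub>K\<^esub>i\<in>{..length w}. f (take i w) \<otimes>\<^bsub>K\<^esub> g (drop i w))"
  by (auto simp: free_algebra_def support_def word_def)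

lemma F_coeff [simp]: "f \<in> carrier F \<Longrightarrow> f w \<in> carrier K"
  by (simp add: F_simps)

lemma F_memI:
  assumes "\<And>w. f w \<in> carrier K" "supp f \<subseteq> S" "finite S" "S \<subseteq> lists E"
  shows "f \<in> carrier F"
  using assms by (auto simp: F_simps(1) intro: finite_subset)

lemma add_mem:
  assumes "f \<in> carrier F" "g \<in> carrier F" shows "f \<oplus>\<^bsub>F\<^esub> g \<in> carrier F"
  using assms by (intro F_memI[of _ "supp f \<union> supp g"]) (auto simp: F_simps support_def)

lemma smult_mem:
  assumes "k \<in> carrier K" "f \<in> carrier F" shows "k \<odot>\<^bsub>F\<^esub> f \<in> carrier F"
  using assms by (intro F_memI[of _ "supp f"]) (auto simp: F_simps support_def)

lemma mult_mem:
  assumes "f \<in> carrier F" "g \<in> carrier F" shows "f \<otimes>\<^bsub>F\<^esub> g \<in> carrier F"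
proof (rule F_memI[of _ "(\<lambda>(u, v). u @ v) ` (supp f \<times> supp g)"])
  show "(f \<otimes>\<^bsub>F\<^esub> g) w \<in> carrier K" for w
    using assms by (auto simp: F_simps(6) intro!: K.finsum_closed)
  show "supp (f \<otimes>\<^bsub>F\<^esub> g) \<subseteq> (\<lambda>(u, v). u @ v) ` (supp f \<times> supp g)"
  proof
    fix w assume "w \<in> supp (f \<otimes>\<^bsub>F\<^esub> g)"
    then have "\<exists>i. f (take i w) \<otimes>\<^bsub>K\<^esub> g (drop i w) \<noteq> \<zero>\<^bsub>K\<^esub>"
      using K.add.finprod_one_eqI[of "{..length w}" "\<lambda>i. f (take i w) \<otimes>\<^bsub>K\<^esub> g (drop i w)"]
      by (auto simp: support_def F_simps(6))
    then obtain i where "f (take i w) \<otimes>\<^bsub>K\<^esub> g (drop i w) \<noteq> \<zero>\<^bsub>K\<^esub>" by blast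
    then have "(take i w, drop i w) \<in> supp f \<times> supp g"
      using F_coeff[OF assms(1), of "take i w"] F_coeff[OF assms(2), of "drop i w"] by (auto simp: support_def)
    then have "(\<lambda>(u, v). u @ v) (take i w, drop i w) \<in> (\<lambda>(u, v). u @ v) ` (supp f \<times> supp g)"
      by (rule imageI)
    then show "w \<in> (\<lambda>(u, v). u @ v) ` (supp f \<times> supp g)" by simp
  qed
next
  have "u @ v \<in> lists E" if "u \<in> supp f" "v \<in> supp g" for u v
    using that assms unfolding F_simps(1) append_in_lists_conv by blast
  then show "(\<lambda>(u, v). u @ v) ` (supp f \<times> supp g) \<subseteq> lists E" by (auto simp del: append_in_lists_conv in_lists_conv_set)
qed (use assms in \<open>auto simp: F_simps(1)\<close>)

lemma word_mem: "w \<in> lists E \<Longrightarrow> word K w \<in> carrier F"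
  by (rule F_memI[of _ "{w}"]) (auto simp: word_def support_def)

lemma zero_mem: "\<zero>\<^bsub>F\<^esub> \<in> carrier F"
  by (rule F_memI[of _ "{}"]) (auto simp: F_simps support_def)

lemma free_gen_word: "free_gen K \<alpha> = word K [\<alpha>]"
  by (simp add: free_gen_def word_def)

lemma gen_mem: "\<alpha> \<in> E \<Longrightarrow> free_gen K \<alpha> \<in> carrier F"
  unfolding free_gen_word by (rule word_mem) simp

lemma F_module: "module K F"
proof (rule moduleI)
  show "cring K" by (rule K.is_cring)
  show "abelian_group F"
  proof (rule abelian_groupI)
    fix f assume f: "f \<in> carrier F"
    have "(\<ominus>\<^bsub>K\<^esub> \<one>\<^bsub>K\<^esub>) \<odot>\<^bsub>F\<^esub> f \<oplus>\<^bsub>F\<^esub> f = \<zero>\<^bsub>F\<^esub>"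
      using f by (simp add: F_simps(2-4) K.l_minus K.l_neg)
    then show "\<exists>g\<in>carrier F. g \<oplus>\<^bsub>F\<^esub> f = \<zero>\<^bsub>F\<^esub>"
      using smult_mem[OF _ f, of "\<ominus>\<^bsub>K\<^esub> \<one>\<^bsub>K\<^esub>"] by auto
  qed (auto simp: add_mem zero_mem, auto simp: F_simps(2-4) K.a_ac)
qed (auto simp: smult_mem, auto simp: F_simps(2-4) K.l_distr K.r_distr K.m_assoc)

lemma mult_assoc:
  assumes f: "f \<in> carrier F" and g: "g \<in> carrier F" and h: "h \<in> carrier F"
  shows "(f \<otimes>\<^bsub>F\<^esub> g) \<otimes>\<^bsub>F\<^esub> h = f \<otimes>\<^bsub>F\<^esub> (g \<otimes>\<^bsub>F\<^esub> h)"
proof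
  fix w :: "'e list"
  let ?n = "length w"
  let ?a = "\<lambda>i j. f (take j w) \<otimes>\<^bsub>K\<^esub> g (drop j (take i w)) \<otimes>\<^bsub>K\<^esub> h (drop i w)"
  have "((f \<otimes>\<^bsub>F\<^esub> g) \<otimes>\<^bsub>F\<^esub> h) w = (\<Oplus>\<^bsub>K\<^esub>i\<in>{..?n}. \<Oplus>\<^bsub>K\<^esub>j\<in>{..i}. ?a i j)"
    unfolding F_simps(6)
  proof (rule K.finsum_cong'[OF refl])
    fix i assume i: "i \<in> {..?n}"
    have "(\<Oplus>\<^bsub>K\<^esub>j\<in>{..length (take i w)}. f (take j (take i w)) \<otimes>\<^bsub>K\<^esub> g (drop j (take i w))) \<otimes>\<^bsub>K\<^esub> h (drop i w)
      = (\<Oplus>\<^bsub>K\<^esub>j\<in>{..length (take i w)}. f (take j (take i w)) \<otimes>\<^bsub>K\<^esub> g (drop j (take i w)) \<otimes>\<^bsub>K\<^esub> h (drop i w))"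
      using f g h by (intro K.finsum_ldistr) auto
    also have "\<dots> = (\<Oplus>\<^bsub>K\<^esub>j\<in>{..i}. ?a i j)"
      using i f g h by (intro K.finsum_cong') (auto simp: min_absorb2)
    finally show "(\<Oplus>\<^bsub>K\<^esub>j\<in>{..length (take i w)}. f (take j (take i w)) \<otimes>\<^bsub>K\<^esub> g (drop j (take i w))) \<otimes>\<^bsub>K\<^esub> h (drop i w)
      = (\<Oplus>\<^bsub>K\<^esub>j\<in>{..i}. ?a i j)" .
  qed (use f g h in \<open>auto intro!: K.finsum_closed\<close>)
  also have "\<dots> = (\<Oplus>\<^bsub>K\<^esub>j\<in>{..?n}. \<Oplus>\<^bsub>K\<^esub>k\<in>{..?n - j}. ?a (j + k) j)"
    using f g h by (intro K.finsum_triangle) auto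
  also have "\<dots> = (f \<otimes>\<^bsub>F\<^esub> (g \<otimes>\<^bsub>F\<^esub> h)) w"
    unfolding F_simps(6)
  proof (rule K.finsum_cong'[OF refl])
    fix j assume j: "j \<in> {..?n}"
    have "f (take j w) \<otimes>\<^bsub>K\<^esub> (\<Oplus>\<^bsub>K\<^esub>k\<in>{..length (drop j w)}. g (take k (drop j w)) \<otimes>\<^bsub>K\<^esub> h (drop k (drop j w)))
      = (\<Oplus>\<^bsub>K\<^esub>k\<in>{..length (drop j w)}. f (take j w) \<otimes>\<^bsub>K\<^esub> (g (take k (drop j w)) \<otimes>\<^bsub>K\<^esub> h (drop k (drop j w))))"
      using f g h by (intro K.finsum_rdistr) auto
    also have "\<dots> = (\<Oplus>\<^bsub>K\<^esub>k\<in>{..?n - j}. ?a (j + k) j)"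
      using f g h by (intro K.finsum_cong') (auto simp: drop_take K.m_assoc add.commute)
    finally show "(\<Oplus>\<^bsub>K\<^esub>k\<in>{..?n - j}. ?a (j + k) j) =
      f (take j w) \<otimes>\<^bsub>K\<^esub> (\<Oplus>\<^bsub>K\<^esub>k\<in>{..length (drop j w)}. g (take k (drop j w)) \<otimes>\<^bsub>K\<^esub> h (drop k (drop j w)))" ..
  qed (use f g h in \<open>auto intro!: K.finsum_closed\<close>)
  finally show "((f \<otimes>\<^bsub>F\<^esub> g) \<otimes>\<^bsub>F\<^esub> h) w = (f \<otimes>\<^bsub>F\<^esub> (g \<otimes>\<^bsub>F\<^esub> h)) w" .
qed

lemma one_mult:
  assumes f: "f \<in> carrier F"
  shows "\<one>\<^bsub>F\<^esub> \<otimes>\<^bsub>F\<^esub> f = f" and "f \<otimes>\<^bsub>F\<^esub> \<one>\<^bsub>F\<^esub> = f"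
proof -
  have "(\<Oplus>\<^bsub>K\<^esub>i\<in>{..length w}. word K [] (take i w) \<otimes>\<^bsub>K\<^esub> f (drop i w)) = f w" for w
  proof -
    have "(\<Oplus>\<^bsub>K\<^esub>i\<in>{..length w}. word K [] (take i w) \<otimes>\<^bsub>K\<^esub> f (drop i w))
      = (\<Oplus>\<^bsub>K\<^esub>i\<in>{..length w}. if i = 0 then f (drop i w) else \<zero>\<^bsub>K\<^esub>)"
      using f by (intro K.finsum_cong') (auto simp: word_def)
    also have "\<dots> = f (drop 0 w)" using f by (intro K.add.finprod_singleton_swap) auto
    finally show ?thesis by simp
  qed
  then show "\<one>\<^bsub>F\<^esub> \<otimes>\<^bsub>F\<^esub> f = f" by (simp add: F_simps(5,6))
  have "(\<Oplus>\<^bsub>K\<^esub>i\<in>{..length w}. f (take i w) \<otimes>\<^bsub>K\<^esub> word K [] (drop i w)) = f w" for w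
  proof -
    have "(\<Oplus>\<^bsub>K\<^esub>i\<in>{..length w}. f (take i w) \<otimes>\<^bsub>K\<^esub> word K [] (drop i w))
      = (\<Oplus>\<^bsub>K\<^esub>i\<in>{..length w}. if i = length w then f (take i w) else \<zero>\<^bsub>K\<^esub>)"
      using f by (intro K.finsum_cong') (auto simp: word_def)
    also have "\<dots> = f (take (length w) w)" using f by (intro K.add.finprod_singleton_swap) auto
    finally show ?thesis by simp
  qed
  then show "f \<otimes>\<^bsub>F\<^esub> \<one>\<^bsub>F\<^esub> = f" by (simp add: F_simps(5,6))
qed

lemma mult_add:
  assumes f: "f \<in> carrier F" and g: "g \<in> carrier F" and h: "h \<in> carrier F"
  shows "(f \<oplus>\<^bsub>F\<^esub> g) \<otimes>\<^bsub>F\<^esub> h = f \<otimes>\<^bsub>F\<^esub> h \<oplus>\<^bsub>F\<^esub> g \<otimes>\<^bsub>F\<^esub> h"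
    and "h \<otimes>\<^bsub>F\<^esub> (f \<oplus>\<^bsub>F\<^esub> g) = h \<otimes>\<^bsub>F\<^esub> f \<oplus>\<^bsub>F\<^esub> h \<otimes>\<^bsub>F\<^esub> g"
proof -
  have c: "(\<lambda>i. p (take i w) \<otimes>\<^bsub>K\<^esub> q (drop i w)) \<in> {..length w} \<rightarrow> carrier K"
    if "p \<in> carrier F" "q \<in> carrier F" for p q w
    using that by auto
  show "(f \<oplus>\<^bsub>F\<^esub> g) \<otimes>\<^bsub>F\<^esub> h = f \<otimes>\<^bsub>F\<^esub> h \<oplus>\<^bsub>F\<^esub> g \<otimes>\<^bsub>F\<^esub> h"
  proof
    fix w
    show "((f \<oplus>\<^bsub>F\<^esub> g) \<otimes>\<^bsub>F\<^esub> h) w = (f \<otimes>\<^bsub>F\<^esub> h \<oplus>\<^bsub>F\<^esub> g \<otimes>\<^bsub>F\<^esub> h) w"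
      unfolding F_simps(3,6) K.finsum_addf[OF c[OF f h] c[OF g h], symmetric]
      using f g h by (intro K.finsum_cong') (auto simp: K.l_distr)
  qed
  show "h \<otimes>\<^bsub>F\<^esub> (f \<oplus>\<^bsub>F\<^esub> g) = h \<otimes>\<^bsub>F\<^esub> f \<oplus>\<^bsub>F\<^esub> h \<otimes>\<^bsub>F\<^esub> g"
  proof
    fix w
    show "(h \<otimes>\<^bsub>F\<^esub> (f \<oplus>\<^bsub>F\<^esub> g)) w = (h \<otimes>\<^bsub>F\<^esub> f \<oplus>\<^bsub>F\<^esub> h \<otimes>\<^bsub>F\<^esub> g) w"
      unfolding F_simps(3,6) K.finsum_addf[OF c[OF h f] c[OF h g], symmetric]
      using f g h by (intro K.finsum_cong') (auto simp: K.r_distr)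
  qed
qed

lemma smult_mult:
  assumes k: "k \<in> carrier K" and f: "f \<in> carrier F" and g: "g \<in> carrier F"
  shows "(k \<odot>\<^bsub>F\<^esub> f) \<otimes>\<^bsub>F\<^esub> g = k \<odot>\<^bsub>F\<^esub> (f \<otimes>\<^bsub>F\<^esub> g)"
proof
  fix w
  have "(\<Oplus>\<^bsub>K\<^esub>i\<in>{..length w}. k \<otimes>\<^bsub>K\<^esub> (f (take i w) \<otimes>\<^bsub>K\<^esub> g (drop i w)))
    = k \<otimes>\<^bsub>K\<^esub> (\<Oplus>\<^bsub>K\<^esub>i\<in>{..length w}. f (take i w) \<otimes>\<^bsub>K\<^esub> g (drop i w))"
    using f g k by (subst K.finsum_rdistr) auto
  then show "((k \<odot>\<^bsub>F\<^esub> f) \<otimes>\<^bsub>F\<^esub> g) w = (k \<odot>\<^bsub>F\<^esub> (f \<otimes>\<^bsub>F\<^esub> g)) w"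
    using f g k by (simp add: F_simps(4,6) K.m_assoc)
qed

lemma F_ring: "ring F"
proof (rule ringI)
  show "abelian_group F" using F_module by (rule module.axioms(2))
  show "Group.monoid F"
    by (rule Group.monoidI) (auto simp: mult_mem mult_assoc one_mult, simp add: F_simps(5) word_mem)
qed (auto simp: mult_add)

lemma gen_mult:
  assumes g: "g \<in> carrier F" and \<alpha>: "\<alpha> \<in> E"
  shows "(free_gen K \<alpha> \<otimes>\<^bsub>F\<^esub> g) w = (if w \<noteq> [] \<and> hd w = \<alpha> then g (tl w) else \<zero>\<^bsub>K\<^esub>)"
proof -
  have "(\<Oplus>\<^bsub>K\<^esub>i\<in>{..length w}. free_gen K \<alpha> (take i w) \<otimes>\<^bsub>K\<^esub> g (drop i w))
    = (\<Oplus>\<^bsub>K\<^esub>i\<in>{..length w}. if i = 1 then (if w \<noteq> [] \<and> hd w = \<alpha> then g (tl w) else \<zero>\<^bsub>K\<^esub>) else \<zero>\<^bsub>K\<^esub>)"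
  proof (rule K.finsum_cong'[OF refl])
    fix i assume i: "i \<in> {..length w}"
    have "take i w = [\<alpha>] \<longleftrightarrow> i = 1 \<and> w \<noteq> [] \<and> hd w = \<alpha>"
      using i by (cases w; cases i) auto
    then show "free_gen K \<alpha> (take i w) \<otimes>\<^bsub>K\<^esub> g (drop i w) =
      (if i = 1 then (if w \<noteq> [] \<and> hd w = \<alpha> then g (tl w) else \<zero>\<^bsub>K\<^esub>) else \<zero>\<^bsub>K\<^esub>)"
      using g by (auto simp: free_gen_def drop_Suc)
  qed (use g in auto)
  also have "\<dots> = (if w \<noteq> [] \<and> hd w = \<alpha> then g (tl w) else \<zero>\<^bsub>K\<^esub>)"
  proof (cases "w = []")
    case True
    then show ?thesis by (auto intro!: K.add.finprod_one_eqI)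
  next
    case False
    then have "1 \<in> {..length w}" by (cases w) auto
    then show ?thesis using g by (intro K.add.finprod_singleton_swap) auto
  qed
  finally show ?thesis by (simp add: F_simps(6))
qed

text \<open>Elements are finite linear combinations of words, and words are products of generators.\<close>

lemma free_algebra_induct [consumes 1, case_names one gen add smult mult]:
  assumes f: "f \<in> carrier F"
    and one: "P \<one>\<^bsub>F\<^esub>"
    and gen: "\<And>\<alpha>. \<alpha> \<in> E \<Longrightarrow> P (free_gen K \<alpha>)"
    and add: "\<And>f g. f \<in> carrier F \<Longrightarrow> g \<in> carrier F \<Longrightarrow> P f \<Longrightarrow> P g \<Longrightarrow> P (f \<oplus>\<^bsub>F\<^esub> g)"
    and smult: "\<And>k f. k \<in> carrier K \<Longrightarrow> f \<in> carrier F \<Longrightarrow> P f \<Longrightarrow> P (k \<odot>\<^bsub>F\<^esub> f)"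
    and mult: "\<And>f g. f \<in> carrier F \<Longrightarrow> g \<in> carrier F \<Longrightarrow> P f \<Longrightarrow> P g \<Longrightarrow> P (f \<otimes>\<^bsub>F\<^esub> g)"
  shows "P f"
proof -
  have words: "P (word K w)" if "w \<in> lists E" for w
    using that
  proof (induction w)
    case Nil
    then show ?case using one by (simp add: F_simps(5))
  next
    case (Cons \<alpha> w)
    then have \<alpha>: "\<alpha> \<in> E" and w: "word K w \<in> carrier F" using word_mem by auto
    have "word K (\<alpha> # w) = free_gen K \<alpha> \<otimes>\<^bsub>F\<^esub> word K w"
    proof
      fix u show "word K (\<alpha> # w) u = (free_gen K \<alpha> \<otimes>\<^bsub>F\<^esub> word K w) u"
        unfolding gen_mult[OF w \<alpha>] by (cases u) (auto simp: word_def)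
    qed
    then show ?case using mult[OF gen_mem[OF \<alpha>] w gen[OF \<alpha>]] Cons by simp
  qed
  have "\<forall>f. f \<in> carrier F \<and> supp f \<subseteq> S \<longrightarrow> P f" if "finite S" "S \<subseteq> lists E" for S
    using that
  proof (induction S rule: finite_induct)
    case empty
    have "P f" if "f \<in> carrier F" "supp f \<subseteq> {}" for f
    proof -
      have "f = \<zero>\<^bsub>K\<^esub> \<odot>\<^bsub>F\<^esub> \<one>\<^bsub>F\<^esub>" using that(2) by (auto simp: F_simps(4,5) support_def word_def)
      then show ?thesis using smult[OF K.zero_closed word_mem[of "[]"]] one by (simp add: F_simps(5))
    qed
    then show ?case by blast
  next
    case (insert w S)
    have "P f" if f: "f \<in> carrier F" "supp f \<subseteq> insert w S" for f
    proof -
      let ?g = "f(w := \<zero>\<^bsub>K\<^esub>)"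
      have g: "?g \<in> carrier F" "supp ?g \<subseteq> S"
        using f by (auto simp: F_simps(1) support_def intro: finite_subset)
      have w: "word K w \<in> carrier F" "P (word K w)" using insert.prems words word_mem by auto
      have "f = (f w \<odot>\<^bsub>F\<^esub> word K w) \<oplus>\<^bsub>F\<^esub> ?g"
        using f(1) by (auto simp: F_simps(3,4) word_def)
      moreover have "P ?g" using insert g by auto
      ultimately show ?thesis
        using add[OF smult_mem g(1)] smult[OF _ w] w f(1) by (metis F_coeff)
    qed
    then show ?case by blast
  qed
  then show ?thesis using f unfolding F_simps(1) by blast
qed

end

locale word_action = words K E + V: module K V
  for K :: "('k, 'a) ring_scheme" and E :: "'e set" and V :: "('k, 'v, 'c) module_scheme" +
  fixes T :: "'e \<Rightarrow> 'v \<Rightarrow> 'v"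
  assumes T_linear: "\<And>\<alpha>. \<alpha> \<in> E \<Longrightarrow> linear_map K V V (T \<alpha>)"
begin

abbreviation act :: "('e list \<Rightarrow> 'k) \<Rightarrow> 'v \<Rightarrow> 'v" where "act \<equiv> word_act K V T"

lemma V_mod: "module K V" ..

lemma foldr_linear: "w \<in> lists E \<Longrightarrow> linear_map K V V (foldr T w)"
proof (induction w)
  case (Cons \<alpha> w)
  then show ?case using linear_map_comp[OF _ T_linear[of \<alpha>]] by (simp add: comp_def)
qed (auto intro: linear_mapI)

lemma foldr_closed: "w \<in> lists E \<Longrightarrow> v \<in> carrier V \<Longrightarrow> foldr T w v \<in> carrier V"
  using linear_mapD(1)[OF foldr_linear] .

lemma act_superset:
  assumes "f \<in> carrier F" "v \<in> carrier V" "supp f \<subseteq> S" "finite S" "S \<subseteq> lists E"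
  shows "act f v = (\<Oplus>\<^bsub>V\<^esub>w\<in>S. f w \<odot>\<^bsub>V\<^esub> foldr T w v)"
proof -
  have "foldr T w v \<in> carrier V" if "w \<in> S" for w using foldr_closed assms that by blast
  then show ?thesis
    unfolding word_act_def using assms
    by (intro V.M.add.finprod_mono_neutral_cong_left) (auto simp: support_def)
qed

lemma foldr_supp: "f \<in> carrier F \<Longrightarrow> v \<in> carrier V \<Longrightarrow> w \<in> supp f \<Longrightarrow> foldr T w v \<in> carrier V"
  using foldr_closed unfolding F_simps(1) by blast

lemma act_closed:
  assumes "f \<in> carrier F" "v \<in> carrier V"
  shows "act f v \<in> carrier V"
  unfolding word_act_def using assms foldr_supp
  by (intro V.M.finsum_closed) auto

lemma act_add:
  assumes "f \<in> carrier F" "g \<in> carrier F" "v \<in> carrier V"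
  shows "act (f \<oplus>\<^bsub>F\<^esub> g) v = act f v \<oplus>\<^bsub>V\<^esub> act g v"
proof -
  let ?S = "supp f \<union> supp g"
  have S: "finite ?S" "?S \<subseteq> lists E" "supp (f \<oplus>\<^bsub>F\<^esub> g) \<subseteq> ?S"
    using assms by (auto simp: F_simps(1,3) support_def)
  have c: "(\<lambda>w. f w \<odot>\<^bsub>V\<^esub> foldr T w v) \<in> ?S \<rightarrow> carrier V" "(\<lambda>w. g w \<odot>\<^bsub>V\<^esub> foldr T w v) \<in> ?S \<rightarrow> carrier V"
    using assms foldr_supp by (auto intro!: V.smult_closed)
  have "act (f \<oplus>\<^bsub>F\<^esub> g) v = (\<Oplus>\<^bsub>V\<^esub>w\<in>?S. (f w \<odot>\<^bsub>V\<^esub> foldr T w v) \<oplus>\<^bsub>V\<^esub> (g w \<odot>\<^bsub>V\<^esub> foldr T w v))"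
    unfolding act_superset[OF add_mem[OF assms(1,2)] assms(3) S(3,1,2)]
    using assms S(2) foldr_supp c
    by (intro V.M.finsum_cong') (auto simp: F_simps(3) Pi_iff intro!: V.smult_l_distr)
  also have "\<dots> = act f v \<oplus>\<^bsub>V\<^esub> act g v"
    using V.M.finsum_addf[OF c] act_superset[OF assms(1,3) _ S(1,2)] act_superset[OF assms(2,3) _ S(1,2)] by simp
  finally show ?thesis .
qed

lemma act_smult:
  assumes "k \<in> carrier K" "f \<in> carrier F" "v \<in> carrier V"
  shows "act (k \<odot>\<^bsub>F\<^esub> f) v = k \<odot>\<^bsub>V\<^esub> act f v"
proof -
  have S: "finite (supp f)" "supp f \<subseteq> lists E" "supp (k \<odot>\<^bsub>F\<^esub> f) \<subseteq> supp f"
    using assms by (auto simp: F_simps(1,4) support_def)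
  have c: "(\<lambda>w. f w \<odot>\<^bsub>V\<^esub> foldr T w v) \<in> supp f \<rightarrow> carrier V"
    using assms foldr_supp by (auto intro!: V.smult_closed)
  have "act (k \<odot>\<^bsub>F\<^esub> f) v = (\<Oplus>\<^bsub>V\<^esub>w\<in>supp f. k \<odot>\<^bsub>V\<^esub> (f w \<odot>\<^bsub>V\<^esub> foldr T w v))"
    unfolding act_superset[OF smult_mem[OF assms(1,2)] assms(3) S(3,1,2)]
    using assms S(2) foldr_supp c
    by (intro V.M.finsum_cong') (auto simp: F_simps(4) Pi_iff intro!: V.smult_assoc1)
  then show ?thesis
    using V.finsum_smult_ldistr[OF S(1) assms(1) c] by (simp add: word_act_def)
qed

lemma act_linear:
  assumes f: "f \<in> carrier F"
  shows "linear_map K V V (act f)"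
proof (rule linear_mapI)
  have S: "finite (supp f)" "supp f \<subseteq> lists E" using f by (auto simp: F_simps(1))
  have c: "(\<lambda>w. f w \<odot>\<^bsub>V\<^esub> foldr T w v) \<in> supp f \<rightarrow> carrier V" if "v \<in> carrier V" for v
    using f foldr_supp that by (auto intro!: V.smult_closed)
  show "act f v \<in> carrier V" if "v \<in> carrier V" for v using act_closed[OF f that] .
  show "act f (v \<oplus>\<^bsub>V\<^esub> u) = act f v \<oplus>\<^bsub>V\<^esub> act f u" if "v \<in> carrier V" "u \<in> carrier V" for v u
    unfolding word_act_def V.M.finsum_addf[OF c[OF that(1)] c[OF that(2)], symmetric]
    using f foldr_supp[OF f] that c S(2)
    by (intro V.M.finsum_cong') (auto simp: linear_mapD(2)[OF foldr_linear] V.smult_r_distr subset_iff Pi_iff)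
  show "act f (k \<odot>\<^bsub>V\<^esub> v) = k \<odot>\<^bsub>V\<^esub> act f v" if "k \<in> carrier K" "v \<in> carrier V" for k v
    unfolding word_act_def V.finsum_smult_ldistr[OF S(1) that(1) c[OF that(2)]]
    using f foldr_supp[OF f] that c S(2)
    by (intro V.M.finsum_cong')
      (auto simp: linear_mapD(3)[OF foldr_linear] subset_iff Pi_iff V.smult_assoc1[symmetric] K.m_comm)
qed

lemma act_word:
  assumes "w \<in> lists E" "v \<in> carrier V"
  shows "act (word K w) v = foldr T w v"
proof -
  have "act (word K w) v = (\<Oplus>\<^bsub>V\<^esub>u\<in>{w}. word K w u \<odot>\<^bsub>V\<^esub> foldr T u v)"
    using assms by (intro act_superset word_mem) (auto simp: word_def support_def)
  then show ?thesis using assms foldr_closed by (simp add: word_def)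
qed

lemma act_one: "v \<in> carrier V \<Longrightarrow> act \<one>\<^bsub>F\<^esub> v = v"
  using act_word[of "[]"] by (simp add: F_simps(5))

lemma act_gen: "\<alpha> \<in> E \<Longrightarrow> v \<in> carrier V \<Longrightarrow> act (free_gen K \<alpha>) v = T \<alpha> v"
  using act_word[of "[\<alpha>]"] by (simp add: free_gen_word)

lemma act_gen_mult:
  assumes \<alpha>: "\<alpha> \<in> E" and g: "g \<in> carrier F" and v: "v \<in> carrier V"
  shows "act (free_gen K \<alpha> \<otimes>\<^bsub>F\<^esub> g) v = T \<alpha> (act g v)"
proof -
  let ?f = "free_gen K \<alpha> \<otimes>\<^bsub>F\<^esub> g"
  have S: "finite (supp g)" "supp g \<subseteq> lists E" using g by (auto simp: F_simps(1))
  have c: "(\<lambda>w. g w \<odot>\<^bsub>V\<^esub> foldr T w v) \<in> supp g \<rightarrow> carrier V"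
    using g foldr_supp v by (auto intro!: V.smult_closed)
  have "supp ?f \<subseteq> (#) \<alpha> ` supp g"
  proof
    fix w assume "w \<in> supp ?f"
    then show "w \<in> (#) \<alpha> ` supp g"
      unfolding support_def by (cases w) (auto simp: gen_mult[OF g \<alpha>] split: if_splits)
  qed
  then have "act ?f v = (\<Oplus>\<^bsub>V\<^esub>w\<in>(#) \<alpha> ` supp g. ?f w \<odot>\<^bsub>V\<^esub> foldr T w v)"
    using S \<alpha> by (intro act_superset mult_mem gen_mem g v) (auto dest!: subsetD[OF S(2)])
  also have "\<dots> = (\<Oplus>\<^bsub>V\<^esub>w\<in>supp g. ?f (\<alpha> # w) \<odot>\<^bsub>V\<^esub> foldr T (\<alpha> # w) v)"
    using S(2) \<alpha> g v foldr_supp linear_mapD(1)[OF T_linear[OF \<alpha>]]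
    by (intro V.M.finsum_reindex) (auto simp: gen_mult[OF g \<alpha>] intro!: V.smult_closed)
  also have "\<dots> = (\<Oplus>\<^bsub>V\<^esub>w\<in>supp g. T \<alpha> (g w \<odot>\<^bsub>V\<^esub> foldr T w v))"
    using S(2) g v foldr_supp linear_mapD(1)[OF T_linear[OF \<alpha>]] c
    by (intro V.M.finsum_cong') (auto simp: gen_mult[OF g \<alpha>] linear_mapD(3)[OF T_linear[OF \<alpha>]] subset_iff Pi_iff)
  also have "\<dots> = T \<alpha> (act g v)"
    unfolding word_act_def using linear_map_finsum[OF V_mod V_mod T_linear[OF \<alpha>] S(1) c] by simp
  finally show ?thesis .
qed

text \<open>By induction over the left factor, the only computation is the one for generators, where
  multiplication prepends a letter to every word.\<close>

lemma act_mult: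
  assumes "f \<in> carrier F" "g \<in> carrier F" "v \<in> carrier V"
  shows "act (f \<otimes>\<^bsub>F\<^esub> g) v = act f (act g v)"
  using assms
proof (induction f arbitrary: g v rule: free_algebra_induct)
  case one
  then show ?case by (simp add: one_mult act_one act_closed)
next
  case (gen \<alpha>)
  then show ?case by (simp add: act_gen_mult act_gen act_closed)
next
  case (add f h)
  then show ?case by (simp add: mult_add act_add mult_mem act_closed)
next
  case (smult k f)
  then show ?case by (simp add: smult_mult act_smult mult_mem act_closed)
next
  case (mult f h)
  then show ?case by (simp add: mult_assoc mult_mem act_closed)
qed

end

context words
begin

abbreviation I :: "('e list \<Rightarrow> 'k) set" where "I \<equiv> halo_ideal K E"
abbreviation B :: "('k, ('e list \<Rightarrow> 'k) set) module" where "B \<equiv> halo_algebra K E"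

lemma relations_in_F:
  "{free_gen K \<alpha> \<otimes>\<^bsub>F\<^esub> free_gen K \<beta> \<ominus>\<^bsub>F\<^esub> free_gen K \<alpha> | \<alpha> \<beta>. \<alpha> \<in> E \<and> \<beta> \<in> E} \<subseteq> carrier F"
proof -
  interpret F: module K F by (rule F_module)
  show ?thesis using mult_mem gen_mem by auto
qed

lemma I_ideal: "ideal I F"
  unfolding halo_ideal_def by (rule ring.genideal_ideal[OF F_ring relations_in_F])

lemma I_submodule: "submodule I K F"
proof -
  interpret I: ideal I F by (rule I_ideal)
  show ?thesis
  proof (rule submodule_by_closure[OF F_module I.a_subset])
    fix k x assume k: "k \<in> carrier K" and x: "x \<in> I"
    have xF: "x \<in> carrier F" by (rule I.a_Hcarr[OF x])
    have "(k \<odot>\<^bsub>F\<^esub> \<one>\<^bsub>F\<^esub>) \<otimes>\<^bsub>F\<^esub> x \<in> I"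
      using k by (intro I.I_l_closed[OF x] smult_mem) auto
    then show "k \<odot>\<^bsub>F\<^esub> x \<in> I" using k xF by (simp add: smult_mult one_mult)
  qed auto
qed

abbreviation cls :: "('e list \<Rightarrow> 'k) \<Rightarrow> ('e list \<Rightarrow> 'k) set" where "cls f \<equiv> I +>\<^bsub>F\<^esub> f"

lemma B_simps:
  "carrier B = cls ` carrier F"
  "\<one>\<^bsub>B\<^esub> = cls \<one>\<^bsub>F\<^esub>"
  "f \<in> carrier F \<Longrightarrow> g \<in> carrier F \<Longrightarrow> cls f \<otimes>\<^bsub>B\<^esub> cls g = cls (f \<otimes>\<^bsub>F\<^esub> g)"
  "f \<in> carrier F \<Longrightarrow> g \<in> carrier F \<Longrightarrow> cls f \<oplus>\<^bsub>B\<^esub> cls g = cls (f \<oplus>\<^bsub>F\<^esub> g)"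
  "k \<in> carrier K \<Longrightarrow> f \<in> carrier F \<Longrightarrow> k \<odot>\<^bsub>B\<^esub> cls f = cls (k \<odot>\<^bsub>F\<^esub> f)"
proof -
  interpret I: ideal I F by (rule I_ideal)
  have e: "carrier B = carrier (F Quot I)" "\<one>\<^bsub>B\<^esub> = \<one>\<^bsub>F Quot I\<^esub>" "monoid.mult B = monoid.mult (F Quot I)"
    "add B = add (F Quot I)" "smult B = (\<lambda>k Y. \<Union>f\<in>Y. cls (k \<odot>\<^bsub>F\<^esub> f))"
    by (simp_all add: halo_algebra_def ring.defs module.defs)
  show "carrier B = cls ` carrier F" unfolding e by (auto simp: FactRing_simps)
  show "\<one>\<^bsub>B\<^esub> = cls \<one>\<^bsub>F\<^esub>" unfolding e by (simp add: FactRing_def)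
  show "f \<in> carrier F \<Longrightarrow> g \<in> carrier F \<Longrightarrow> cls f \<otimes>\<^bsub>B\<^esub> cls g = cls (f \<otimes>\<^bsub>F\<^esub> g)"
    unfolding e by (simp add: FactRing_def I.rcoset_mult_add)
  show "f \<in> carrier F \<Longrightarrow> g \<in> carrier F \<Longrightarrow> cls f \<oplus>\<^bsub>B\<^esub> cls g = cls (f \<oplus>\<^bsub>F\<^esub> g)"
    unfolding e by (simp add: FactRing_def I.a_rcos_sum)
  show "k \<in> carrier K \<Longrightarrow> f \<in> carrier F \<Longrightarrow> k \<odot>\<^bsub>B\<^esub> cls f = cls (k \<odot>\<^bsub>F\<^esub> f)"
    unfolding e by (rule coset_smult[OF F_module I_submodule])
qed

lemma algebra_moduleD:
  assumes "algebra_module K B A"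
  shows "module K A" "f \<in> carrier F \<Longrightarrow> linear_map K A A (opr A (cls f))"
    "v \<in> carrier A \<Longrightarrow> opr A (cls \<one>\<^bsub>F\<^esub>) v = v"
    "f \<in> carrier F \<Longrightarrow> g \<in> carrier F \<Longrightarrow> v \<in> carrier A \<Longrightarrow>
      opr A (cls (f \<otimes>\<^bsub>F\<^esub> g)) v = opr A (cls f) (opr A (cls g) v)"
    "f \<in> carrier F \<Longrightarrow> g \<in> carrier F \<Longrightarrow> v \<in> carrier A \<Longrightarrow>
      opr A (cls (f \<oplus>\<^bsub>F\<^esub> g)) v = opr A (cls f) v \<oplus>\<^bsub>A\<^esub> opr A (cls g) v"
    "k \<in> carrier K \<Longrightarrow> f \<in> carrier F \<Longrightarrow> v \<in> carrier A \<Longrightarrow>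
      opr A (cls (k \<odot>\<^bsub>F\<^esub> f)) v = k \<odot>\<^bsub>A\<^esub> opr A (cls f) v"
  using assms unfolding algebra_module_def by (auto simp: B_simps)

text \<open>The halo algebra is generated by the classes of the generators, so linear maps need only
  be tested on these.\<close>

lemma equivariant_by_generators:
  assumes A: "algebra_module K B A" and A': "algebra_module K B A'" and h: "linear_map K A A' h"
    and gens: "\<And>\<alpha> v. \<alpha> \<in> E \<Longrightarrow> v \<in> carrier A \<Longrightarrow>
      h (opr A (cls (free_gen K \<alpha>)) v) = opr A' (cls (free_gen K \<alpha>)) (h v)"
  shows "equivariant_map K (carrier B) A A' h"
proof -
  note A = algebra_moduleD[OF A] and A' = algebra_moduleD[OF A'] and h = linear_mapD[OF h]
  have c: "opr A (cls f) v \<in> carrier A" if "f \<in> carrier F" "v \<in> carrier A" for f v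
    using linear_mapD(1)[OF A(2)[OF that(1)] that(2)] .
  have "h (opr A (cls f) v) = opr A' (cls f) (h v)" if "f \<in> carrier F" "v \<in> carrier A" for f v
    using that
  proof (induction f arbitrary: v rule: free_algebra_induct)
    case one
    then show ?case by (simp add: A(3) A'(3) h(1))
  next
    case (add f g)
    then show ?case by (simp add: A(5) A'(5) h(1,2) c)
  next
    case (smult k f)
    then show ?case by (simp add: A(6) A'(6) h(1,3) c)
  next
    case (mult f g)
    then show ?case by (simp add: A(4) A'(4) h(1) c)
  qed (simp add: gens)
  then show ?thesis using assms(3) by (auto simp: equivariant_map_def B_simps(1))
qed

lemma gen_relation:
  assumes A: "algebra_module K B A" and "\<alpha> \<in> E" "\<beta> \<in> E" "v \<in> carrier A"
  shows "opr A (cls (free_gen K \<alpha>)) (opr A (cls (free_gen K \<beta>)) v) = opr A (cls (free_gen K \<alpha>)) v"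
proof -
  have "free_gen K \<alpha> \<otimes>\<^bsub>F\<^esub> free_gen K \<beta> \<ominus>\<^bsub>F\<^esub> free_gen K \<alpha> \<in> I"
    unfolding halo_ideal_def using ring.genideal_self[OF F_ring relations_in_F] assms(2,3) by blast
  then have "cls (free_gen K \<alpha> \<otimes>\<^bsub>F\<^esub> free_gen K \<beta>) = cls (free_gen K \<alpha>)"
    using coset_eq_iff[OF F_module I_submodule] mult_mem gen_mem assms(2,3) by simp
  then show ?thesis using algebra_moduleD(4)[OF A] gen_mem assms(2-4) by metis
qed

end

locale halo_action = word_action K E V T
  for K :: "('k, 'a) ring_scheme" and E :: "'e set" and V :: "('k, 'v, 'c) module_scheme" and T +
  assumes T_T: "\<And>\<alpha> \<beta> v. \<alpha> \<in> E \<Longrightarrow> \<beta> \<in> E \<Longrightarrow> v \<in> carrier V \<Longrightarrow> T \<alpha> (T \<beta> v) = T \<alpha> v"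
begin

text \<open>The elements that act as zero form an ideal, since the action is multiplicative, and they
  contain the defining relations of the halo algebra.\<close>

lemma act_ideal:
  assumes f: "f \<in> I" and v: "v \<in> carrier V"
  shows "act f v = \<zero>\<^bsub>V\<^esub>"
proof -
  interpret F: module K F by (rule F_module)
  let ?N = "{f \<in> carrier F. \<forall>v\<in>carrier V. act f v = \<zero>\<^bsub>V\<^esub>}"
  have act0: "act f \<zero>\<^bsub>V\<^esub> = \<zero>\<^bsub>V\<^esub>" if "f \<in> carrier F" for f
    by (rule linear_map_zero[OF V_mod V_mod act_linear[OF that]])
  have N: "submodule ?N K F"
  proof (rule submodule_by_closure[OF F_module])
    show "\<zero>\<^bsub>F\<^esub> \<in> ?N"
      using act_smult[OF K.zero_closed zero_mem] act_closed[OF zero_mem] by (simp add: zero_mem)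
  qed (auto simp: act_add act_smult add_mem smult_mem)
  have "ideal ?N F"
  proof (rule idealI[OF F_ring submodule.axioms(1)[OF N]])
    fix a x assume a: "a \<in> ?N" and x: "x \<in> carrier F"
    show "x \<otimes>\<^bsub>F\<^esub> a \<in> ?N" using a x by (auto simp: mult_mem act_mult act0)
    show "a \<otimes>\<^bsub>F\<^esub> x \<in> ?N" using a x by (auto simp: mult_mem act_mult act_closed)
  qed
  moreover have "free_gen K \<alpha> \<otimes>\<^bsub>F\<^esub> free_gen K \<beta> \<ominus>\<^bsub>F\<^esub> free_gen K \<alpha> \<in> ?N" if "\<alpha> \<in> E" "\<beta> \<in> E" for \<alpha> \<beta>
  proof -
    note g = gen_mem[OF that(1)] gen_mem[OF that(2)]
    have "act (free_gen K \<alpha> \<otimes>\<^bsub>F\<^esub> free_gen K \<beta> \<ominus>\<^bsub>F\<^esub> free_gen K \<alpha>) v = \<zero>\<^bsub>V\<^esub>" if v: "v \<in> carrier V" for v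
    proof -
      have "linear_map K F V (\<lambda>f. act f v)"
        by (rule linear_mapI) (auto simp: act_closed act_add act_smult v)
      then have "act (free_gen K \<alpha> \<otimes>\<^bsub>F\<^esub> free_gen K \<beta> \<ominus>\<^bsub>F\<^esub> free_gen K \<alpha>) v
        = act (free_gen K \<alpha> \<otimes>\<^bsub>F\<^esub> free_gen K \<beta>) v \<ominus>\<^bsub>V\<^esub> act (free_gen K \<alpha>) v"
        using linear_map_minus[OF F_module V_mod] mult_mem g by blast
      then show ?thesis
        using g v \<open>\<alpha> \<in> E\<close> \<open>\<beta> \<in> E\<close> linear_mapD(1)[OF T_linear]
        by (simp add: act_mult act_gen T_T V.M.minus_eq_zero_iff)
    qed
    then show ?thesis using g mult_mem by simp
  qed
  ultimately have "I \<subseteq> ?N"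
    unfolding halo_ideal_def by (intro ring.genideal_minimal[OF F_ring]) blast+
  then show ?thesis using f v by blast
qed

text \<open>The representatives of a class differ by elements that act as zero.\<close>

lemma act_class:
  assumes f: "f \<in> carrier F" and v: "v \<in> carrier V"
  shows "act (SOME g. g \<in> cls f) v = act f v"
proof -
  have "(SOME g. g \<in> cls f) \<in> cls f"
    by (rule someI[of "\<lambda>g. g \<in> cls f"]) (rule coset_self[OF F_module I_submodule f])
  then obtain b where "b \<in> I" "(SOME g. g \<in> cls f) = b \<oplus>\<^bsub>F\<^esub> f" unfolding coset_iff by blast
  then show ?thesis
    using act_ideal[OF _ v] submoduleD(1)[OF F_module I_submodule] f v act_closed[OF f v] by (simp add: act_add)
qed

lemma act_algebra_module:
  assumes A: "module K A" "carrier A = carrier V" "add A = add V" "smult A = smult V"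
    "opr A = (\<lambda>Y. act (SOME f. f \<in> Y))"
  shows "algebra_module K B A"
  unfolding algebra_module_def
  using A act_closed linear_mapD[OF act_linear]
  by (auto simp: B_simps act_class act_one act_mult act_add act_smult mult_mem add_mem smult_mem
      word_mem[of "[]", simplified, folded F_simps(5)] intro!: linear_mapI)

end

section \<open>Representations of the digroup\<close>

locale digroup_action = words K E + group_action G E \<phi>
  for K :: "('k, 'a) ring_scheme" and G :: "('g, 'b) monoid_scheme" (structure)
    and E :: "'e set" and \<phi> :: "'g \<Rightarrow> 'e \<Rightarrow> 'e" +
  assumes E_nonempty: "E \<noteq> {}"
begin

sublocale G: group G
  using group_hom by (rule group_hom.axioms(1))

lemma \<phi>_closed: "g \<in> carrier G \<Longrightarrow> \<alpha> \<in> E \<Longrightarrow> \<phi> g \<alpha> \<in> E"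
  using element_image by blast

lemma \<phi>_one: "\<alpha> \<in> E \<Longrightarrow> \<phi> \<one> \<alpha> = \<alpha>"
  using id_eq_one by (metis restrict_apply)

lemma \<phi>_inv:
  assumes "g \<in> carrier G" "\<alpha> \<in> E"
  shows "\<phi> (inv g) (\<phi> g \<alpha>) = \<alpha>" "\<phi> g (\<phi> (inv g) \<alpha>) = \<alpha>"
  using orbit_sym_aux[OF assms refl] orbit_sym_aux[OF G.inv_closed[OF assms(1)] assms(2) refl] assms by simp_all

abbreviation rep :: "('k, 'v, ('g \<times> 'e) rep_sym) opmod \<Rightarrow> bool"
  where "rep \<equiv> digroup_rep K G E \<phi>"

abbreviation eps :: "('k, 'v, ('g \<times> 'e) rep_sym) opmod \<Rightarrow> 'e \<Rightarrow> 'v \<Rightarrow> 'v"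
  where "eps V \<alpha> \<equiv> lam V (\<one>, \<alpha>)"

abbreviation rg :: "('k, 'v, ('g \<times> 'e) rep_sym) opmod \<Rightarrow> 'g \<Rightarrow> 'v \<Rightarrow> 'v"
  where "rg V \<equiv> rho_grp E V"

lemma base_point: "(SOME \<alpha>. \<alpha> \<in> E) \<in> E"
  using E_nonempty by (simp add: some_in_eq)

lemma rep_module: "rep V \<Longrightarrow> module K V"
  by (simp add: digroup_rep_def)

lemma rep_raw:
  assumes "rep V"
  shows "x \<in> digroup G E \<Longrightarrow> linear_map K V V (lam V x)"
    and "x \<in> digroup G E \<Longrightarrow> linear_map K V V (rho V x)"
    and "\<alpha> \<in> E \<Longrightarrow> v \<in> carrier V \<Longrightarrow> rho V (\<one>, \<alpha>) v = v"
    and "g \<in> carrier G \<Longrightarrow> \<alpha> \<in> E \<Longrightarrow> h \<in> carrier G \<Longrightarrow> \<beta> \<in> E \<Longrightarrow> v \<in> carrier V \<Longrightarrow>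
      lam V (g \<otimes> h, \<alpha>) v = lam V (g, \<alpha>) (lam V (h, \<beta>) v)"
    and "g \<in> carrier G \<Longrightarrow> \<alpha> \<in> E \<Longrightarrow> h \<in> carrier G \<Longrightarrow> \<beta> \<in> E \<Longrightarrow> v \<in> carrier V \<Longrightarrow>
      rho V (g \<otimes> h, \<phi> g \<beta>) v = rho V (g, \<alpha>) (rho V (h, \<beta>) v)"
    and "g \<in> carrier G \<Longrightarrow> \<alpha> \<in> E \<Longrightarrow> h \<in> carrier G \<Longrightarrow> \<beta> \<in> E \<Longrightarrow> v \<in> carrier V \<Longrightarrow>
      rho V (g, \<alpha>) (lam V (h, \<beta>) v) = lam V (g \<otimes> h, \<phi> g \<beta>) v"
    and "g \<in> carrier G \<Longrightarrow> \<alpha> \<in> E \<Longrightarrow> h \<in> carrier G \<Longrightarrow> \<beta> \<in> E \<Longrightarrow> v \<in> carrier V \<Longrightarrow>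
      lam V (g, \<alpha>) (rho V (h, \<beta>) v) = lam V (g \<otimes> h, \<alpha>) v"
proof -
  show "x \<in> digroup G E \<Longrightarrow> linear_map K V V (lam V x)" "x \<in> digroup G E \<Longrightarrow> linear_map K V V (rho V x)"
    "\<alpha> \<in> E \<Longrightarrow> v \<in> carrier V \<Longrightarrow> rho V (\<one>, \<alpha>) v = v"
    using assms unfolding digroup_rep_def by auto
  have *: "\<forall>x\<in>digroup G E. \<forall>y\<in>digroup G E. \<forall>v\<in>carrier V.
      lam V (dg_dashv G x y) v = lam V x (lam V y v) \<and>
      rho V (dg_vdash G \<phi> x y) v = rho V x (rho V y v) \<and>
      rho V x (lam V y v) = lam V (dg_vdash G \<phi> x y) v \<and>
      lam V x (rho V y v) = lam V (dg_dashv G x y) v"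
    using assms unfolding digroup_rep_def by blast
  show "lam V (g \<otimes> h, \<alpha>) v = lam V (g, \<alpha>) (lam V (h, \<beta>) v)" "rho V (g \<otimes> h, \<phi> g \<beta>) v = rho V (g, \<alpha>) (rho V (h, \<beta>) v)" "rho V (g, \<alpha>) (lam V (h, \<beta>) v) = lam V (g \<otimes> h, \<phi> g \<beta>) v" "lam V (g, \<alpha>) (rho V (h, \<beta>) v) = lam V (g \<otimes> h, \<alpha>) v"
    if "g \<in> carrier G" "\<alpha> \<in> E" "h \<in> carrier G" "\<beta> \<in> E" "v \<in> carrier V"
    using *[rule_format, of "(g, \<alpha>)" "(h, \<beta>)" v] that by (simp_all add: dg_dashv_def dg_vdash_def)
qed

text \<open>The axioms give \<open>\<rho>(g, \<phi> g \<gamma>) = \<rho>(g, \<alpha>) \<rho>(1, \<gamma>) = \<rho>(g, \<alpha>)\<close>,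
  and \<open>\<phi> g\<close> is onto.\<close>

lemma rho_eq_rg:
  assumes V: "rep V" and "g \<in> carrier G" "\<alpha> \<in> E" "v \<in> carrier V"
  shows "rho V (g, \<alpha>) v = rg V g v"
proof -
  have "rho V (g, \<beta>) v = rho V (g, \<gamma>) v" if "\<beta> \<in> E" "\<gamma> \<in> E" for \<beta> \<gamma>
  proof -
    have i: "\<phi> (inv g) \<beta> \<in> E" using that assms(2) \<phi>_closed by simp
    from rep_raw(5)[OF V assms(2) that(2) G.one_closed i assms(4)]
    show ?thesis using rep_raw(3)[OF V i assms(4)] assms(2) that \<phi>_inv(2) by simp
  qed
  from this[OF assms(3) base_point] show ?thesis unfolding rho_grp_def .
qed

text \<open>A representation amounts to a representation of the group and idempotents
  \<open>\<epsilon>\<^sub>\<alpha>\<close> that it permutes, with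
  \<open>\<lambda>(g, \<alpha>) = \<epsilon>\<^sub>\<alpha> \<rho>\<^sub>g\<close>. The converse is \<open>repI\<close>.\<close>

lemma repD:
  assumes V: "rep V"
  shows "\<alpha> \<in> E \<Longrightarrow> linear_map K V V (eps V \<alpha>)"
    and "g \<in> carrier G \<Longrightarrow> linear_map K V V (rg V g)"
    and "v \<in> carrier V \<Longrightarrow> rg V \<one> v = v"
    and "g \<in> carrier G \<Longrightarrow> h \<in> carrier G \<Longrightarrow> v \<in> carrier V \<Longrightarrow> rg V (g \<otimes> h) v = rg V g (rg V h v)"
    and "\<alpha> \<in> E \<Longrightarrow> \<beta> \<in> E \<Longrightarrow> v \<in> carrier V \<Longrightarrow> eps V \<alpha> (eps V \<beta> v) = eps V \<alpha> v"
    and "g \<in> carrier G \<Longrightarrow> \<alpha> \<in> E \<Longrightarrow> v \<in> carrier V \<Longrightarrow> lam V (g, \<alpha>) v = eps V \<alpha> (rg V g v)"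
    and "g \<in> carrier G \<Longrightarrow> \<alpha> \<in> E \<Longrightarrow> v \<in> carrier V \<Longrightarrow> rg V g (eps V \<alpha> v) = eps V (\<phi> g \<alpha>) (rg V g v)"
proof -
  let ?a = "SOME \<alpha>. \<alpha> \<in> E"
  note a = base_point and raw = rep_raw[OF V]
  show l: "\<alpha> \<in> E \<Longrightarrow> linear_map K V V (eps V \<alpha>)" by (rule raw(1)) simp
  show r: "g \<in> carrier G \<Longrightarrow> linear_map K V V (rg V g)"
    unfolding rho_grp_def by (rule raw(2)) (simp add: a)
  show "v \<in> carrier V \<Longrightarrow> rg V \<one> v = v" unfolding rho_grp_def by (rule raw(3)[OF a])
  show "rg V (g \<otimes> h) v = rg V g (rg V h v)" if "g \<in> carrier G" "h \<in> carrier G" "v \<in> carrier V"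
    using raw(5)[OF that(1) a that(2) a that(3)] that
      rho_eq_rg[OF V _ \<phi>_closed[OF that(1) a] that(3), of "g \<otimes> h"]
    unfolding rho_grp_def by simp
  show "eps V \<alpha> (eps V \<beta> v) = eps V \<alpha> v" if "\<alpha> \<in> E" "\<beta> \<in> E" "v \<in> carrier V"
    using raw(4)[OF G.one_closed that(1) G.one_closed that(2,3)] by simp
  show lr: "lam V (g, \<alpha>) v = eps V \<alpha> (rg V g v)" if "g \<in> carrier G" "\<alpha> \<in> E" "v \<in> carrier V" for g \<alpha> v
    using raw(7)[OF G.one_closed that(2) that(1) a that(3)] that(1) unfolding rho_grp_def by simp
  show "rg V g (eps V \<alpha> v) = eps V (\<phi> g \<alpha>) (rg V g v)" if "g \<in> carrier G" "\<alpha> \<in> E" "v \<in> carrier V"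
    using raw(6)[OF that(1) a G.one_closed that(2,3)] lr[OF that(1) \<phi>_closed[OF that(1,2)] that(3)] that(1)
    unfolding rho_grp_def by simp
qed

lemma rg_closed: "rep V \<Longrightarrow> g \<in> carrier G \<Longrightarrow> v \<in> carrier V \<Longrightarrow> rg V g v \<in> carrier V"
  using linear_mapD(1)[OF repD(2)] .

lemma eps_closed: "rep V \<Longrightarrow> \<alpha> \<in> E \<Longrightarrow> v \<in> carrier V \<Longrightarrow> eps V \<alpha> v \<in> carrier V"
  using linear_mapD(1)[OF repD(1)] .

lemma rg_inv:
  assumes "rep V" "g \<in> carrier G" "v \<in> carrier V"
  shows "rg V (inv g) (rg V g v) = v" "rg V g (rg V (inv g) v) = v"
  using repD(4)[OF assms(1) _ assms(2,3), of "inv g"] repD(4)[OF assms(1,2) _ assms(3), of "inv g"]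
    repD(3)[OF assms(1,3)] assms(2) by simp_all

lemma rg_inv_into:
  assumes "rep V" "g \<in> carrier G" "v \<in> carrier V"
  shows "inv_into (carrier V) (rg V g) v = rg V (inv g) v"
proof (rule inv_into_f_eq)
  show "inj_on (rg V g) (carrier V)" using rg_inv(1)[OF assms(1,2)] by (rule inj_on_inverseI)
qed (use assms(2) rg_inv(2)[OF assms] rg_closed[OF assms(1) _ assms(3), of "inv g"] in simp_all)

lemma repI:
  assumes V: "module K V"
    and lam: "\<And>g \<alpha> v. g \<in> carrier G \<Longrightarrow> \<alpha> \<in> E \<Longrightarrow> v \<in> carrier V \<Longrightarrow> lam V (g, \<alpha>) v = e \<alpha> (r g v)"
    and rho: "\<And>g \<alpha> v. g \<in> carrier G \<Longrightarrow> \<alpha> \<in> E \<Longrightarrow> v \<in> carrier V \<Longrightarrow> rho V (g, \<alpha>) v = r g v"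
    and e: "\<And>\<alpha>. \<alpha> \<in> E \<Longrightarrow> linear_map K V V (e \<alpha>)"
    and r: "\<And>g. g \<in> carrier G \<Longrightarrow> linear_map K V V (r g)"
    and r_one: "\<And>v. v \<in> carrier V \<Longrightarrow> r \<one> v = v"
    and r_mult: "\<And>g h v. g \<in> carrier G \<Longrightarrow> h \<in> carrier G \<Longrightarrow> v \<in> carrier V \<Longrightarrow> r (g \<otimes> h) v = r g (r h v)"
    and e_e: "\<And>\<alpha> \<beta> v. \<alpha> \<in> E \<Longrightarrow> \<beta> \<in> E \<Longrightarrow> v \<in> carrier V \<Longrightarrow> e \<alpha> (e \<beta> v) = e \<alpha> v"
    and r_e: "\<And>g \<alpha> v. g \<in> carrier G \<Longrightarrow> \<alpha> \<in> E \<Longrightarrow> v \<in> carrier V \<Longrightarrow> r g (e \<alpha> v) = e (\<phi> g \<alpha>) (r g v)"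
  shows "rep V"
proof -
  note c = linear_mapD(1)[OF e] linear_mapD(1)[OF r]
  have p1: "linear_map K V V (lam V x)" if "x \<in> digroup G E" for x
    using that lam c e r
    by (cases x) (auto intro!: linear_mapI simp: linear_mapD[OF e] linear_mapD[OF r]
        module.axioms(2)[OF V, THEN abelian_groupE(1)] module.smult_closed[OF V])
  have p2: "linear_map K V V (rho V x)" if "x \<in> digroup G E" for x
    using that rho c r
    by (cases x) (auto intro!: linear_mapI simp: linear_mapD[OF r]
        module.axioms(2)[OF V, THEN abelian_groupE(1)] module.smult_closed[OF V])
  have p3: "bij_betw (rho V x) (carrier V) (carrier V)" if x: "x \<in> digroup G E" for x
  proof -
    obtain g \<alpha> where g: "g \<in> carrier G" "\<alpha> \<in> E" "x = (g, \<alpha>)" using x by auto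
    have "r (inv g) (r g v) = v" "r g (r (inv g) v) = v" if "v \<in> carrier V" for v
      using r_mult[of "inv g" g v] r_mult[of g "inv g" v] r_one that g(1) by simp_all
    then show ?thesis
      using g rho c by (intro bij_betw_byWitness[where f'="r (inv g)"]) auto
  qed
  have p4: "rho V x v = v" if "x \<in> halo G E" "v \<in> carrier V" for x v
    using that rho r_one by auto
  have p5: "lam V (dg_dashv G x y) v = lam V x (lam V y v) \<and>
      rho V (dg_vdash G \<phi> x y) v = rho V x (rho V y v) \<and>
      rho V x (lam V y v) = lam V (dg_vdash G \<phi> x y) v \<and>
      lam V x (rho V y v) = lam V (dg_dashv G x y) v"
    if x: "x \<in> digroup G E" and y: "y \<in> digroup G E" and v: "v \<in> carrier V" for x y v
  proof -
    obtain g \<alpha> h \<beta> where xy: "x = (g, \<alpha>)" "y = (h, \<beta>)"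
      and g: "g \<in> carrier G" "\<alpha> \<in> E" "h \<in> carrier G" "\<beta> \<in> E"
      using x y by auto
    note cl = g v \<phi>_closed[OF g(1,4)] G.m_closed[OF g(1,3)] c(2)[OF g(3) v] c(1)[OF g(4) c(2)[OF g(3) v]]
      c(2)[OF g(1) c(2)[OF g(3) v]]
    show ?thesis
      unfolding xy dg_dashv_def dg_vdash_def fst_conv snd_conv
      by (simp only: lam rho r_mult r_e e_e cl simp_thms)
  qed
  note p5' = p5[THEN conjunct2] and p5'' = p5[THEN conjunct2, THEN conjunct2]
  show ?thesis
    unfolding digroup_rep_def
    by (intro conjI ballI V p1 p2 p3 p4 p5[THEN conjunct1] p5'[THEN conjunct1]
        p5''[THEN conjunct1] p5''[THEN conjunct2])
qed

lemma rep_equivariant_iff: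
  assumes V: "rep V" and W: "rep W"
  shows "equivariant_map K (rep_syms G E) V W h \<longleftrightarrow> linear_map K V W h \<and>
    (\<forall>\<alpha>\<in>E. \<forall>v\<in>carrier V. h (eps V \<alpha> v) = eps W \<alpha> (h v)) \<and>
    (\<forall>g\<in>carrier G. \<forall>v\<in>carrier V. h (rg V g v) = rg W g (h v))"
proof
  assume e: "equivariant_map K (rep_syms G E) V W h"
  note h = equivariant_mapD[OF e]
  have "h (rg V g v) = rg W g (h v)" if "g \<in> carrier G" "v \<in> carrier V" for g v
    unfolding rho_grp_def using that base_point by (intro h(2)) (auto simp: rep_syms_def)
  moreover have "h (eps V \<alpha> v) = eps W \<alpha> (h v)" if "\<alpha> \<in> E" "v \<in> carrier V" for \<alpha> v
    using that by (intro h(2)) (auto simp: rep_syms_def)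
  ultimately show "linear_map K V W h \<and>
    (\<forall>\<alpha>\<in>E. \<forall>v\<in>carrier V. h (eps V \<alpha> v) = eps W \<alpha> (h v)) \<and>
    (\<forall>g\<in>carrier G. \<forall>v\<in>carrier V. h (rg V g v) = rg W g (h v))" using h(1) by blast
next
  assume a: "linear_map K V W h \<and>
    (\<forall>\<alpha>\<in>E. \<forall>v\<in>carrier V. h (eps V \<alpha> v) = eps W \<alpha> (h v)) \<and>
    (\<forall>g\<in>carrier G. \<forall>v\<in>carrier V. h (rg V g v) = rg W g (h v))"
  then have hc: "v \<in> carrier V \<Longrightarrow> h v \<in> carrier W" for v using linear_mapD(1)[of K V W h v] by blast
  show "equivariant_map K (rep_syms G E) V W h"
    unfolding equivariant_map_def using a
  proof (intro conjI ballI)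
    fix x v assume x: "x \<in> rep_syms G E" and v: "v \<in> carrier V"
    from x consider (l) g \<alpha> where "x = Lam (g, \<alpha>)" "g \<in> carrier G" "\<alpha> \<in> E"
      | (r) g \<alpha> where "x = Rho (g, \<alpha>)" "g \<in> carrier G" "\<alpha> \<in> E"
      by (auto simp: rep_syms_def)
    then show "h (opr V x v) = opr W x (h v)"
    proof cases
      case l
      show ?thesis
        unfolding l(1) repD(6)[OF V l(2,3) v] repD(6)[OF W l(2,3) hc[OF v]]
        using a l(2,3) v rg_closed[OF V l(2) v] by metis
    next
      case r
      show ?thesis
        unfolding r(1) rho_eq_rg[OF V r(2,3) v] rho_eq_rg[OF W r(2,3) hc[OF v]]
        using a r(2) v by metis
    qed
  qed (use a in blast)
qed

subsection \<open>The underlying modules over the halo algebra\<close>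

lemma rep_halo_action: "rep V \<Longrightarrow> halo_action K E V (eps V)"
  by (intro halo_action.intro word_action.intro words_axioms rep_module word_action_axioms.intro
      halo_action_axioms.intro repD(1,5))

lemma free_act_eq: "free_act K G V = word_act K V (eps V)"
  by (intro ext) (simp add: free_act_def word_act_def support_def)

lemma halo_module_simps [simp]:
  "carrier (halo_module K G V) = carrier V"
  "zero (halo_module K G V) = zero V"
  "add (halo_module K G V) = add V"
  "smult (halo_module K G V) = smult V"
  by (simp_all add: halo_module_def)

lemma halo_module_algebra_module:
  assumes "rep V"
  shows "algebra_module K B (halo_module K G V)"
proof -
  interpret halo_action K E V "eps V" by (rule rep_halo_action[OF assms])
  show ?thesis
    by (rule act_algebra_module)
      (auto simp: halo_module_def free_act_eq intro: module_cong[OF rep_module[OF assms]])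
qed

lemma halo_module_gen:
  assumes "rep V" "\<alpha> \<in> E" "v \<in> carrier V"
  shows "opr (halo_module K G V) (cls (free_gen K \<alpha>)) v = eps V \<alpha> v"
proof -
  interpret halo_action K E V "eps V" by (rule rep_halo_action[OF assms(1)])
  show ?thesis
    by (simp add: halo_module_def free_act_eq act_class[OF gen_mem[OF assms(2)] assms(3)] act_gen[OF assms(2,3)])
qed

lemma linear_map_cong:
  assumes "carrier V = carrier V'" "add V = add V'" "smult V = smult V'"
    "carrier W = carrier W'" "add W = add W'" "smult W = smult W'"
  shows "linear_map K V W h = linear_map K V' W' h"
  unfolding linear_map_def by (simp add: assms)

lemma halo_equivariant_iff:
  assumes V: "rep V" and W: "rep W"
  shows "equivariant_map K (carrier B) (halo_module K G V) (halo_module K G W) h \<longleftrightarrow>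
    linear_map K V W h \<and> (\<forall>\<alpha>\<in>E. \<forall>v\<in>carrier V. h (eps V \<alpha> v) = eps W \<alpha> (h v))"
proof -
  have l: "linear_map K (halo_module K G V) (halo_module K G W) h = linear_map K V W h"
    by (rule linear_map_cong) simp_all
  show ?thesis
  proof
    assume e: "equivariant_map K (carrier B) (halo_module K G V) (halo_module K G W) h"
    then have h: "linear_map K V W h" using equivariant_mapD(1) l by blast
    have "h (eps V \<alpha> v) = eps W \<alpha> (h v)" if "\<alpha> \<in> E" "v \<in> carrier V" for \<alpha> v
      using equivariant_mapD(2)[OF e, of "cls (free_gen K \<alpha>)" v] gen_mem[OF that(1)]
        halo_module_gen[OF V that] halo_module_gen[OF W that(1) linear_mapD(1)[OF h that(2)]] that(2)
      by (simp add: B_simps(1))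
    then show "linear_map K V W h \<and> (\<forall>\<alpha>\<in>E. \<forall>v\<in>carrier V. h (eps V \<alpha> v) = eps W \<alpha> (h v))"
      using h by blast
  next
    assume h: "linear_map K V W h \<and> (\<forall>\<alpha>\<in>E. \<forall>v\<in>carrier V. h (eps V \<alpha> v) = eps W \<alpha> (h v))"
    then show "equivariant_map K (carrier B) (halo_module K G V) (halo_module K G W) h"
      using halo_module_gen[OF V] halo_module_gen[OF W] linear_mapD(1)[of K V W h] l
      by (intro equivariant_by_generators halo_module_algebra_module V W) auto
  qed
qed

end

section \<open>Spaces of homomorphisms\<close>

lemma hom_space_simps:
  "f \<in> carrier (hom_space K S V W) \<longleftrightarrow> f \<in> extensional (carrier V) \<and> equivariant_map K S V W f"
  "\<zero>\<^bsub>hom_space K S V W\<^esub> = (\<lambda>v\<in>carrier V. \<zero>\<^bsub>W\<^esub>)"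
  "f \<oplus>\<^bsub>hom_space K S V W\<^esub> g = (\<lambda>v\<in>carrier V. f v \<oplus>\<^bsub>W\<^esub> g v)"
  "k \<odot>\<^bsub>hom_space K S V W\<^esub> f = (\<lambda>v\<in>carrier V. k \<odot>\<^bsub>W\<^esub> f v)"
  by (auto simp: hom_space_def)

lemma hom_space_module:
  assumes V: "module K V" and W: "module K W"
    and opV: "\<And>x. x \<in> S \<Longrightarrow> linear_map K V V (opr V x)" and opW: "\<And>x. x \<in> S \<Longrightarrow> linear_map K W W (opr W x)"
  shows "module K (hom_space K S V W)"
proof -
  interpret V: module K V by fact
  interpret W: module K W by fact
  let ?P = "vspace (\<Pi>\<^sub>E v\<in>carrier V. carrier W) (\<lambda>v\<in>carrier V. \<zero>\<^bsub>W\<^esub>)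
    (\<lambda>f g. \<lambda>v\<in>carrier V. f v \<oplus>\<^bsub>W\<^esub> g v) (\<lambda>k f. \<lambda>v\<in>carrier V. k \<odot>\<^bsub>W\<^esub> f v) :: ('a, 'c \<Rightarrow> 'e) module"
  let ?H = "{f \<in> extensional (carrier V). equivariant_map K S V W f}"
  have P: "module K ?P"
    by (rule pointwise_module[OF V.R.is_cring, where M="\<lambda>_. W"]) (rule W)
  note c = linear_mapD(1)[OF opV] and d = linear_mapD(1)[OF opW]
  have e: "linear_map K V W f" "\<And>v. v \<in> carrier V \<Longrightarrow> f v \<in> carrier W"
    "\<And>x v. x \<in> S \<Longrightarrow> v \<in> carrier V \<Longrightarrow> f (opr V x v) = opr W x (f v)" if "f \<in> ?H" for f
    using that equivariant_mapD[of K S V W f] linear_mapD(1)[of K V W f] by auto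
  have "submodule ?H K ?P"
  proof (rule submodule_by_closure[OF P])
    show "?H \<subseteq> carrier ?P" using e(2) by (auto simp: PiE_iff intro: extensional_arb)
    show "\<zero>\<^bsub>?P\<^esub> \<in> ?H"
      by (auto simp: equivariant_map_def c linear_map_zero[OF W W opW] intro!: linear_mapI)
  next
    fix f g assume f: "f \<in> ?H" and g: "g \<in> ?H"
    then show "f \<oplus>\<^bsub>?P\<^esub> g \<in> ?H"
      using e[OF f] e[OF g]
      by (auto simp: equivariant_map_def c linear_mapD(2,3)[OF e(1)[OF f]] linear_mapD(2,3)[OF e(1)[OF g]]
          linear_mapD(2)[OF opW] W.M.a_ac W.smult_r_distr intro!: linear_mapI)
  next
    fix k f assume k: "k \<in> carrier K" and f: "f \<in> ?H"
    have "k \<odot>\<^bsub>W\<^esub> (l \<odot>\<^bsub>W\<^esub> w) = l \<odot>\<^bsub>W\<^esub> (k \<odot>\<^bsub>W\<^esub> w)" if "l \<in> carrier K" "w \<in> carrier W" for l w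
      using k that by (simp add: W.smult_assoc1[symmetric] V.R.m_comm)
    then show "k \<odot>\<^bsub>?P\<^esub> f \<in> ?H"
      using e[OF f] k
      by (auto simp: equivariant_map_def c linear_mapD(2,3)[OF e(1)[OF f]] linear_mapD(3)[OF opW]
          W.smult_r_distr intro!: linear_mapI)
  qed
  from submodule_module[OF P this] show ?thesis by (simp add: hom_space_def vspace_def)
qed

context digroup_action
begin

lemma hom_halo_simps:
  assumes Q: "rep Q" and W: "rep W"
  shows "f \<in> carrier (hom_halo K G E Q W) \<longleftrightarrow> f \<in> extensional (carrier Q) \<and> linear_map K Q W f \<and>
      (\<forall>\<alpha>\<in>E. \<forall>q\<in>carrier Q. f (eps Q \<alpha> q) = eps W \<alpha> (f q))"
    and "\<zero>\<^bsub>hom_halo K G E Q W\<^esub> = (\<lambda>q\<in>carrier Q. \<zero>\<^bsub>W\<^esub>)"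
    and "f \<oplus>\<^bsub>hom_halo K G E Q W\<^esub> f' = (\<lambda>q\<in>carrier Q. f q \<oplus>\<^bsub>W\<^esub> f' q)"
    and "k \<odot>\<^bsub>hom_halo K G E Q W\<^esub> f = (\<lambda>q\<in>carrier Q. k \<odot>\<^bsub>W\<^esub> f q)"
    and "g \<in> carrier G \<Longrightarrow> opr (hom_halo K G E Q W) g f = (\<lambda>q\<in>carrier Q. rg W g (f (rg Q (inv g) q)))"
  by (auto simp: hom_halo_def hom_space_simps halo_equivariant_iff[OF Q W] rg_inv_into[OF Q] restrict_def)

lemma hom_halo_module:
  assumes Q: "rep Q" and W: "rep W"
  shows "module K (hom_halo K G E Q W)"
proof -
  note A = algebra_moduleD[OF halo_module_algebra_module]
  have "module K (hom_space K (carrier B) (halo_module K G Q) (halo_module K G W))"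
    using A(2)[OF Q] A(2)[OF W] by (intro hom_space_module A(1)[OF Q] A(1)[OF W]) (auto simp: B_simps(1))
  then show ?thesis by (rule module_cong) (simp_all add: hom_halo_def)
qed

lemma hom_halo_opr_mem:
  assumes Q: "rep Q" and W: "rep W" and g: "g \<in> carrier G" and f: "f \<in> carrier (hom_halo K G E Q W)"
  shows "opr (hom_halo K G E Q W) g f \<in> carrier (hom_halo K G E Q W)"
proof -
  note f = f[unfolded hom_halo_simps(1)[OF Q W]]
  have fl: "linear_map K Q W f" using f by blast
  interpret Q: module K Q by (rule rep_module[OF Q])
  have ig: "inv g \<in> carrier G" using g by simp
  note Qi = linear_mapD[OF repD(2)[OF Q ig]] and Wg = linear_mapD[OF repD(2)[OF W g]]
  have "linear_map K Q W (\<lambda>q\<in>carrier Q. rg W g (f (rg Q (inv g) q)))"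
    by (rule linear_mapI) (auto simp: Qi Wg linear_mapD[OF fl])
  moreover have "rg W g (f (rg Q (inv g) (eps Q \<alpha> q))) = eps W \<alpha> (rg W g (f (rg Q (inv g) q)))"
    if "\<alpha> \<in> E" "q \<in> carrier Q" for \<alpha> q
    using that f Qi(1)[OF that(2)] \<phi>_closed[OF ig that(1)] \<phi>_inv(2)[OF g that(1)] linear_mapD(1)[OF fl]
    by (simp add: repD(7)[OF Q ig] repD(7)[OF W g])
  ultimately show ?thesis
    unfolding hom_halo_simps(5)[OF Q W g] hom_halo_simps(1)[OF Q W] by (simp add: eps_closed[OF Q])
qed

lemma hom_halo_group_module:
  assumes Q: "rep Q" and W: "rep W"
  shows "group_module K G (hom_halo K G E Q W)"
  unfolding group_module_def
proof (intro conjI ballI)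
  let ?H = "hom_halo K G E Q W"
  note S = hom_halo_simps[OF Q W]
  interpret W: module K W by (rule rep_module[OF W])
  show "module K ?H" by (rule hom_halo_module[OF Q W])
  have fc: "f q \<in> carrier W" if "f \<in> carrier ?H" "q \<in> carrier Q" for f q
    using that unfolding S(1) using linear_mapD(1)[of K Q W f q] by blast
  show "linear_map K ?H ?H (opr ?H g)" if g: "g \<in> carrier G" for g
  proof (rule linear_mapI)
    have ig: "inv g \<in> carrier G" using g by simp
    note Wg = linear_mapD[OF repD(2)[OF W g]]
    show "opr ?H g f \<in> carrier ?H" if "f \<in> carrier ?H" for f by (rule hom_halo_opr_mem[OF Q W g that])
    show "opr ?H g (f \<oplus>\<^bsub>?H\<^esub> f') = opr ?H g f \<oplus>\<^bsub>?H\<^esub> opr ?H g f'" if "f \<in> carrier ?H" "f' \<in> carrier ?H" for f f'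
      unfolding S(5)[OF g] S(3) using fc that rg_closed[OF Q ig] by (auto simp: Wg)
    show "opr ?H g (k \<odot>\<^bsub>?H\<^esub> f) = k \<odot>\<^bsub>?H\<^esub> opr ?H g f" if "k \<in> carrier K" "f \<in> carrier ?H" for k f
      unfolding S(5)[OF g] S(4) using fc that rg_closed[OF Q ig] by (auto simp: Wg)
  qed
  show "opr ?H \<one> f = f" if "f \<in> carrier ?H" for f
    unfolding S(5)[OF G.one_closed] using that fc[OF that] repD(3)[OF Q] repD(3)[OF W]
    by (auto simp: S(1) extensional_def fun_eq_iff)
  show "opr ?H (g \<otimes> h) f = opr ?H g (opr ?H h f)" if "g \<in> carrier G" "h \<in> carrier G" "f \<in> carrier ?H" for g h f
    unfolding S(5)[OF that(1)] S(5)[OF that(2)] S(5)[OF G.m_closed[OF that(1,2)]]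
    using fc[OF that(3)] that(1,2) rg_closed[OF Q]
    by (auto simp: G.inv_mult_group repD(4)[OF Q] repD(4)[OF W] fun_eq_iff)
qed

text \<open>Invariance of \<open>f\<close> under conjugation by \<open>g\<close> means that \<open>f\<close>
  commutes with \<open>\<rho>\<^sub>g\<close>, and together with the \<open>\<epsilon>\<^sub>\<alpha>\<close> these generate the
  operators of a representation.\<close>

lemma invariant_hom:
  assumes Q: "rep Q" and W: "rep W"
  shows "carrier (fixed_space G (hom_halo K G E Q W)) = carrier (hom_space K (rep_syms G E) Q W)"
proof (intro equalityI subsetI)
  let ?H = "hom_halo K G E Q W"
  note S = hom_halo_simps[OF Q W]
  fix f assume f: "f \<in> carrier (fixed_space G ?H)"
  then have fH: "f \<in> extensional (carrier Q)" "linear_map K Q W f"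
    "\<And>\<alpha> q. \<alpha> \<in> E \<Longrightarrow> q \<in> carrier Q \<Longrightarrow> f (eps Q \<alpha> q) = eps W \<alpha> (f q)"
    by (auto simp: S(1))
  have "f (rg Q g q) = rg W g (f q)" if "g \<in> carrier G" "q \<in> carrier Q" for g q
  proof -
    have "opr ?H g f = f" using f that(1) by simp
    then have "(\<lambda>q\<in>carrier Q. rg W g (f (rg Q (inv g) q))) (rg Q g q) = f (rg Q g q)"
      unfolding S(5)[OF that(1)] by simp
    then show ?thesis using rg_closed[OF Q that] rg_inv(1)[OF Q that] by simp
  qed
  then show "f \<in> carrier (hom_space K (rep_syms G E) Q W)"
    using fH by (simp add: hom_space_simps rep_equivariant_iff[OF Q W])
next
  let ?H = "hom_halo K G E Q W"
  note S = hom_halo_simps[OF Q W]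
  fix f assume "f \<in> carrier (hom_space K (rep_syms G E) Q W)"
  then have f: "f \<in> extensional (carrier Q)" "linear_map K Q W f"
    "\<And>\<alpha> q. \<alpha> \<in> E \<Longrightarrow> q \<in> carrier Q \<Longrightarrow> f (eps Q \<alpha> q) = eps W \<alpha> (f q)"
    "\<And>g q. g \<in> carrier G \<Longrightarrow> q \<in> carrier Q \<Longrightarrow> f (rg Q g q) = rg W g (f q)"
    by (auto simp: hom_space_simps rep_equivariant_iff[OF Q W])
  have "opr ?H g f = f" if g: "g \<in> carrier G" for g
    unfolding S(5)[OF g] using f(1,4) g rg_inv(2)[OF W g] linear_mapD(1)[OF f(2)]
    by (auto simp: extensional_def fun_eq_iff)
  then show "f \<in> carrier (fixed_space G ?H)" using f by (simp add: S(1))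
qed

lemma hom_halo_compose:
  assumes Q: "rep Q" and W: "rep W" and W': "rep W'" and d: "equivariant_map K (rep_syms G E) W W' d"
  shows "equivariant_map K (carrier G) (hom_halo K G E Q W) (hom_halo K G E Q W') (compose (carrier Q) d)"
proof -
  note S = hom_halo_simps[OF Q W] and S' = hom_halo_simps[OF Q W']
  note d = d[unfolded rep_equivariant_iff[OF W W']]
  have dl: "linear_map K W W' d" using d by blast
  have fc: "f q \<in> carrier W" if "f \<in> carrier (hom_halo K G E Q W)" "q \<in> carrier Q" for f q
    using that unfolding S(1) using linear_mapD(1)[of K Q W f q] by blast
  interpret Q: module K Q by (rule rep_module[OF Q])
  have "linear_map K (hom_halo K G E Q W) (hom_halo K G E Q W') (compose (carrier Q) d)"
  proof (rule linear_mapI)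
    fix f assume f: "f \<in> carrier (hom_halo K G E Q W)"
    then have fl: "linear_map K Q W f" by (simp add: S(1))
    have "linear_map K Q W' (compose (carrier Q) d f)"
      by (rule linear_mapI) (auto simp: compose_def linear_mapD[OF fl] linear_mapD[OF dl])
    then show "compose (carrier Q) d f \<in> carrier (hom_halo K G E Q W')"
      using f fc[OF f] d by (auto simp: S(1) S'(1) compose_def eps_closed[OF Q])
  qed (auto simp: S(3,4) S'(3,4) compose_def linear_mapD[OF dl] fc)
  moreover have "compose (carrier Q) d (opr (hom_halo K G E Q W) g f) =
      opr (hom_halo K G E Q W') g (compose (carrier Q) d f)"
    if "g \<in> carrier G" "f \<in> carrier (hom_halo K G E Q W)" for g f
    unfolding S(5)[OF that(1)] S'(5)[OF that(1)] using that d fc[OF that(2)] rg_closed[OF Q]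
    by (auto simp: compose_def fun_eq_iff)
  ultimately show ?thesis by (simp add: equivariant_map_def)
qed

end

lemma cohomology_cong:
  assumes "\<And>n. carrier (C n) = carrier (C' n)" "\<And>n. add (C n) = add (C' n)"
    "\<And>n. zero (C n) = zero (C' n)" "\<And>n. smult (C n) = smult (C' n)"
  shows "cohomology C d n = cohomology C' d n"
proof -
  have "cocycles C d n = cocycles C' d n" "coboundaries C d n = coboundaries C' d n"
    by (simp_all add: cocycles_def coboundaries_def assms split: nat.split)
  moreover have "a_r_coset (C n) = a_r_coset (C' n)" "set_add (C n) = set_add (C' n)"
    by (simp_all add: fun_eq_iff a_r_coset_def r_coset_def set_add_def set_mult_def assms)
  ultimately show ?thesis by (simp add: cohomology_def subquotient_def assms)
qed

section \<open>Injective representations are injective over the halo algebra\<close>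

subsection \<open>Change of universe\<close>

lemma equivariant_map_comp:
  assumes f: "equivariant_map K S U V f" and g: "equivariant_map K S V W g"
  shows "equivariant_map K S U W (\<lambda>x. g (f x))"
  using linear_map_comp[OF equivariant_mapD(1)[OF f] equivariant_mapD(1)[OF g]]
    equivariant_mapD(2)[OF f] equivariant_mapD(2)[OF g] linear_mapD(1)[OF equivariant_mapD(1)[OF f]]
  by (auto simp: equivariant_map_def)

definition transport :: "('v \<Rightarrow> 'u) \<Rightarrow> ('k, 'v, 'x) opmod \<Rightarrow> ('k, 'u, 'x) opmod"
  where "transport j V = (let u = inv_into (carrier V) j in with_ops
    (vspace (j ` carrier V) (j \<zero>\<^bsub>V\<^esub>) (\<lambda>x y. j (u x \<oplus>\<^bsub>V\<^esub> u y)) (\<lambda>k x. j (k \<odot>\<^bsub>V\<^esub> u x)))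
    (\<lambda>s x. j (opr V s (u x))))"

lemma transport_simps:
  assumes "inj_on j (carrier V)"
  shows "carrier (transport j V) = j ` carrier V"
    and "\<zero>\<^bsub>transport j V\<^esub> = j \<zero>\<^bsub>V\<^esub>"
    and "x \<in> carrier V \<Longrightarrow> y \<in> carrier V \<Longrightarrow> j x \<oplus>\<^bsub>transport j V\<^esub> j y = j (x \<oplus>\<^bsub>V\<^esub> y)"
    and "x \<in> carrier V \<Longrightarrow> k \<odot>\<^bsub>transport j V\<^esub> j x = j (k \<odot>\<^bsub>V\<^esub> x)"
    and "x \<in> carrier V \<Longrightarrow> opr (transport j V) s (j x) = j (opr V s x)"
    and "x \<in> carrier V \<Longrightarrow> inv_into (carrier V) j (j x) = x"
  using assms by (auto simp: transport_def Let_def)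

lemma transport_module:
  assumes V: "module K V" and j: "inj_on j (carrier V)"
  shows "module K (transport j V)"
proof -
  interpret module K V by fact
  note t = transport_simps[OF j]
  show ?thesis
  proof (rule moduleI)
    show "abelian_group (transport j V)"
    proof (rule abelian_groupI)
      fix x assume "x \<in> carrier (transport j V)"
      then obtain v where v: "v \<in> carrier V" "x = j v" by (auto simp: t(1))
      then have "j (\<ominus>\<^bsub>V\<^esub> v) \<oplus>\<^bsub>transport j V\<^esub> x = \<zero>\<^bsub>transport j V\<^esub>"
        by (simp add: t(2,3) M.l_neg)
      then show "\<exists>y\<in>carrier (transport j V). y \<oplus>\<^bsub>transport j V\<^esub> x = \<zero>\<^bsub>transport j V\<^esub>"
        using v by (auto simp: t(1))
    qed (auto simp: t(1-3) M.a_ac)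
  qed (auto simp: t(1,3,4) R.is_cring smult_l_distr smult_r_distr smult_assoc1)
qed

lemma transport_to:
  assumes "inj_on j (carrier V)"
  shows "equivariant_map K S V (transport j V) j"
  unfolding equivariant_map_def by (auto intro!: linear_mapI simp: transport_simps[OF assms])

lemma transport_from:
  assumes V: "module K V" and op: "\<And>s. s \<in> S \<Longrightarrow> linear_map K V V (opr V s)" and j: "inj_on j (carrier V)"
  shows "equivariant_map K S (transport j V) V (inv_into (carrier V) j)"
proof -
  interpret module K V by fact
  show ?thesis
    unfolding equivariant_map_def
    by (auto intro!: linear_mapI simp: transport_simps[OF j] linear_mapD(1)[OF op])
qed

lemma infinite_times_self:
  assumes "infinite A"
  shows "A \<times> A \<lesssim> A"
  using card_of_Times_same_infinite[OF assms] card_of_ordIso[of "A \<times> A" A] eqpoll_imp_lepoll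
  unfolding eqpoll_def by blast

lemma PiE_lepoll:
  assumes "infinite A" "finite S"
  shows "S \<rightarrow>\<^sub>E A \<lesssim> A"
  using assms(2)
proof (induction S rule: finite_induct)
  case empty
  obtain a where "a \<in> A" using assms(1) infinite_imp_nonempty by auto
  then show ?case using singleton_lepoll[of _ a A] by (simp add: insert_absorb)
next
  case (insert x S)
  have "insert x S \<rightarrow>\<^sub>E A \<lesssim> A \<times> (S \<rightarrow>\<^sub>E A)"
    unfolding PiE_insert_eq by (rule image_lepoll)
  also have "\<dots> \<lesssim> A \<times> A" using insert.IH by (intro times_lepoll_mono) auto
  also have "\<dots> \<lesssim> A" by (rule infinite_times_self[OF assms(1)])
  finally show ?case .
qed

context finite_group_char_zero
begin

lemma infinite_vector_space:
  assumes "module K V" "v \<in> carrier V" "v \<noteq> \<zero>\<^bsub>V\<^esub>"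
  shows "infinite (carrier V)"
proof -
  interpret module K V by fact
  have pos: "[n] \<cdot>\<^bsub>V\<^esub> v \<noteq> \<zero>\<^bsub>V\<^esub>" if "n > 0" for n :: nat
  proof
    assume "[n] \<cdot>\<^bsub>V\<^esub> v = \<zero>\<^bsub>V\<^esub>"
    moreover have u: "[n] \<cdot>\<^bsub>K\<^esub> \<one>\<^bsub>K\<^esub> \<in> Units K" using char_K[OF that] K.field_Units by simp
    ultimately have "inv\<^bsub>K\<^esub> ([n] \<cdot>\<^bsub>K\<^esub> \<one>\<^bsub>K\<^esub>) \<odot>\<^bsub>V\<^esub> (([n] \<cdot>\<^bsub>K\<^esub> \<one>\<^bsub>K\<^esub>) \<odot>\<^bsub>V\<^esub> v) = \<zero>\<^bsub>V\<^esub>"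
      using add_pow_smult[OF assms(2), of n] by simp
    then show False
      using u assms(2,3) by (simp add: smult_assoc1[symmetric])
  qed
  have "inj (\<lambda>n::nat. [n] \<cdot>\<^bsub>V\<^esub> v)"
  proof (rule linorder_injI)
    fix m n :: nat assume "m < n"
    show "[m] \<cdot>\<^bsub>V\<^esub> v \<noteq> [n] \<cdot>\<^bsub>V\<^esub> v"
    proof
      assume "[m] \<cdot>\<^bsub>V\<^esub> v = [n] \<cdot>\<^bsub>V\<^esub> v"
      moreover have "([m] \<cdot>\<^bsub>V\<^esub> v) \<oplus>\<^bsub>V\<^esub> ([(n - m)] \<cdot>\<^bsub>V\<^esub> v) = [n] \<cdot>\<^bsub>V\<^esub> v"
        using M.add.nat_pow_mult[OF assms(2), of m "n - m"] \<open>m < n\<close> by simp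
      ultimately have "[(n - m)] \<cdot>\<^bsub>V\<^esub> v = \<zero>\<^bsub>V\<^esub>"
        using assms(2) M.add.r_cancel_one[of "[m] \<cdot>\<^bsub>V\<^esub> v" "[(n - m)] \<cdot>\<^bsub>V\<^esub> v"]
        by (metis M.add.l_cancel_one M.add.nat_pow_closed)
      then show False using pos[of "n - m"] \<open>m < n\<close> by simp
    qed
  qed
  moreover have "range (\<lambda>n::nat. [n] \<cdot>\<^bsub>V\<^esub> v) \<subseteq> carrier V" using assms(2) by auto
  ultimately show ?thesis by (rule infinite_super[OF _ range_inj_infinite, rotated])
qed

text \<open>A nonzero vector space over \<open>K\<close> is infinite, so that its finite powers embed into it: the
  induced representation fits into the universe of the given module.\<close>

lemma functions_embed:
  assumes "module K V"
  shows "\<exists>j::('g \<Rightarrow> 'v) \<Rightarrow> 'v. inj_on j (carrier G \<rightarrow>\<^sub>E carrier (V :: ('k, 'v, 'c) module_scheme))"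
proof (cases "infinite (carrier V)")
  case True
  then show ?thesis using PiE_lepoll[OF True finite_G] unfolding lepoll_def by blast
next
  case False
  interpret module K V by fact
  have "carrier V = {\<zero>\<^bsub>V\<^esub>}" using infinite_vector_space[OF assms] False by auto
  then have "inj_on (\<lambda>_. \<zero>\<^bsub>V\<^esub>) (carrier G \<rightarrow>\<^sub>E carrier V)"
    by (auto intro!: inj_onI PiE_ext[of _ "carrier G" "\<lambda>_. {\<zero>\<^bsub>V\<^esub>}"])
  then show ?thesis by blast
qed

end

subsection \<open>Induced representations\<close>

context digroup_action
begin

text \<open>Injectivity is tested on objects in the type \<open>'t\<close>. Test objects in other types
  can be copied into it when their carriers embed.\<close>

lemma injective_object_universe:
  fixes M :: "('k, 'u, ('g \<times> 'e) rep_sym) opmod"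
    and A :: "('k, 'v, ('g \<times> 'e) rep_sym) opmod" and A' :: "('k, 'w, ('g \<times> 'e) rep_sym) opmod"
    and j :: "'v \<Rightarrow> 't" and j' :: "'w \<Rightarrow> 't"
  assumes M: "injective_object K (rep_syms G E) (rep :: ('k, 't, ('g \<times> 'e) rep_sym) opmod \<Rightarrow> bool) M"
    and A: "rep A" and A': "rep A'"
    and j: "inj_on j (carrier A)" and j': "inj_on j' (carrier A')"
    and i: "equivariant_map K (rep_syms G E) A A' i" "inj_on i (carrier A)"
    and f: "equivariant_map K (rep_syms G E) A M f"
  shows "\<exists>h. equivariant_map K (rep_syms G E) A' M h \<and> (\<forall>a\<in>carrier A. h (i a) = f a)"
proof -
  have tr: "rep (transport l V)" if V: "rep V" and l: "inj_on l (carrier V)"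
    for l :: "'x \<Rightarrow> 't" and V :: "('k, 'x, ('g \<times> 'e) rep_sym) opmod"
  proof (rule repI[where e="\<lambda>\<alpha> x. l (eps V \<alpha> (inv_into (carrier V) l x))"
        and r="\<lambda>g x. l (rg V g (inv_into (carrier V) l x))"])
    interpret module K V by (rule rep_module[OF V])
    note t = transport_simps[OF l]
    show "module K (transport l V)" by (rule transport_module[OF rep_module[OF V] l])
    show "linear_map K (transport l V) (transport l V) (\<lambda>x. l (eps V \<alpha> (inv_into (carrier V) l x)))"
      if "\<alpha> \<in> E" for \<alpha>
      by (rule linear_mapI) (auto simp: t linear_mapD[OF repD(1)[OF V that]])
    show "linear_map K (transport l V) (transport l V) (\<lambda>x. l (rg V g (inv_into (carrier V) l x)))"
      if "g \<in> carrier G" for g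
      by (rule linear_mapI) (auto simp: t linear_mapD[OF repD(2)[OF V that]])
    show "lam (transport l V) (g, \<alpha>) x = l (eps V \<alpha> (inv_into (carrier V) l (l (rg V g (inv_into (carrier V) l x)))))"
      "rho (transport l V) (g, \<alpha>) x = l (rg V g (inv_into (carrier V) l x))"
      "l (rg V g (inv_into (carrier V) l (l (eps V \<alpha> (inv_into (carrier V) l x))))) =
        l (eps V (\<phi> g \<alpha>) (inv_into (carrier V) l (l (rg V g (inv_into (carrier V) l x)))))"
      if g: "g \<in> carrier G" "\<alpha> \<in> E" and x: "x \<in> carrier (transport l V)" for g \<alpha> x
    proof -
      obtain v where v: "v \<in> carrier V" "x = l v" using x by (auto simp: t(1))
      have c: "rg V g v \<in> carrier V" "eps V \<alpha> v \<in> carrier V" using g v(1) rg_closed[OF V] eps_closed[OF V] by auto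
      show "lam (transport l V) (g, \<alpha>) x = l (eps V \<alpha> (inv_into (carrier V) l (l (rg V g (inv_into (carrier V) l x)))))"
        unfolding v(2) t(5)[OF v(1)] t(6)[OF v(1)] t(6)[OF c(1)] repD(6)[OF V g v(1)] ..
      show "rho (transport l V) (g, \<alpha>) x = l (rg V g (inv_into (carrier V) l x))"
        unfolding v(2) t(5)[OF v(1)] t(6)[OF v(1)] rho_eq_rg[OF V g v(1)] ..
      show "l (rg V g (inv_into (carrier V) l (l (eps V \<alpha> (inv_into (carrier V) l x))))) =
        l (eps V (\<phi> g \<alpha>) (inv_into (carrier V) l (l (rg V g (inv_into (carrier V) l x)))))"
        unfolding v(2) t(6)[OF v(1)] t(6)[OF c(1)] t(6)[OF c(2)] repD(7)[OF V g v(1)] ..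
    qed
    show "l (rg V \<one> (inv_into (carrier V) l x)) = x" if "x \<in> carrier (transport l V)" for x
      using that by (auto simp: t repD(3)[OF V])
    show "l (rg V (g \<otimes> h) (inv_into (carrier V) l x)) =
        l (rg V g (inv_into (carrier V) l (l (rg V h (inv_into (carrier V) l x)))))"
      if "g \<in> carrier G" "h \<in> carrier G" "x \<in> carrier (transport l V)" for g h x
      using that by (auto simp: t repD(4)[OF V] rg_closed[OF V])
    show "l (eps V \<alpha> (inv_into (carrier V) l (l (eps V \<beta> (inv_into (carrier V) l x))))) =
        l (eps V \<alpha> (inv_into (carrier V) l x))"
      if "\<alpha> \<in> E" "\<beta> \<in> E" "x \<in> carrier (transport l V)" for \<alpha> \<beta> x
      using that by (auto simp: t repD(5)[OF V] eps_closed[OF V])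
  qed
  have op: "linear_map K A A (opr A s)" if "s \<in> rep_syms G E" for s
    using that rep_raw(1,2)[OF A] by (auto simp: rep_syms_def)
  let ?u = "inv_into (carrier A) j"
  note from_A = transport_from[where S="rep_syms G E", OF rep_module[OF A] op j]
  note to_A' = transport_to[where K=K and S="rep_syms G E", OF j']
  have e1: "equivariant_map K (rep_syms G E) (transport j A) (transport j' A') (\<lambda>x. j' (i (?u x)))"
    by (rule equivariant_map_comp[OF from_A equivariant_map_comp[OF i(1) to_A']])
  have e2: "inj_on (\<lambda>x. j' (i (?u x))) (carrier (transport j A))"
  proof (rule inj_onI)
    fix x y assume "x \<in> carrier (transport j A)" "y \<in> carrier (transport j A)"
      and eq: "j' (i (?u x)) = j' (i (?u y))"
    then obtain a b where ab: "a \<in> carrier A" "b \<in> carrier A" "x = j a" "y = j b"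
      by (auto simp: transport_simps[OF j])
    then have "j' (i a) = j' (i b)" using eq by (simp add: transport_simps(6)[OF j])
    then have "i a = i b"
      using inj_onD[OF j'] linear_mapD(1)[OF equivariant_mapD(1)[OF i(1)]] ab by blast
    then show "x = y" using inj_onD[OF i(2)] ab by blast
  qed
  have e3: "equivariant_map K (rep_syms G E) (transport j A) M (\<lambda>x. f (?u x))"
    by (rule equivariant_map_comp[OF from_A f])
  from M[unfolded injective_object_def, rule_format, OF conjI[OF tr[OF A j] conjI[OF tr[OF A' j']
        conjI[OF e1 conjI[OF e2 e3]]]]]
  obtain h where h: "equivariant_map K (rep_syms G E) (transport j' A') M h"
    "\<And>x. x \<in> carrier (transport j A) \<Longrightarrow> h (j' (i (?u x))) = f (?u x)"
    by blast
  have "h (j' (i a)) = f a" if "a \<in> carrier A" for a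
    using h(2)[of "j a"] that by (simp add: transport_simps[OF j])
  then show ?thesis using equivariant_map_comp[OF to_A' h(1)] by blast
qed

definition ind_r :: "'g \<Rightarrow> ('g \<Rightarrow> 'v) \<Rightarrow> 'g \<Rightarrow> 'v"
  where "ind_r g s = (\<lambda>k\<in>carrier G. s (inv g \<otimes> k))"

definition ind_e :: "('k, 'v, ('e list \<Rightarrow> 'k) set) opmod \<Rightarrow> 'e \<Rightarrow> ('g \<Rightarrow> 'v) \<Rightarrow> 'g \<Rightarrow> 'v"
  where "ind_e A \<alpha> s = (\<lambda>k\<in>carrier G. opr A (cls (free_gen K (\<phi> (inv k) \<alpha>))) (s k))"

text \<open>The representation \<open>KG \<otimes> A\<close> induced from a module over the halo algebra, where
  \<open>\<Sum> g \<otimes> s g\<close> is written as the function \<open>s\<close>.\<close>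

definition ind :: "('k, 'v, ('e list \<Rightarrow> 'k) set) opmod \<Rightarrow> ('k, 'g \<Rightarrow> 'v, ('g \<times> 'e) rep_sym) opmod"
  where "ind A = with_ops
    (vspace (carrier G \<rightarrow>\<^sub>E carrier A) (\<lambda>k\<in>carrier G. \<zero>\<^bsub>A\<^esub>)
      (\<lambda>s t. \<lambda>k\<in>carrier G. s k \<oplus>\<^bsub>A\<^esub> t k) (\<lambda>c s. \<lambda>k\<in>carrier G. c \<odot>\<^bsub>A\<^esub> s k))
    (\<lambda>y. case y of Lam x \<Rightarrow> (\<lambda>s. ind_e A (snd x) (ind_r (fst x) s)) | Rho x \<Rightarrow> ind_r (fst x))"

lemma ind_simps:
  "s \<in> carrier (ind A) \<longleftrightarrow> s \<in> carrier G \<rightarrow>\<^sub>E carrier A"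
  "\<zero>\<^bsub>ind A\<^esub> = (\<lambda>k\<in>carrier G. \<zero>\<^bsub>A\<^esub>)"
  "s \<oplus>\<^bsub>ind A\<^esub> t = (\<lambda>k\<in>carrier G. s k \<oplus>\<^bsub>A\<^esub> t k)"
  "c \<odot>\<^bsub>ind A\<^esub> s = (\<lambda>k\<in>carrier G. c \<odot>\<^bsub>A\<^esub> s k)"
  "rg (ind A) g = ind_r g"
  "s \<in> carrier (ind A) \<Longrightarrow> eps (ind A) \<alpha> s = ind_e A \<alpha> s"
  by (auto simp: ind_def rho_grp_def ind_r_def ind_e_def PiE_iff extensional_def fun_eq_iff)

lemma ind_rep:
  assumes A: "algebra_module K B A"
  shows "rep (ind A)"
proof (rule repI[where e="ind_e A" and r=ind_r])
  note Ad = algebra_moduleD[OF A]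
  note E = linear_mapD[OF Ad(2)[OF gen_mem]]
  interpret A: module K A by (rule Ad(1))
  have p: "\<phi> (inv k) \<alpha> \<in> E" if "k \<in> carrier G" "\<alpha> \<in> E" for k \<alpha> using that \<phi>_closed by simp
  have pm: "s k \<in> carrier A" if "s \<in> carrier G \<rightarrow>\<^sub>E carrier A" "k \<in> carrier G" for s k
    using that by auto
  then have sc: "s k \<in> carrier A" if "s \<in> carrier (ind A)" "k \<in> carrier G" for s k
    using that by (simp add: ind_simps(1))
  show "module K (ind A)"
    by (rule module_cong[OF pointwise_module[OF K.is_cring, where M="\<lambda>_. A" and S="carrier G"]])
      (simp_all add: ind_def Ad(1))
  show "lam (ind A) (g, \<alpha>) s = ind_e A \<alpha> (ind_r g s)" "rho (ind A) (g, \<alpha>) s = ind_r g s" for g \<alpha> s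
    by (simp_all add: ind_def)
  show "linear_map K (ind A) (ind A) (ind_e A \<alpha>)" if "\<alpha> \<in> E" for \<alpha>
    by (rule linear_mapI) (auto simp: ind_simps(1,3,4) ind_e_def fun_eq_iff E[OF p[OF _ that]] pm)
  show "linear_map K (ind A) (ind A) (ind_r g)" if "g \<in> carrier G" for g
    using that by (intro linear_mapI) (auto simp: ind_simps(1,3,4) ind_r_def fun_eq_iff)
  show "ind_r \<one> s = s" if "s \<in> carrier (ind A)" for s
    using that by (auto simp: ind_simps(1) ind_r_def PiE_iff extensional_def fun_eq_iff)
  show "ind_r (g \<otimes> h) s = ind_r g (ind_r h s)" if "g \<in> carrier G" "h \<in> carrier G" for g h s
    using that by (auto simp: ind_r_def fun_eq_iff G.inv_mult_group G.m_assoc)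
  show "ind_e A \<alpha> (ind_e A \<beta> s) = ind_e A \<alpha> s" if "\<alpha> \<in> E" "\<beta> \<in> E" "s \<in> carrier (ind A)" for \<alpha> \<beta> s
    using that sc by (auto simp: ind_e_def fun_eq_iff gen_relation[OF A p p])
  show "ind_r g (ind_e A \<alpha> s) = ind_e A (\<phi> g \<alpha>) (ind_r g s)"
    if g: "g \<in> carrier G" and \<alpha>: "\<alpha> \<in> E" and "s \<in> carrier (ind A)" for g \<alpha> s
  proof -
    have "\<phi> (inv (inv g \<otimes> k)) \<alpha> = \<phi> (inv k) (\<phi> g \<alpha>)" if "k \<in> carrier G" for k
      using that g composition_rule[OF \<alpha>, of "inv k" g] by (simp add: G.inv_mult_group)
    then show ?thesis using g by (auto simp: ind_r_def ind_e_def fun_eq_iff)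
  qed
qed

lemma ind_functorial:
  assumes A: "algebra_module K B A" and A': "algebra_module K B A'" and i: "equivariant_map K (carrier B) A A' i"
  shows "equivariant_map K (rep_syms G E) (ind A) (ind A') (\<lambda>s. \<lambda>k\<in>carrier G. i (s k))"
proof -
  note il = linear_mapD[OF equivariant_mapD(1)[OF i]]
  have ie: "i (opr A (cls (free_gen K \<beta>)) v) = opr A' (cls (free_gen K \<beta>)) (i v)"
    if "\<beta> \<in> E" "v \<in> carrier A" for \<beta> v
    using that gen_mem by (intro equivariant_mapD(2)[OF i]) (auto simp: B_simps(1))
  have pm: "s k \<in> carrier A" if "s \<in> carrier G \<rightarrow>\<^sub>E carrier A" "k \<in> carrier G" for s k
    using that by auto
  let ?i = "\<lambda>s. \<lambda>k\<in>carrier G. i (s k)"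
  have c: "?i s \<in> carrier (ind A')" if "s \<in> carrier (ind A)" for s
    using that il(1) by (auto simp: ind_simps(1))
  have "linear_map K (ind A) (ind A') ?i"
    using c by (intro linear_mapI) (auto simp: ind_simps(1,3,4) fun_eq_iff il(2,3) pm)
  moreover have "?i (eps (ind A) \<alpha> s) = eps (ind A') \<alpha> (?i s)" if "\<alpha> \<in> E" "s \<in> carrier (ind A)" for \<alpha> s
    unfolding ind_simps(6)[OF that(2)] ind_simps(6)[OF c[OF that(2)]] using that
    by (auto simp: ind_e_def ind_simps(1) fun_eq_iff ie \<phi>_closed pm)
  moreover have "?i (rg (ind A) g s) = rg (ind A') g (?i s)" if "g \<in> carrier G" "s \<in> carrier (ind A)" for g s
    unfolding ind_simps(5) using that by (auto simp: ind_r_def ind_simps(1) fun_eq_iff)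
  ultimately show ?thesis unfolding rep_equivariant_iff[OF ind_rep[OF A] ind_rep[OF A']] by blast
qed

text \<open>The adjoint of a homomorphism \<open>f\<close> of modules over the halo algebra:
  \<open>\<Sum> g \<otimes> s g \<mapsto> \<Sum> g f (s g)\<close>.\<close>

definition ind_adjoint ::
  "('k, 'w, ('g \<times> 'e) rep_sym) opmod \<Rightarrow> ('v \<Rightarrow> 'w) \<Rightarrow> ('g \<Rightarrow> 'v) \<Rightarrow> 'w"
  where "ind_adjoint M f s = (\<Oplus>\<^bsub>M\<^esub>k\<in>carrier G. rg M k (f (s k)))"

lemma ind_adjoint_equivariant:
  assumes A: "algebra_module K B A" and M: "rep M" and fin: "finite (carrier G)"
    and f: "equivariant_map K (carrier B) A (halo_module K G M) f"
  shows "equivariant_map K (rep_syms G E) (ind A) M (ind_adjoint M f)"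
proof -
  interpret M: module K M by (rule rep_module[OF M])
  have fl: "linear_map K A M f"
    using equivariant_mapD(1)[OF f] linear_map_cong[of A A "halo_module K G M" M f] by simp
  note fd = linear_mapD[OF fl]
  have fe: "f (opr A (cls (free_gen K \<beta>)) v) = eps M \<beta> (f v)" if "\<beta> \<in> E" "v \<in> carrier A" for \<beta> v
    using equivariant_mapD(2)[OF f, of "cls (free_gen K \<beta>)" v] gen_mem[OF that(1)]
      halo_module_gen[OF M that(1) fd(1)[OF that(2)]] that(2)
    by (simp add: B_simps(1))
  have t: "rg M k (f (s k)) \<in> carrier M" if "s \<in> carrier (ind A)" "k \<in> carrier G" for s k
    using that rg_closed[OF M] fd(1) by (auto simp: ind_simps(1))
  have sc: "s k \<in> carrier A" if "s \<in> carrier (ind A)" "k \<in> carrier G" for s k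
    using that by (auto simp: ind_simps(1))
  have "linear_map K (ind A) M (ind_adjoint M f)"
  proof (rule linear_mapI)
    fix s assume s: "s \<in> carrier (ind A)"
    then show "ind_adjoint M f s \<in> carrier M" unfolding ind_adjoint_def using t by auto
    fix s' assume s': "s' \<in> carrier (ind A)"
    have "ind_adjoint M f (s \<oplus>\<^bsub>ind A\<^esub> s') =
        (\<Oplus>\<^bsub>M\<^esub>k\<in>carrier G. rg M k (f (s k)) \<oplus>\<^bsub>M\<^esub> rg M k (f (s' k)))"
      unfolding ind_adjoint_def
      using t[OF s] t[OF s'] sc[OF s] sc[OF s'] fd(1)
      by (intro M.M.finsum_cong') (auto simp: ind_simps(3) fd(2) linear_mapD(2)[OF repD(2)[OF M]])
    then show "ind_adjoint M f (s \<oplus>\<^bsub>ind A\<^esub> s') = ind_adjoint M f s \<oplus>\<^bsub>M\<^esub> ind_adjoint M f s'"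
      using t[OF s] t[OF s'] unfolding ind_adjoint_def by (subst (asm) M.M.finsum_addf) auto
  next
    fix c s assume c: "c \<in> carrier K" and s: "s \<in> carrier (ind A)"
    have "ind_adjoint M f (c \<odot>\<^bsub>ind A\<^esub> s) = (\<Oplus>\<^bsub>M\<^esub>k\<in>carrier G. c \<odot>\<^bsub>M\<^esub> rg M k (f (s k)))"
      unfolding ind_adjoint_def using t[OF s] sc[OF s] fd(1) c
      by (intro M.M.finsum_cong') (auto simp: ind_simps(4) fd(3) linear_mapD(3)[OF repD(2)[OF M]])
    then show "ind_adjoint M f (c \<odot>\<^bsub>ind A\<^esub> s) = c \<odot>\<^bsub>M\<^esub> ind_adjoint M f s"
      using t[OF s] c fin unfolding ind_adjoint_def by (subst M.finsum_smult_ldistr) auto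
  qed
  moreover have "ind_adjoint M f (eps (ind A) \<alpha> s) = eps M \<alpha> (ind_adjoint M f s)"
    if \<alpha>: "\<alpha> \<in> E" and s: "s \<in> carrier (ind A)" for \<alpha> s
  proof -
    have "rg M k (f (ind_e A \<alpha> s k)) = eps M \<alpha> (rg M k (f (s k)))" if k: "k \<in> carrier G" for k
    proof -
      have p: "\<phi> (inv k) \<alpha> \<in> E" using \<phi>_closed \<alpha> k by simp
      show ?thesis
        using k fe[OF p sc[OF s k]] repD(7)[OF M k p fd(1)[OF sc[OF s k]]] \<phi>_inv(2)[OF k \<alpha>]
        by (simp add: ind_e_def)
    qed
    then have "ind_adjoint M f (ind_e A \<alpha> s) = (\<Oplus>\<^bsub>M\<^esub>k\<in>carrier G. eps M \<alpha> (rg M k (f (s k))))"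
      unfolding ind_adjoint_def using t[OF s] eps_closed[OF M \<alpha>]
      by (intro M.M.finsum_cong') auto
    also have "\<dots> = eps M \<alpha> (ind_adjoint M f s)"
      unfolding ind_adjoint_def using t[OF s]
      by (intro linear_map_finsum[OF rep_module[OF M] rep_module[OF M] repD(1)[OF M \<alpha>] fin, symmetric]) auto
    finally show ?thesis by (simp only: ind_simps(6)[OF s])
  qed
  moreover have "ind_adjoint M f (rg (ind A) g s) = rg M g (ind_adjoint M f s)"
    if g: "g \<in> carrier G" and s: "s \<in> carrier (ind A)" for g s
  proof -
    let ?u = "\<lambda>k. rg M k (f (s (inv g \<otimes> k)))"
    have u: "?u k \<in> carrier M" if "k \<in> carrier G" for k
      using that g rg_closed[OF M] fd(1) sc[OF s] by auto
    have im: "(\<otimes>) g ` carrier G = carrier G" by (rule G.surj_const_mult[OF g])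
    have "ind_adjoint M f (ind_r g s) = (\<Oplus>\<^bsub>M\<^esub>k\<in>carrier G. ?u k)"
      unfolding ind_adjoint_def using u by (intro M.M.finsum_cong') (auto simp: ind_r_def)
    also have "\<dots> = (\<Oplus>\<^bsub>M\<^esub>k\<in>carrier G. ?u (g \<otimes> k))"
      using M.M.finsum_reindex[of ?u "(\<otimes>) g" "carrier G"] G.inj_on_cmult[OF g] u by (simp add: im Pi_def)
    also have "\<dots> = (\<Oplus>\<^bsub>M\<^esub>k\<in>carrier G. rg M g (rg M k (f (s k))))"
    proof (rule M.M.finsum_cong'[OF refl])
      fix k assume k: "k \<in> carrier G"
      show "?u (g \<otimes> k) = rg M g (rg M k (f (s k)))"
        using repD(4)[OF M g k fd(1)[OF sc[OF s k]]] g k by (simp add: G.m_assoc[symmetric])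
    qed (use t[OF s] rg_closed[OF M g] in auto)
    also have "\<dots> = rg M g (ind_adjoint M f s)"
      unfolding ind_adjoint_def using t[OF s]
      by (intro linear_map_finsum[OF rep_module[OF M] rep_module[OF M] repD(2)[OF M g] fin, symmetric]) auto
    finally show ?thesis by (simp only: ind_simps(5))
  qed
  ultimately show ?thesis unfolding rep_equivariant_iff[OF ind_rep[OF A] M] by blast
qed

text \<open>The unit of the adjunction, \<open>a \<mapsto> 1 \<otimes> a\<close>.\<close>

definition ind_unit :: "('k, 'v, ('e list \<Rightarrow> 'k) set) opmod \<Rightarrow> 'v \<Rightarrow> 'g \<Rightarrow> 'v"
  where "ind_unit A a = (\<lambda>k\<in>carrier G. if k = \<one> then a else \<zero>\<^bsub>A\<^esub>)"

text \<open>Restriction to the halo algebra is right adjoint to \<open>ind\<close>, which preserves injective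
  maps. To extend \<open>f\<close> along \<open>i\<close>, its adjoint is extended along
  \<open>ind i\<close>, and the extension is composed with the unit.\<close>

lemma halo_injective:
  fixes M :: "('k, 'u, ('g \<times> 'e) rep_sym) opmod"
  assumes fin: "finite (carrier G)"
    and emb: "\<And>A :: ('k, 't, ('e list \<Rightarrow> 'k) set) opmod. module K A \<Longrightarrow>
      \<exists>j::('g \<Rightarrow> 't) \<Rightarrow> 't. inj_on j (carrier G \<rightarrow>\<^sub>E carrier A)"
    and M: "rep M"
    and inj: "injective_object K (rep_syms G E) (rep :: ('k, 't, ('g \<times> 'e) rep_sym) opmod \<Rightarrow> bool) M"
  shows "injective_object K (carrier B)
    (algebra_module K B :: ('k, 't, ('e list \<Rightarrow> 'k) set) opmod \<Rightarrow> bool) (halo_module K G M)"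
  unfolding injective_object_def
proof (intro allI impI, elim conjE)
  fix A A' :: "('k, 't, ('e list \<Rightarrow> 'k) set) opmod" and i f
  assume A: "algebra_module K B A" and A': "algebra_module K B A'"
    and i: "equivariant_map K (carrier B) A A' i" and i_inj: "inj_on i (carrier A)"
    and f: "equivariant_map K (carrier B) A (halo_module K G M) f"
  note Am = algebra_moduleD(1)[OF A] and A'm = algebra_moduleD(1)[OF A']
  interpret A: module K A by (rule Am)
  interpret A': module K A' by (rule A'm)
  interpret M: module K M by (rule rep_module[OF M])
  note il = equivariant_mapD(1)[OF i]
  let ?i = "\<lambda>s. \<lambda>k\<in>carrier G. i (s k)"
  have ci: "carrier (ind A) = carrier G \<rightarrow>\<^sub>E carrier A" "carrier (ind A') = carrier G \<rightarrow>\<^sub>E carrier A'"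
    by (auto simp: ind_simps(1))
  obtain j :: "('g \<Rightarrow> 't) \<Rightarrow> 't" and j' :: "('g \<Rightarrow> 't) \<Rightarrow> 't"
    where j: "inj_on j (carrier (ind A))" and j': "inj_on j' (carrier (ind A'))"
    unfolding ci using emb[OF Am] emb[OF A'm] by blast
  have "inj_on ?i (carrier (ind A))"
  proof (rule inj_onI)
    fix s s' assume s: "s \<in> carrier (ind A)" "s' \<in> carrier (ind A)" and eq: "?i s = ?i s'"
    show "s = s'"
      using s unfolding ci
    proof (rule PiE_ext)
      fix k assume k: "k \<in> carrier G"
      have "i (s k) = i (s' k)" using fun_cong[OF eq, of k] k by simp
      then show "s k = s' k" using inj_onD[OF i_inj] s k unfolding ci by (meson PiE_mem)
    qed
  qed
  from injective_object_universe[OF inj ind_rep[OF A] ind_rep[OF A'] j j' ind_functorial[OF A A' i] this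
      ind_adjoint_equivariant[OF A M fin f]]
  obtain h where h: "equivariant_map K (rep_syms G E) (ind A') M h"
    "\<And>s. s \<in> carrier (ind A) \<Longrightarrow> h (?i s) = ind_adjoint M f s" by blast
  note hd = h(1)[unfolded rep_equivariant_iff[OF ind_rep[OF A'] M]]
  have hl: "linear_map K (ind A') M h" using hd by blast
  have uc: "ind_unit A b \<in> carrier (ind A)" if "b \<in> carrier A" for b
    using that by (auto simp: ind_simps(1) ind_unit_def)
  have uc': "ind_unit A' b \<in> carrier (ind A')" if "b \<in> carrier A'" for b
    using that by (auto simp: ind_simps(1) ind_unit_def)
  have zero: "opr A' (cls (free_gen K \<alpha>)) \<zero>\<^bsub>A'\<^esub> = \<zero>\<^bsub>A'\<^esub>" if "\<alpha> \<in> E" for \<alpha>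
    by (rule linear_map_zero[OF A'm A'm algebra_moduleD(2)[OF A' gen_mem[OF that]]])
  let ?h = "\<lambda>b. h (ind_unit A' b)"
  have "linear_map K A' M ?h"
  proof (rule linear_mapI)
    show "?h b \<in> carrier M" if "b \<in> carrier A'" for b using linear_mapD(1)[OF hl uc'[OF that]] .
    have "ind_unit A' (b \<oplus>\<^bsub>A'\<^esub> c) = ind_unit A' b \<oplus>\<^bsub>ind A'\<^esub> ind_unit A' c" for b c
      by (auto simp: ind_unit_def ind_simps(3) fun_eq_iff)
    then show "?h (b \<oplus>\<^bsub>A'\<^esub> c) = ?h b \<oplus>\<^bsub>M\<^esub> ?h c" if "b \<in> carrier A'" "c \<in> carrier A'" for b c
      using linear_mapD(2)[OF hl uc'[OF that(1)] uc'[OF that(2)]] by simp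
    have "ind_unit A' (c \<odot>\<^bsub>A'\<^esub> b) = c \<odot>\<^bsub>ind A'\<^esub> ind_unit A' b" if "c \<in> carrier K" for c b
      using that by (auto simp: ind_unit_def ind_simps(4) fun_eq_iff)
    then show "?h (c \<odot>\<^bsub>A'\<^esub> b) = c \<odot>\<^bsub>M\<^esub> ?h b" if "c \<in> carrier K" "b \<in> carrier A'" for c b
      using linear_mapD(3)[OF hl that(1) uc'[OF that(2)]] that by simp
  qed
  then have "linear_map K A' (halo_module K G M) ?h"
    using linear_map_cong[of A' A' "halo_module K G M" M ?h] by simp
  moreover have "?h (opr A' (cls (free_gen K \<alpha>)) b) = opr (halo_module K G M) (cls (free_gen K \<alpha>)) (?h b)"
    if \<alpha>: "\<alpha> \<in> E" and b: "b \<in> carrier A'" for \<alpha> b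
  proof -
    have "ind_unit A' (opr A' (cls (free_gen K \<alpha>)) b) = ind_e A' \<alpha> (ind_unit A' b)"
      using \<phi>_one[OF \<alpha>] zero \<phi>_closed[OF _ \<alpha>] by (auto simp: ind_unit_def ind_e_def fun_eq_iff)
    also have "\<dots> = eps (ind A') \<alpha> (ind_unit A' b)" using ind_simps(6)[OF uc'[OF b]] by simp
    finally show ?thesis
      using hd \<alpha> uc'[OF b] halo_module_gen[OF M \<alpha> linear_mapD(1)[OF hl uc'[OF b]]] by metis
  qed
  ultimately have "equivariant_map K (carrier B) A' (halo_module K G M) ?h"
    by (intro equivariant_by_generators[OF A' halo_module_algebra_module[OF M]])
  moreover have "?h (i a) = f a" if a: "a \<in> carrier A" for a
  proof -
    have f0: "f \<zero>\<^bsub>A\<^esub> = \<zero>\<^bsub>M\<^esub>"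
      using linear_map_zero[OF Am algebra_moduleD(1)[OF halo_module_algebra_module[OF M]] equivariant_mapD(1)[OF f]]
      by simp
    have fa: "f a \<in> carrier M" using linear_mapD(1)[OF equivariant_mapD(1)[OF f] a] by simp
    have "ind_unit A' (i a) = ?i (ind_unit A a)"
      using linear_map_zero[OF Am A'm il] by (auto simp: ind_unit_def fun_eq_iff)
    then have "?h (i a) = ind_adjoint M f (ind_unit A a)" using h(2)[OF uc[OF a]] by simp
    also have "\<dots> = (\<Oplus>\<^bsub>M\<^esub>k\<in>carrier G. if k = \<one> then rg M k (f a) else \<zero>\<^bsub>M\<^esub>)"
      unfolding ind_adjoint_def using rg_closed[OF M _ fa]
        linear_map_zero[OF rep_module[OF M] rep_module[OF M] repD(2)[OF M]]
      by (intro M.M.finsum_cong') (auto simp: ind_unit_def f0)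
    also have "\<dots> = rg M \<one> (f a)"
      using fin rg_closed[OF M _ fa] by (intro M.M.add.finprod_singleton_swap) auto
    finally show ?thesis using repD(3)[OF M fa] by simp
  qed
  ultimately show "\<exists>h. equivariant_map K (carrier B) A' (halo_module K G M) h \<and> (\<forall>a\<in>carrier A. h (i a) = f a)"
    by blast
qed

lemma halo_injective_resolution:
  assumes fin: "finite (carrier G)"
    and emb: "\<And>A :: ('k, 't, ('e list \<Rightarrow> 'k) set) opmod. module K A \<Longrightarrow>
      \<exists>j::('g \<Rightarrow> 't) \<Rightarrow> 't. inj_on j (carrier G \<rightarrow>\<^sub>E carrier A)"
    and W: "rep W"
    and res: "injective_resolution K (rep_syms G E) rep
      (rep :: ('k, 't, ('g \<times> 'e) rep_sym) opmod \<Rightarrow> bool) W \<eta> R d"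
  shows "injective_resolution K (carrier B) (algebra_module K B)
    (algebra_module K B :: ('k, 't, ('e list \<Rightarrow> 'k) set) opmod \<Rightarrow> bool)
    (halo_module K G W) \<eta> (\<lambda>n. halo_module K G (R n)) d"
proof -
  note D = injective_resolutionD[OF res]
  have eq: "equivariant_map K (carrier B) (halo_module K G V) (halo_module K G V') f"
    if "rep V" "rep V'" "equivariant_map K (rep_syms G E) V V' f" for V V' f
    using that unfolding halo_equivariant_iff[OF that(1,2)] rep_equivariant_iff[OF that(1,2)] by blast
  have "cocycles (\<lambda>n. halo_module K G (R n)) d n = cocycles R d n" for n
    by (simp add: cocycles_def)
  then show ?thesis
    unfolding injective_resolution_def
    using D(5-7) halo_module_algebra_module[OF D(1)] halo_injective[OF fin emb D(1,2)]
      eq[OF W D(1) D(3)] eq[OF D(1) D(1) D(4)]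
    by simp
qed

end

section \<open>The spectral sequence of the digroup representations\<close>

theorem corollary60:
  fixes K :: "('k, 'a) ring_scheme"
    and G :: "('g, 'b) monoid_scheme"
    and E :: "'e set"
    and \<phi> :: "'g \<Rightarrow> 'e \<Rightarrow> 'e"
    and Q W :: "('k, 'u, ('g \<times> 'e) rep_sym) opmod"
    and \<eta> :: "'u \<Rightarrow> 'u"
    and I :: "nat \<Rightarrow> ('k, 'u, ('g \<times> 'e) rep_sym) opmod"
    and d :: "nat \<Rightarrow> 'u \<Rightarrow> 'u"
    and \<epsilon> :: "nat \<Rightarrow> ('u \<Rightarrow> 'u) \<Rightarrow> 'm"
    and J :: "nat \<Rightarrow> nat \<Rightarrow> ('k, 'm, 'g) opmod"
    and dv dh :: "nat \<Rightarrow> nat \<Rightarrow> 'm \<Rightarrow> 'm"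
  assumes "field K" and "\<And>n::nat. n > 0 \<Longrightarrow> [n] \<cdot>\<^bsub>K\<^esub> \<one>\<^bsub>K\<^esub> \<noteq> \<zero>\<^bsub>K\<^esub>"
    and "group G" and "finite (carrier G)"
    and "group_action G E \<phi>" and "E \<noteq> {}"
    and "digroup_rep K G E \<phi> Q" and "digroup_rep K G E \<phi> W"
    and "injective_resolution K (rep_syms G E)
      (digroup_rep K G E \<phi>) (digroup_rep K G E \<phi> :: ('k, 'u, ('g \<times> 'e) rep_sym) opmod \<Rightarrow> bool)
      W \<eta> I d"
    and "cartan_eilenberg K G
      (\<lambda>q. hom_halo K G E Q (I q)) (\<lambda>q. compose (carrier Q) (d q)) \<epsilon> J dv dh"
  shows "injective_resolution K (carrier (halo_algebra K E))
      (algebra_module K (halo_algebra K E))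
      (algebra_module K (halo_algebra K E) :: ('k, 'u, ('e list \<Rightarrow> 'k) set) opmod \<Rightarrow> bool)
      (halo_module K G W) \<eta> (\<lambda>n. halo_module K G (I n)) d \<and>
    (\<forall>p q :: nat. lin_iso K
      (ss_page (\<lambda>p q. fixed_space G (J p q)) dv dh 2 (int p) (int q))
      (group_cohomology G (ext_halo K G E Q I d q) p)) \<and>
    converges_to K (ss_page (\<lambda>p q. fixed_space G (J p q)) dv dh) (ext_rep K G E Q I d) \<and>
    collapses_at (ss_page (\<lambda>p q. fixed_space G (J p q)) dv dh)
      (ss_diff (\<lambda>p q. fixed_space G (J p q)) dv dh) 2 \<and>
    (\<forall>n :: nat. lin_iso K (ext_rep K G E Q I d n) (fixed_space G (ext_halo K G E Q I d n)))"
proof -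
  note Q = assms(7) and W = assms(8) and res = assms(9)
  have fg: "finite_group_char_zero K G"
    using assms(1-4) by (rule finite_group_char_zero.intro)
  interpret fg: finite_group_char_zero K G by (rule fg)
  have "digroup_action K G E \<phi>"
    by (intro digroup_action.intro words.intro fg.K.is_cring assms(5) digroup_action_axioms.intro assms(6))
  then interpret dg: digroup_action K G E \<phi> .
  note R = injective_resolutionD[OF res]
  let ?C = "\<lambda>q. hom_halo K G E Q (I q)" and ?\<delta> = "\<lambda>q. compose (carrier Q) (d q)"
  have "cartan_eilenberg_resolution K G ?C ?\<delta> \<epsilon> J dv dh"
    by (intro cartan_eilenberg_resolution.intro group_complex.intro group_complex_axioms.intro
        cartan_eilenberg_resolution_axioms.intro fg dg.hom_halo_group_module dg.hom_halo_compose Q R(1,4) assms(10))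
  then interpret ce: cartan_eilenberg_resolution K G ?C ?\<delta> \<epsilon> J dv dh .
  interpret inv: resolved_double_complex K "\<lambda>p q. fixed_space G (J p q)" dv dh "\<lambda>n. fixed_space G (?C n)" ?\<delta> \<epsilon>
    by (rule ce.invariants_resolved)
  let ?page = "ss_page (\<lambda>p q. fixed_space G (J p q)) dv dh"
  have halo: "ext_halo K G E Q I d = cohomology_ops ?C ?\<delta>"
    by (simp add: fun_eq_iff ext_halo_def)
  have ext_rep: "ext_rep K G E Q I d = cohomology (\<lambda>n. fixed_space G (?C n)) ?\<delta>"
  proof
    fix n
    have "cohomology (\<lambda>n. hom_space K (rep_syms G E) Q (I n)) ?\<delta> n = cohomology (\<lambda>n. fixed_space G (?C n)) ?\<delta> n"
      by (rule cohomology_cong)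
        (simp_all only: dg.invariant_hom[OF Q R(1)] fixed_space_simps fun_eq_iff hom_space_simps
          dg.hom_halo_simps[OF Q R(1)] simp_thms)
    then show "ext_rep K G E Q I d n = cohomology (\<lambda>n. fixed_space G (?C n)) ?\<delta> n"
      by (simp add: ext_rep_def)
  qed
  have coh_module: "module K (cohomology (\<lambda>n. fixed_space G (?C n)) ?\<delta> n)" for n
    by (rule cohomology_module[where C="\<lambda>n. fixed_space G (?C n)", OF ce.inv_mod ce.inv_\<delta>])
  have E2: "lin_iso K (?page 2 (int p) (int q)) (group_cohomology G (ext_halo K G E Q I d q) p)" for p q
  proof -
    let ?M = "cohomology_ops ?C ?\<delta> q"
    have M: "group_module K G ?M" by (rule ce.cohomology_group_module)
    note gm = group_cohomology_module[OF fg.K.is_cring assms(3) M]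
    show ?thesis
      unfolding halo
    proof (cases "p = 0")
      case True
      have "lin_iso K (?page 2 0 (int q)) (cohomology (\<lambda>n. fixed_space G (?C n)) ?\<delta> q)"
        by (rule lin_iso_sym[OF coh_module inv.edge_iso]) simp
      moreover note ce.invariant_cohomology[of q]
      moreover have "lin_iso K (fixed_space G ?M) (group_cohomology G ?M 0)"
        by (rule lin_iso_sym[OF gm group_cohomology_0[OF fg.K.is_cring assms(3) M]])
      ultimately show "lin_iso K (?page 2 (int p) (int q)) (group_cohomology G ?M p)"
        using True by (auto intro: lin_iso_trans)
    next
      case False
      have "lin_iso K (?page 2 (int p) (int p + int q - int p)) (group_cohomology G ?M p)"
        using False by (intro lin_iso_zero_spaces inv.page_module gm inv.page_zero fg.group_cohomology_pos M) auto
      then show "lin_iso K (?page 2 (int p) (int q)) (group_cohomology G ?M p)" by simp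
    qed
  qed
  show ?thesis
    using dg.halo_injective_resolution[OF assms(4) fg.functions_embed W res]
      E2 inv.convergence inv.collapse ce.invariant_cohomology
    unfolding ext_rep halo by blast
qed

end
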